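(* Let $\zeta(\theta)=13\cos(2\theta)-\cos(4\theta)$ and, for small $t>0$, let $\Omega=\{x\in\mathbb{R}^2: r<1+t\zeta(\theta)\}$, a smooth domain symmetric about both coordinate axes, where $(r,\theta)$ are polar coordinates of $x$. Let $u$ be the torsion function of $\Omega$. Then there exists $t_0>0$ such that for $0<t<t_0$, $|\nabla u|$ is strictly monotone along $\Gamma^{++}=\partial\Omega\cap\{x_1\ge 0,\ x_2\ge 0\}$, while the curvature of $\partial\Omega$ is not monotone along $\Gamma^{++}$.
   Context: The torsion function of a bounded domain $\Omega$ is the solution $u$ of $-\Delta u=1$ in $\Omega$, $u=0$ on $\partial\Omega$. Monotonicity along $\Gamma^{++}$ is understood with respect to the polar angle $\theta\in[0,\pi/2]$ of the boundary point $(r,\theta)$, $r=1+t\zeta(\theta)$. *)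

theory Defs
  imports "HOL-Analysis.Analysis"
begin

section \<open>Calculus on open subsets of Euclidean space\<close>

definition pd :: "'n::finite \<Rightarrow> (real ^ 'n \<Rightarrow> real) \<Rightarrow> real ^ 'n \<Rightarrow> real" where
  "pd i f x = frechet_derivative f (at x) (axis i 1)"

text \<open>Class \<open>C\<^sup>k\<close> on an \<^emph>\<open>open\<close> set \<open>S\<close>; the list \<open>is\<close> is a multi-index of differentiation directions.\<close>

definition Ck_on :: "nat \<Rightarrow> (real ^ 'n::finite) set \<Rightarrow> (real ^ 'n \<Rightarrow> real) \<Rightarrow> bool" where
  "Ck_on k S f \<longleftrightarrow>
     (\<forall>is. (length is < k \<longrightarrow> foldr pd is f differentiable_on S) \<and>
           (length is \<le> k \<longrightarrow> continuous_on S (foldr pd is f)))"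

definition laplacian :: "(real ^ 'n::finite \<Rightarrow> real) \<Rightarrow> real ^ 'n \<Rightarrow> real" where
  "laplacian f x = (\<Sum>i\<in>UNIV. pd i (pd i f) x)"

text \<open>\<open>g\<close> is the continuous gradient of \<open>f\<close> on \<open>S\<close>, one-sided where \<open>S\<close> has boundary points.
  On the closure of a smooth domain \<open>g\<close> is uniquely determined by \<open>f\<close>, and its values on the
  boundary are the limits of the interior gradient.\<close>

definition gradient_on :: "(real ^ 'n::finite) set \<Rightarrow> (real ^ 'n \<Rightarrow> real) \<Rightarrow> (real ^ 'n \<Rightarrow> real ^ 'n) \<Rightarrow> bool" where
  "gradient_on S f g \<longleftrightarrow>
     continuous_on S g \<and> (\<forall>x\<in>S. (f has_derivative (\<lambda>h. g x \<bullet> h)) (at x within S))"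

definition bounded_smooth_domain :: "(real ^ 'n::finite) set \<Rightarrow> bool" where
  "bounded_smooth_domain \<Omega> \<longleftrightarrow>
     \<Omega> \<noteq> {} \<and> open \<Omega> \<and> connected \<Omega> \<and> bounded \<Omega> \<and>
     (\<forall>p\<in>frontier \<Omega>. \<exists>U \<phi>. open U \<and> p \<in> U \<and> (\<forall>k. Ck_on k U \<phi>) \<and>
        (\<exists>i. pd i \<phi> p \<noteq> 0) \<and> \<Omega> \<inter> U = {x \<in> U. \<phi> x < 0})"

text \<open>Values of \<open>u\<close> outside the closure of \<open>\<Omega>\<close> are irrelevant.\<close>

definition torsion_function :: "(real ^ 'n::finite) set \<Rightarrow> (real ^ 'n \<Rightarrow> real) \<Rightarrow> bool" where
  "torsion_function \<Omega> u \<longleftrightarrow>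
     Ck_on 2 \<Omega> u \<and> continuous_on (closure \<Omega>) u \<and>
     (\<forall>x\<in>\<Omega>. - laplacian u x = 1) \<and> (\<forall>x\<in>frontier \<Omega>. u x = 0)"

section \<open>Plane curves\<close>

text \<open>Signed curvature of a regular plane curve; positive for counterclockwise convex curves.\<close>

definition curvature :: "(real \<Rightarrow> real ^ 2) \<Rightarrow> real \<Rightarrow> real" where
  "curvature \<gamma> s =
     (let v = vector_derivative \<gamma> (at s);
          a = vector_derivative (\<lambda>s. vector_derivative \<gamma> (at s)) (at s)
      in (v $ 1 * a $ 2 - v $ 2 * a $ 1) / norm v ^ 3)"

section \<open>The perturbed disc\<close>

definition polar :: "real \<Rightarrow> real \<Rightarrow> real ^ 2" where
  "polar r \<theta> = vector [r * cos \<theta>, r * sin \<theta>]"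

definition zeta :: "real \<Rightarrow> real" where
  "zeta \<theta> = 13 * cos (2 * \<theta>) - cos (4 * \<theta>)"

definition Omega :: "real \<Rightarrow> (real ^ 2) set" where
  "Omega t = {polar r \<theta> | r \<theta>. 0 \<le> r \<and> r < 1 + t * zeta \<theta>}"

definition bdry_point :: "real \<Rightarrow> real \<Rightarrow> real ^ 2" where
  "bdry_point t \<theta> = polar (1 + t * zeta \<theta>) \<theta>"

definition Gamma_pp :: "real \<Rightarrow> (real ^ 2) set" where
  "Gamma_pp t = frontier (Omega t) \<inter> {x. x $ 1 \<ge> 0 \<and> x $ 2 \<ge> 0}"

definition symmetric_both_axes :: "(real ^ 2) set \<Rightarrow> bool" where
  "symmetric_both_axes S \<longleftrightarrow>
     (\<forall>x y. vector [x, y] \<in> S \<longrightarrow> vector [x, - y] \<in> S \<and> vector [- x, y] \<in> S)"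

end

theory Submission
  imports Defs "HOL-Complex_Analysis.Complex_Analysis" "HOL-Real_Asymp.Real_Asymp"
begin

text \<open>
  The domain is mapped conformally from the unit disc by \<open>f z = z exp (G z)\<close>, where \<open>G = a + i b\<close> on the
  unit circle, with \<open>b\<close> the conjugate function of \<open>a\<close>. That \<open>f\<close> maps the circle onto the boundary curve
  means \<open>exp a = 1 + t zeta (\<phi> + b)\<close> (Theodorsen's equation). In the Wiener algebra of Laurent series with
  \<open>\<Sum>n. \<bar>a\<^sub>n\<bar> 2\<^bsup>\<bar>n\<bar>\<^esup> < \<infinity>\<close>, conjugation is bounded, so for small \<open>t\<close> this is solved by the contraction
  principle, with \<open>a = t zeta + O(t\<^sup>2)\<close>, and \<open>f\<close> extends conformally beyond the closed disc. The torsion function is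
  \<open>- \<bar>x\<bar>\<^sup>2 / 4 + Re (H (f\<^sup>-\<^sup>1 x))\<close>, where \<open>Re H = exp (2 a) / 4\<close> on the circle.

  The squared norm of the gradient at \<open>f (exp (i \<phi>))\<close> extends to a holomorphic function of \<open>\<phi>\<close> in a strip, equal to
  \<open>1/4 + t (3/2 cos 4\<phi> - 13/2 cos 2\<phi>) + O(t\<^sup>2)\<close>. The first-order term has derivative
  \<open>t sin 2\<phi> (13 - 12 cos 2\<phi>) \<ge> t sin 2\<phi>\<close>, and by symmetry the derivative of the error vanishes at \<open>0\<close> and \<open>\<pi>/2\<close>,
  hence is \<open>O(t\<^sup>2 sin 2\<phi>)\<close>. The curvature is \<open>1 + t (39 cos 2\<theta> - 15 cos 4\<theta>) + O(t\<^sup>2)\<close>, whose first-order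
  coefficient takes the values \<open>24, 27, -54\<close> at \<open>0, \<pi>/6, \<pi>/2\<close>.
\<close>

text \<open>For \<alpha> cos 2\<theta> - cos 4\<theta> in place of zeta, the first-order term of the
  squared gradient has derivative sin 2\<phi> (\<alpha> - 12 cos 2\<phi>), and that of the curvature
  has derivative 6 sin 2\<theta> (20 cos 2\<theta> - \<alpha>). Every \<alpha> strictly between 12
  and 20 separates the two behaviours; 13 lies in this window. The obstacle is that the gradient is
  needed up to the boundary, with two angular derivatives of the error under control. The weights
  2^|n| settle this without boundary regularity theory: all functions are holomorphic on a
  neighbourhood of the circle that does not depend on t, so sup bounds of order t^2 pass to
  derivatives by Cauchy's estimates. The two reflections of the domain become invariance of the
  fixed point under z \<mapsto> 1/z and z \<mapsto> -z. An arbitrary torsion function is identified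
  with the constructed one by the maximum principle. Monotonicity in \<phi> carries over to the
  polar angle because the boundary correspondence is increasing and fixes 0 and \<pi>/2.\<close>

no_notation Infinite_Set_Sum.abs_summable_on (infix "abs'_summable'_on" 50)

section \<open>A weighted Wiener algebra\<close>

text \<open>The bijection between (n, k) and (k, n - k) carries this family to the product family
  \<open>f k * g m\<close>, which is summable row by row.\<close>

lemma conv_summable:
  fixes f g :: "int \<Rightarrow> 'c::{real_normed_field,banach}"
  assumes f: "f abs_summable_on UNIV" and g: "g abs_summable_on UNIV"
  shows "(\<lambda>(n, k). f k * g (n - k)) abs_summable_on (UNIV \<times> UNIV)"
proof -
  have "(\<lambda>(k, m). f k * g m) abs_summable_on (UNIV \<times> UNIV)"
    unfolding Infinite_Sum.abs_summable_on_Sigma_iff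
  proof (intro conjI ballI)
    fix k show "(\<lambda>m. case (k, m) of (k, m) \<Rightarrow> f k * g m) abs_summable_on UNIV"
      using summable_on_cmult_right[OF g, of "norm (f k)"] by (simp add: norm_mult)
  next
    have "(\<lambda>k. norm (f k) * infsum (\<lambda>m. norm (g m)) UNIV) summable_on UNIV"
      by (intro summable_on_cmult_left f)
    then show "(\<lambda>k. \<Sum>\<^sub>\<infinity>m. norm (case (k, m) of (k, m) \<Rightarrow> f k * g m)) abs_summable_on UNIV"
      by (simp add: norm_mult infsum_cmult_right' infsum_nonneg)
  qed
  also have "?this \<longleftrightarrow> ?thesis"
    by (intro summable_on_reindex_bij_witness[where i = "\<lambda>(n, k). (k, n - k)" and j = "\<lambda>(k, m). (k + m, k)"]) auto
  finally show ?thesis .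
qed

text \<open>Fubini for the double family: for fixed \<open>k\<close> the sum over \<open>n\<close>
  is a shifted copy of the sum of \<open>g\<close>.\<close>

lemma conv_infsum:
  fixes f g :: "int \<Rightarrow> 'c::{real_normed_field,banach}"
  assumes f: "f abs_summable_on UNIV" and g: "g abs_summable_on UNIV"
  shows "infsum (\<lambda>n. infsum (\<lambda>k. f k * g (n - k)) UNIV) UNIV = infsum f UNIV * infsum g UNIV"
    and "(\<lambda>n. infsum (\<lambda>k. f k * g (n - k)) UNIV) summable_on UNIV"
proof -
  have s: "(\<lambda>(n, k). f k * g (n - k)) summable_on (UNIV \<times> UNIV)"
    by (rule abs_summable_summable[OF conv_summable[OF assms]])
  have sh: "infsum (\<lambda>n. g (n - k)) UNIV = infsum g UNIV" for k
    by (rule infsum_reindex_bij_witness[where i = "\<lambda>n. n + k" and j = "\<lambda>n. n - k"]) auto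
  show "infsum (\<lambda>n. infsum (\<lambda>k. f k * g (n - k)) UNIV) UNIV = infsum f UNIV * infsum g UNIV"
    by (subst infsum_swap_banach[OF s]) (simp add: infsum_cmult_right' sh infsum_cmult_left')
  show "(\<lambda>n. infsum (\<lambda>k. f k * g (n - k)) UNIV) summable_on UNIV"
    using summable_on_Sigma_banach[OF s] by simp
qed

text \<open>Submultiplicativity of the weight makes the weighted l1 space a Banach algebra under
  convolution, and 2^|n| dominates |z^n| on 1/2 \<le> |z| \<le> 2. Elements are therefore Laurent
  series that converge absolutely on a fixed annulus around the unit circle.\<close>

definition wt :: "int \<Rightarrow> real" where "wt n = 2 ^ nat \<bar>n\<bar>"

lemma wt_pos: "wt n > 0" by (simp add: wt_def)
lemma wt_ge_1: "wt n \<ge> 1" by (simp add: wt_def)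
lemma wt_minus [simp]: "wt (- n) = wt n" by (simp add: wt_def)

lemma wt_add: "wt (m + n) \<le> wt m * wt n"
proof -
  have "nat \<bar>m + n\<bar> \<le> nat \<bar>m\<bar> + nat \<bar>n\<bar>" by linarith
  then have "(2::real) ^ nat \<bar>m + n\<bar> \<le> 2 ^ (nat \<bar>m\<bar> + nat \<bar>n\<bar>)" by (intro power_increasing) auto
  then show ?thesis by (simp add: wt_def power_add)
qed

text \<open>Real coefficients suffice because the domain is symmetric about the x1-axis: sequences
  invariant under n \<mapsto> -n are real cosine series on the circle, and i times the conjugate
  series has real coefficients again.\<close>

typedef wl = "{a :: int \<Rightarrow> real. (\<lambda>n. a n * wt n) abs_summable_on UNIV}"
  morphisms coef Abs_wl
  by (rule exI[of _ "\<lambda>_. 0"]) simp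

setup_lifting type_definition_wl

lemma coef_summable: "(\<lambda>n. coef a n * wt n) abs_summable_on UNIV"
  using coef by blast

lemma coef_summable': "(\<lambda>n. \<bar>coef a n\<bar> * wt n) summable_on UNIV"
  using coef_summable[of a] wt_pos by (simp add: abs_mult less_imp_le)

lemma wl_eqI: "(\<And>n. coef a n = coef b n) \<Longrightarrow> a = b"
  by (simp add: coef_inject[symmetric] fun_eq_iff)

lemma coef_abs_summable: "coef a abs_summable_on UNIV"
proof (rule Infinite_Sum.abs_summable_on_comparison_test[OF coef_summable[of a]])
  show "norm (coef a n) \<le> norm (coef a n * wt n)" for n
    using mult_left_mono[OF wt_ge_1[of n], of "\<bar>coef a n\<bar>"] wt_pos[of n] by (simp add: abs_mult)
qed

lemma wl_summable_add:
  assumes "(\<lambda>n. a n * wt n) abs_summable_on UNIV" "(\<lambda>n. b n * wt n) abs_summable_on UNIV"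
  shows "(\<lambda>n. (a n + b n) * wt n) abs_summable_on UNIV"
  by (rule Infinite_Sum.abs_summable_on_comparison_test'[OF summable_on_add[OF assms]])
     (metis distrib_right norm_triangle_ineq)

instantiation wl :: real_vector
begin
lift_definition zero_wl :: wl is "\<lambda>_. 0" by simp
lift_definition plus_wl :: "wl \<Rightarrow> wl \<Rightarrow> wl" is "\<lambda>a b n. a n + b n"
  by (rule wl_summable_add)
lift_definition uminus_wl :: "wl \<Rightarrow> wl" is "\<lambda>a n. - a n" by simp
lift_definition minus_wl :: "wl \<Rightarrow> wl \<Rightarrow> wl" is "\<lambda>a b n. a n - b n"
  subgoal for a b using wl_summable_add[of a "\<lambda>n. - b n"] by simp
  done
lift_definition scaleR_wl :: "real \<Rightarrow> wl \<Rightarrow> wl" is "\<lambda>c a n. c * a n"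
  by (simp add: abs_mult mult.assoc summable_on_cmult_right)
instance
  by standard (transfer; simp add: fun_eq_iff algebra_simps)+
end

lemma coef_simps [simp]:
  "coef 0 n = 0" "coef (a + b) n = coef a n + coef b n" "coef (- a) n = - coef a n"
  "coef (a - b) n = coef a n - coef b n" "coef (c *\<^sub>R a) n = c * coef a n"
  by (transfer; simp)+

instantiation wl :: real_normed_vector
begin
definition norm_wl :: "wl \<Rightarrow> real" where "norm_wl a = infsum (\<lambda>n. \<bar>coef a n\<bar> * wt n) UNIV"
definition sgn_wl :: "wl \<Rightarrow> wl" where "sgn_wl a = a /\<^sub>R norm a"
definition dist_wl :: "wl \<Rightarrow> wl \<Rightarrow> real" where "dist_wl a b = norm (a - b)"
definition uniformity_wl :: "(wl \<times> wl) filter" where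
  "uniformity_wl = (INF e\<in>{0 <..}. principal {(x, y). dist x y < e})"
definition open_wl :: "wl set \<Rightarrow> bool" where
  "open_wl U = (\<forall>x\<in>U. eventually (\<lambda>(x', y). x' = x \<longrightarrow> y \<in> U) uniformity)"
instance
proof
  fix a b :: wl and c :: real
  show "norm a = 0 \<longleftrightarrow> a = 0"
  proof
    assume "norm a = 0"
    then have "\<bar>coef a n\<bar> * wt n = 0" for n
      unfolding norm_wl_def
      by (intro nonneg_infsum_le_0D[OF _ coef_summable']) (auto simp: wt_pos less_imp_le)
    then show "a = 0" by (intro wl_eqI) (simp add: wt_def)
  qed (simp add: norm_wl_def)
  have "norm (a + b) \<le> infsum (\<lambda>n. \<bar>coef a n\<bar> * wt n + \<bar>coef b n\<bar> * wt n) UNIV"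
    unfolding norm_wl_def
    by (intro infsum_mono coef_summable' summable_on_add)
       (simp add: wt_pos flip: distrib_right)
  then show "norm (a + b) \<le> norm a + norm b"
    by (simp add: norm_wl_def infsum_add coef_summable')
  show "norm (c *\<^sub>R a) = \<bar>c\<bar> * norm a"
    by (simp add: norm_wl_def abs_mult mult.assoc infsum_cmult_right')
qed (auto simp: sgn_wl_def dist_wl_def uniformity_wl_def open_wl_def)
end

lemma sum_coef_le_norm: "finite F \<Longrightarrow> (\<Sum>n\<in>F. \<bar>coef a n\<bar> * wt n) \<le> norm a"
  unfolding norm_wl_def by (intro finite_sum_le_infsum coef_summable') (auto simp: wt_pos less_imp_le)

lemma coef_le_norm: "\<bar>coef a n\<bar> \<le> norm a"
  using sum_coef_le_norm[of "{n}" a] mult_left_mono[OF wt_ge_1[of n], of "\<bar>coef a n\<bar>"] by simp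

lemma norm_wl_leI:
  assumes "\<And>F. finite F \<Longrightarrow> (\<Sum>n\<in>F. \<bar>coef a n\<bar> * wt n) \<le> B"
  shows "norm a \<le> B"
  unfolding norm_wl_def by (intro infsum_le_finite_sums coef_summable' assms)

text \<open>Completeness as for l1: coefficients converge one by one, and bounds on finite partial
  sums survive the limit. This gives both membership of the limit in the space and convergence in
  norm.\<close>

instance wl :: banach
proof
  fix X :: "nat \<Rightarrow> wl"
  assume C: "Cauchy X"
  have "Cauchy (\<lambda>i. coef (X i) n)" for n
    unfolding Cauchy_def
  proof (intro allI impI)
    fix e :: real assume "e > 0"
    then obtain M where M: "\<And>i j. i \<ge> M \<Longrightarrow> j \<ge> M \<Longrightarrow> norm (X i - X j) < e"
      using C unfolding Cauchy_def dist_norm by blast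
    show "\<exists>M. \<forall>i\<ge>M. \<forall>j\<ge>M. dist (coef (X i) n) (coef (X j) n) < e"
    proof (intro exI allI impI)
      fix i j assume "i \<ge> M" "j \<ge> M"
      then show "dist (coef (X i) n) (coef (X j) n) < e"
        using M[of i j] coef_le_norm[of "X i - X j" n] by (simp add: dist_real_def)
    qed
  qed
  then obtain x where x: "\<And>n. (\<lambda>i. coef (X i) n) \<longlonglongrightarrow> x n"
    unfolding Cauchy_convergent_iff convergent_def by metis
  have fin: "(\<Sum>n\<in>F. \<bar>coef (X i) n - x n\<bar> * wt n) \<le> e"
    if "finite F" "\<And>j. j \<ge> M \<Longrightarrow> norm (X i - X j) < e" for F i M e
  proof (rule tendsto_upperbound)
    show "(\<lambda>j. \<Sum>n\<in>F. \<bar>coef (X i) n - coef (X j) n\<bar> * wt n) \<longlonglongrightarrow> (\<Sum>n\<in>F. \<bar>coef (X i) n - x n\<bar> * wt n)"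
      by (intro tendsto_intros x)
    show "\<forall>\<^sub>F j in sequentially. (\<Sum>n\<in>F. \<bar>coef (X i) n - coef (X j) n\<bar> * wt n) \<le> e"
      unfolding eventually_sequentially
    proof (intro exI allI impI)
      fix j assume "j \<ge> M"
      then show "(\<Sum>n\<in>F. \<bar>coef (X i) n - coef (X j) n\<bar> * wt n) \<le> e"
        using that(2)[of j] sum_coef_le_norm[OF that(1), of "X i - X j"] by simp
    qed
  qed auto
  obtain M0 where M0: "\<And>i j. i \<ge> M0 \<Longrightarrow> j \<ge> M0 \<Longrightarrow> norm (X i - X j) < 1"
    using C unfolding Cauchy_def dist_norm by (meson zero_less_one)
  \<comment> \<open>The limit sequence is obtained from \<open>X M0\<close> by subtracting a
    difference whose weighted partial sums are at most 1.\<close>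
  have d: "(\<lambda>n. (coef (X M0) n - x n) * wt n) abs_summable_on UNIV"
  proof (rule nonneg_bdd_above_summable_on)
    show "bdd_above (sum (\<lambda>n. norm ((coef (X M0) n - x n) * wt n)) ` {F. F \<subseteq> UNIV \<and> finite F})"
      using fin[of _ M0 M0 1] M0 wt_pos by (intro bdd_aboveI2[where M = 1]) (auto simp: abs_mult less_imp_le)
  qed auto
  have "(\<lambda>n. x n * wt n) abs_summable_on UNIV"
    by (rule Infinite_Sum.abs_summable_on_comparison_test'[OF summable_on_add[OF coef_summable[of "X M0"] d]])
       (smt (verit) left_diff_distrib norm_triangle_ineq4 real_norm_def)
  then have cx: "coef (Abs_wl x) n = x n" for n
    by (simp add: Abs_wl_inverse)
  have "X \<longlonglongrightarrow> Abs_wl x"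
    unfolding LIMSEQ_def
  proof (intro allI impI)
    fix e :: real assume "e > 0"
    then have "e / 2 > 0" by simp
    then obtain M where M: "\<And>i j. i \<ge> M \<Longrightarrow> j \<ge> M \<Longrightarrow> norm (X i - X j) < e / 2"
      using C unfolding Cauchy_def dist_norm by blast
    show "\<exists>M. \<forall>i\<ge>M. dist (X i) (Abs_wl x) < e"
    proof (intro exI allI impI)
      fix i assume "i \<ge> M"
      have "norm (X i - Abs_wl x) \<le> e / 2"
        by (rule norm_wl_leI) (use fin[of _ M i "e / 2"] M \<open>i \<ge> M\<close> in \<open>auto simp: cx\<close>)
      then show "dist (X i) (Abs_wl x) < e" using \<open>e > 0\<close> by (simp add: dist_norm)
    qed
  qed
  then show "convergent X" by (auto simp: convergent_def)
qed

text \<open>The inequality \<open>wt n \<le> wt k * wt (n - k)\<close> moves the weight inside the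
  convolution. What remains is the convolution of the two nonnegative l1 sequences \<open>f\<close>
  and \<open>g\<close>, whose total is the product of the norms.\<close>

lemma conv_le:
  fixes a b :: "int \<Rightarrow> real"
  assumes a: "(\<lambda>n. a n * wt n) abs_summable_on UNIV" and b: "(\<lambda>n. b n * wt n) abs_summable_on UNIV"
  shows "(\<lambda>n. (\<Sum>\<^sub>\<infinity>k. a k * b (n - k)) * wt n) abs_summable_on UNIV"
    and "(\<Sum>\<^sub>\<infinity>n. \<bar>\<Sum>\<^sub>\<infinity>k. a k * b (n - k)\<bar> * wt n)
           \<le> (\<Sum>\<^sub>\<infinity>n. \<bar>a n\<bar> * wt n) * (\<Sum>\<^sub>\<infinity>n. \<bar>b n\<bar> * wt n)"
proof -
  define f where "f n = \<bar>a n\<bar> * wt n" for n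
  define g where "g n = \<bar>b n\<bar> * wt n" for n
  have f: "f abs_summable_on UNIV" and g: "g abs_summable_on UNIV"
    using a b wt_pos by (simp_all add: f_def g_def abs_mult less_imp_le)
  have s: "(\<lambda>k. f k * g (n - k)) summable_on UNIV" for n
    using conv_summable[OF f g] unfolding Infinite_Sum.abs_summable_on_Sigma_iff
    by (metis (no_types, lifting) UNIV_I abs_summable_summable case_prod_conv summable_on_cong)
  have pt: "\<bar>a k * b (n - k)\<bar> * wt n \<le> f k * g (n - k)" for n k
  proof -
    have "\<bar>a k * b (n - k)\<bar> * wt n \<le> \<bar>a k * b (n - k)\<bar> * (wt k * wt (n - k))"
      using wt_add[of k "n - k"] by (intro mult_left_mono) auto
    then show ?thesis by (simp add: f_def g_def abs_mult mult_ac)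
  qed
  have le: "\<bar>\<Sum>\<^sub>\<infinity>k. a k * b (n - k)\<bar> * wt n \<le> (\<Sum>\<^sub>\<infinity>k. f k * g (n - k))" for n
  proof -
    have "\<bar>\<Sum>\<^sub>\<infinity>k. a k * b (n - k)\<bar> * wt n = norm (\<Sum>\<^sub>\<infinity>k. a k * b (n - k) * wt n)"
      using wt_pos[of n] by (simp add: infsum_cmult_left' abs_mult)
    also have "\<dots> \<le> (\<Sum>\<^sub>\<infinity>k. f k * g (n - k))"
      using pt[of _ n] wt_pos[of n] s
      by (intro norm_infsum_le[OF has_sum_infsum has_sum_infsum])
         (auto simp: abs_mult intro!: abs_summable_summable
            Infinite_Sum.abs_summable_on_comparison_test'[OF s[of n]])
    finally show ?thesis .
  qed
  note S = conv_infsum[OF f g]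
  show s1: "(\<lambda>n. (\<Sum>\<^sub>\<infinity>k. a k * b (n - k)) * wt n) abs_summable_on UNIV"
    by (rule Infinite_Sum.abs_summable_on_comparison_test'[OF S(2)]) (use le wt_pos in \<open>auto simp: abs_mult less_imp_le\<close>)
  show "(\<Sum>\<^sub>\<infinity>n. \<bar>\<Sum>\<^sub>\<infinity>k. a k * b (n - k)\<bar> * wt n)
           \<le> (\<Sum>\<^sub>\<infinity>n. \<bar>a n\<bar> * wt n) * (\<Sum>\<^sub>\<infinity>n. \<bar>b n\<bar> * wt n)"
    using infsum_mono[OF _ S(2) le] s1 S(1) wt_pos
    by (simp add: f_def g_def abs_mult less_imp_le cong: infsum_cong)
qed

lemma infsum_single':
  fixes f :: "'a \<Rightarrow> 'b::{comm_monoid_add, t2_space}"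
  assumes "\<And>k. k \<noteq> m \<Longrightarrow> f k = 0"
  shows "infsum f UNIV = f m"
  using infsum_cong_neutral[of "{m}" UNIV f f] assms by simp

lemma coef_conv_summable: "(\<lambda>k. coef a k * coef b (n - k)) summable_on UNIV"
  using conv_summable[OF coef_abs_summable[of a] coef_abs_summable[of b]]
  unfolding Infinite_Sum.abs_summable_on_Sigma_iff
  by (metis (no_types, lifting) UNIV_I abs_summable_summable case_prod_conv summable_on_cong)

instantiation wl :: comm_ring_1
begin
lift_definition times_wl :: "wl \<Rightarrow> wl \<Rightarrow> wl" is "\<lambda>a b n. \<Sum>\<^sub>\<infinity>k. a k * b (n - k)"
  by (rule conv_le)
lift_definition one_wl :: wl is "\<lambda>n. of_bool (n = 0)"
  by (rule finite_nonzero_values_imp_summable_on) simp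
instance
proof
  fix a b c :: wl
  have cm: "coef (a * b) n = (\<Sum>\<^sub>\<infinity>k. coef a k * coef b (n - k))" for a b n
    by transfer simp
  show comm: "a * b = b * a" for a b :: wl
  proof (rule wl_eqI)
    fix n show "coef (a * b) n = coef (b * a) n"
      unfolding cm by (rule infsum_reindex_bij_witness[where i = "\<lambda>k. n - k" and j = "\<lambda>k. n - k"]) auto
  qed
  show "1 * a = a"
    by (intro wl_eqI, unfold cm, subst infsum_single'[of 0]) (transfer; simp)+
  show "(a + b) * c = a * c + b * c"
    by (intro wl_eqI) (simp add: cm distrib_right infsum_add[OF coef_conv_summable coef_conv_summable])
  show "(0::wl) \<noteq> 1"
    by transfer (auto simp: fun_eq_iff)
  show "a * b * c = a * (b * c)"
  proof (rule wl_eqI)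
    fix n
    \<comment> \<open>Summability of the double family justifies the exchange of the sums; the third
      factor is simply bounded by its norm.\<close>
    have s: "(\<lambda>(k, j). coef a j * coef b (k - j) * coef c (n - k)) summable_on (UNIV \<times> UNIV)"
    proof (rule abs_summable_summable, rule Infinite_Sum.abs_summable_on_comparison_test')
      show "(\<lambda>(k, j). norm (coef a j * coef b (k - j)) * norm c) summable_on (UNIV \<times> UNIV)"
        using summable_on_cmult_left[OF conv_summable[OF coef_abs_summable[of a] coef_abs_summable[of b]], of "norm c"]
        by (simp add: case_prod_unfold)
    qed (auto simp: abs_mult intro!: mult_mono coef_le_norm)
    have "coef (a * b * c) n = (\<Sum>\<^sub>\<infinity>k. \<Sum>\<^sub>\<infinity>j. coef a j * coef b (k - j) * coef c (n - k))"
      by (simp add: cm infsum_cmult_left')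
    also have "\<dots> = (\<Sum>\<^sub>\<infinity>j. \<Sum>\<^sub>\<infinity>k. coef a j * coef b (k - j) * coef c (n - k))"
      by (rule infsum_swap_banach[OF s])
    also have "\<dots> = (\<Sum>\<^sub>\<infinity>j. \<Sum>\<^sub>\<infinity>m. coef a j * coef b m * coef c (n - j - m))"
    proof (rule infsum_cong)
      fix j
      show "(\<Sum>\<^sub>\<infinity>k. coef a j * coef b (k - j) * coef c (n - k)) = (\<Sum>\<^sub>\<infinity>m. coef a j * coef b m * coef c (n - j - m))"
        by (rule infsum_reindex_bij_witness[where i = "\<lambda>m. m + j" and j = "\<lambda>k. k - j"]) auto
    qed
    also have "\<dots> = coef (a * (b * c)) n"
      by (simp add: cm mult.assoc infsum_cmult_right')
    finally show "coef (a * b * c) n = coef (a * (b * c)) n" .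
  qed
qed
end

lemma coef_mult: "coef (a * b) n = (\<Sum>\<^sub>\<infinity>k. coef a k * coef b (n - k))"
  by transfer simp

lemma coef_one: "coef 1 n = of_bool (n = 0)"
  by transfer simp

instance wl :: real_normed_algebra_1
proof
  fix a b :: wl and r :: real
  show "r *\<^sub>R a * b = r *\<^sub>R (a * b)"
    by (intro wl_eqI) (simp add: coef_mult mult.assoc infsum_cmult_right')
  show "a * r *\<^sub>R b = r *\<^sub>R (a * b)"
    by (intro wl_eqI) (simp add: coef_mult mult.left_commute[of _ r] infsum_cmult_right')
  show "norm (a * b) \<le> norm a * norm b"
    unfolding norm_wl_def coef_mult by (rule conv_le(2)[OF coef_summable coef_summable])
  show "norm (1::wl) = 1"
    unfolding norm_wl_def by (subst infsum_single'[of 0]) (auto simp: coef_one wt_def)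
qed

lift_definition zmon :: "int \<Rightarrow> wl" is "\<lambda>m n. of_bool (n = m)"
  by (rule finite_nonzero_values_imp_summable_on) simp

lemma coef_zmon [simp]: "coef (zmon m) n = of_bool (n = m)"
  by transfer simp

lemma norm_zmon: "norm (zmon m) = wt m"
  unfolding norm_wl_def by (subst infsum_single'[of m]) auto

text \<open>A Fourier multiplier. The use of \<open>Abs_wl\<close> is meaningful when the product
  sequence stays in the space, as it does for multipliers bounded by 1.\<close>

definition multiplier :: "(int \<Rightarrow> real) \<Rightarrow> wl \<Rightarrow> wl" where
  "multiplier c a = Abs_wl (\<lambda>n. c n * coef a n)"

lemma coef_multiplier:
  assumes "\<And>n. \<bar>c n\<bar> \<le> 1"
  shows "coef (multiplier c a) n = c n * coef a n"
proof -
  have "(\<lambda>n. c n * coef a n * wt n) abs_summable_on UNIV"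
  proof (rule Infinite_Sum.abs_summable_on_comparison_test'[OF coef_summable[of a]])
    fix n
    show "norm (c n * coef a n * wt n) \<le> norm (coef a n * wt n)"
      using mult_right_mono[OF assms[of n], of "\<bar>coef a n * wt n\<bar>"] by (simp add: abs_mult mult_ac)
  qed
  then show ?thesis by (simp add: multiplier_def Abs_wl_inverse)
qed

text \<open>The conjugate function has multiplier -i sgn n. Without the factor -i the coefficients
  stay real, and the result is i times the conjugate function. \<open>alt\<close> is the
  substitution z \<mapsto> -z, and \<open>refl_wl\<close> is z \<mapsto> 1/z, which on the unit
  circle is complex conjugation.\<close>

definition hilb :: "wl \<Rightarrow> wl" where "hilb = multiplier (\<lambda>n. of_int (sgn n))"
definition alt :: "wl \<Rightarrow> wl" where "alt = multiplier (\<lambda>n. if even n then 1 else -1)"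
lift_definition refl_wl :: "wl \<Rightarrow> wl" is "\<lambda>a n. a (- n)"
  by (subst summable_on_reindex_bij_witness[where i = uminus and j = uminus]) (auto cong: rev_conj_cong)

lemma coef_hilb [simp]: "coef (hilb a) n = of_int (sgn n) * coef a n"
  unfolding hilb_def by (rule coef_multiplier) (simp add: sgn_if)
lemma coef_alt [simp]: "coef (alt a) n = (if even n then 1 else -1) * coef a n"
  unfolding alt_def by (rule coef_multiplier) simp
lemma coef_refl [simp]: "coef (refl_wl a) n = coef a (- n)"
  by transfer simp

lemma norm_le_normI:
  assumes "\<And>n. \<bar>coef a n\<bar> \<le> \<bar>coef b n\<bar>"
  shows "norm a \<le> norm b"
  unfolding norm_wl_def
  by (intro infsum_mono coef_summable') (use assms wt_pos in \<open>auto intro!: mult_right_mono simp: less_imp_le\<close>)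

lemma norm_hilb_le: "norm (hilb a) \<le> norm a"
  by (rule norm_le_normI) (simp add: abs_mult sgn_if)
lemma norm_alt_le: "norm (alt a) \<le> norm a"
  by (rule norm_le_normI) (simp add: abs_mult)
lemma norm_refl_le: "norm (refl_wl a) \<le> norm a"
  unfolding norm_wl_def
  by (rule eq_refl, rule infsum_reindex_bij_witness[where i = uminus and j = uminus]) auto

lemma bounded_linear_hilb: "bounded_linear hilb"
  by (rule bounded_linear_intro[where K = 1]) (auto intro!: wl_eqI simp: norm_hilb_le distrib_left)
lemma bounded_linear_alt: "bounded_linear alt"
  by (rule bounded_linear_intro[where K = 1]) (auto intro!: wl_eqI simp: norm_alt_le)
lemma bounded_linear_refl: "bounded_linear refl_wl"
  by (rule bounded_linear_intro[where K = 1]) (auto intro!: wl_eqI simp: norm_refl_le)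

lemma alt_mult: "alt (a * b) = alt a * alt b"
  by (intro wl_eqI) (auto simp: coef_mult simp flip: infsum_cmult_right' infsum_uminus intro!: infsum_cong)

lemma refl_mult: "refl_wl (a * b) = refl_wl a * refl_wl b"
proof (rule wl_eqI)
  fix n
  have "(\<Sum>\<^sub>\<infinity>k. coef a k * coef b (- n - k)) = (\<Sum>\<^sub>\<infinity>k. coef a (- k) * coef b (- (n - k)))"
    by (rule infsum_reindex_bij_witness[where i = uminus and j = uminus]) auto
  then show "coef (refl_wl (a * b)) n = coef (refl_wl a * refl_wl b) n"
    unfolding coef_mult coef_refl .
qed

lemma alt_one: "alt 1 = 1" by (intro wl_eqI) (simp add: coef_one)
lemma refl_one: "refl_wl 1 = 1" by (intro wl_eqI) (simp add: coef_one)

section \<open>Evaluation of Laurent series as a continuous algebra homomorphism\<close>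

definition ev :: "complex \<Rightarrow> wl \<Rightarrow> complex" where
  "ev z a = (\<Sum>\<^sub>\<infinity>n. of_real (coef a n) * z powi n)"

lemma norm_powi_le_wt:
  fixes z :: complex
  assumes "1/2 \<le> norm z" "norm z \<le> 2"
  shows "norm (z powi n) \<le> wt n"
proof (cases "n \<ge> 0")
  case True
  then show ?thesis using power_mono[OF assms(2), of "nat n"] by (simp add: power_int_def norm_power wt_def)
next
  case False
  have "inverse (norm z) \<le> inverse (1/2)" using assms by (intro le_imp_inverse_le) auto
  then show ?thesis using False assms
    by (simp add: power_int_def norm_power wt_def norm_inverse power_mono)
qed

lemma ev_summable:
  fixes z :: complex
  assumes "1/2 \<le> norm z" "norm z \<le> 2"
  shows "(\<lambda>n. of_real (coef a n) * z powi n) abs_summable_on UNIV"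
  by (rule Infinite_Sum.abs_summable_on_comparison_test'[OF coef_summable'[of a]])
     (use norm_powi_le_wt[OF assms] in \<open>auto simp: norm_mult intro!: mult_left_mono\<close>)

lemma bounded_linear_ev:
  assumes z: "1/2 \<le> norm z" "norm z \<le> 2"
  shows "bounded_linear (ev z)"
proof -
  have le: "norm (ev z a) \<le> norm a" for a
    unfolding ev_def norm_wl_def
    by (rule norm_infsum_le[OF has_sum_infsum has_sum_infsum])
       (use norm_powi_le_wt[OF z] abs_summable_summable[OF ev_summable[OF z]] coef_summable'[of a] in
        \<open>auto simp: norm_mult intro!: mult_left_mono\<close>)
  note s = abs_summable_summable[OF ev_summable[OF z]]
  show "bounded_linear (ev z)"
    by (rule bounded_linear_intro[where K = 1])
       (simp_all add: le, simp_all add: ev_def distrib_right infsum_add[OF s s] scaleR_conv_of_real[where 'a = complex] mult.assoc infsum_cmult_right')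
qed

lemma ev_mult:
  assumes z: "1/2 \<le> norm z" "norm z \<le> 2"
  shows "ev z (a * b) = ev z a * ev z b"
proof -
  have "z \<noteq> 0" using z by auto
  then have "of_real (coef (a * b) n) * z powi n
      = (\<Sum>\<^sub>\<infinity>k. (of_real (coef a k) * z powi k) * (of_real (coef b (n - k)) * z powi (n - k)))" for n
  proof -
    have "(\<Sum>\<^sub>\<infinity>k. (of_real (coef a k) * z powi k) * (of_real (coef b (n - k)) * z powi (n - k)))
       = (\<Sum>\<^sub>\<infinity>k. of_real (coef a k * coef b (n - k)) * z powi n)"
      using \<open>z \<noteq> 0\<close> by (intro infsum_cong) (simp add: power_int_diff)
    also have "\<dots> = (\<Sum>\<^sub>\<infinity>k. of_real (coef a k * coef b (n - k))) * z powi n"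
      by (rule infsum_cmult_left')
    also have "(\<Sum>\<^sub>\<infinity>k. of_real (coef a k * coef b (n - k)) :: complex) = of_real (coef (a * b) n)"
      unfolding coef_mult
      by (intro infsumI has_sum_of_real has_sum_infsum coef_conv_summable)
    finally show ?thesis by simp
  qed
  then show ?thesis
    using conv_infsum(1)[OF ev_summable[OF z, of a] ev_summable[OF z, of b]] by (simp add: ev_def)
qed

lemma ev_zmon: "ev z (zmon m) = z powi m"
  unfolding ev_def by (subst infsum_single'[of m]) auto

lemma ev_one: "ev z 1 = 1"
  unfolding ev_def by (subst infsum_single'[of 0]) (auto simp: coef_one)

lemma ev_refl: "ev z (refl_wl a) = ev (inverse z) a"
  unfolding ev_def
  by (rule infsum_reindex_bij_witness[where i = uminus and j = uminus]) (auto simp: power_int_minus power_int_inverse)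

text \<open>Continuous unital homomorphisms commute with power series. With \<open>alt\<close>,
  \<open>refl_wl\<close> and \<open>ev z\<close> for \<open>h\<close>, this turns exponential
  identities in the algebra into symmetries and into identities between functions on the
  circle.\<close>

lemma hom_exp:
  fixes h :: "'a::{real_normed_algebra_1,banach} \<Rightarrow> 'b::{real_normed_algebra_1,banach}"
  assumes h: "bounded_linear h" and mult: "\<And>a b. h (a * b) = h a * h b" and one: "h 1 = 1"
  shows "h (exp a) = exp (h a)"
proof -
  interpret bounded_linear h by (rule h)
  have pow: "h (a ^ n) = h a ^ n" for n by (induction n) (simp_all add: one mult)
  show ?thesis
    unfolding exp_def by (subst suminf[OF summable_exp_generic]) (simp add: scaleR pow)
qed

section \<open>Theodorsen's equation\<close>

lemma power_diff_bound:
  fixes x y :: "'a::real_normed_algebra_1"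
  assumes "norm x \<le> d" "norm y \<le> d"
  shows "norm (x ^ Suc n - y ^ Suc n) \<le> real (Suc n) * d ^ n * norm (x - y)"
proof (induction n)
  case (Suc n)
  have d: "0 \<le> d" using assms norm_ge_zero order_trans by blast
  have "x ^ Suc (Suc n) - y ^ Suc (Suc n) = x * (x ^ Suc n - y ^ Suc n) + (x - y) * y ^ Suc n"
    by (simp add: algebra_simps)
  also have "norm \<dots> \<le> norm x * norm (x ^ Suc n - y ^ Suc n) + norm (x - y) * norm y ^ Suc n"
    by (intro order_trans[OF norm_triangle_ineq] add_mono order_trans[OF norm_mult_ineq] mult_left_mono norm_power_ineq) auto
  also have "\<dots> \<le> d * (real (Suc n) * d ^ n * norm (x - y)) + norm (x - y) * d ^ Suc n"
    using assms d Suc.IH by (intro add_mono mult_mono power_mono) auto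
  also have "\<dots> = real (Suc (Suc n)) * d ^ Suc n * norm (x - y)"
    by (simp add: algebra_simps)
  finally show ?case .
qed simp

text \<open>Termwise |x^n - y^n| / n! \<le> d^(n-1) / (n-1)! |x - y| for n \<ge> 2, and these bounds
  sum to e^d - 1. Removing the linear part is what makes the constant small for small
  \<open>d\<close>, as the contraction argument requires.\<close>

lemma exp_remainder_lipschitz:
  fixes x y :: "'a::{real_normed_algebra_1,banach}"
  assumes "norm x \<le> d" "norm y \<le> d"
  shows "norm ((exp x - 1 - x) - (exp y - 1 - y)) \<le> (exp d - 1) * norm (x - y)"
proof -
  define D where "D n = x ^ n /\<^sub>R fact n - y ^ n /\<^sub>R fact n" for n
  have "(\<lambda>n. x ^ n /\<^sub>R fact n) sums exp x" "(\<lambda>n. y ^ n /\<^sub>R fact n) sums exp y"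
    by (rule exp_converges)+
  then have "D sums (exp x - exp y)"
    unfolding D_def by (rule sums_diff)
  then have D: "(\<lambda>n. D (n + 2)) sums ((exp x - 1 - x) - (exp y - 1 - y))"
    by (subst sums_iff_shift) (simp add: D_def numeral_2_eq_2 algebra_simps)
  have "(\<lambda>n. d ^ n /\<^sub>R fact n) sums exp d" by (rule exp_converges)
  \<comment> \<open>The shift is by one here and by two for \<open>D\<close>: a difference of degree
    n costs only the power n - 1 of \<open>d\<close>, so the terms from degree 2 on match those of
    e^d from degree 1 on.\<close>
  then have "(\<lambda>n. d ^ (n + 1) /\<^sub>R fact (n + 1)) sums (exp d - 1)"
    by (subst sums_iff_shift) simp
  then have E: "(\<lambda>n. d ^ (n + 1) / fact (n + 1) * norm (x - y)) sums ((exp d - 1) * norm (x - y))"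
    by (intro sums_mult2) (simp add: divide_inverse_commute)
  have le: "norm (D (n + 2)) \<le> d ^ (n + 1) / fact (n + 1) * norm (x - y)" for n
  proof -
    have "norm (D (n + 2)) = norm (x ^ Suc (Suc n) - y ^ Suc (Suc n)) / fact (n + 2)"
      by (simp add: D_def divide_inverse_commute flip: scaleR_diff_right)
    also have "\<dots> \<le> (real (Suc (Suc n)) * d ^ Suc n * norm (x - y)) / fact (n + 2)"
      by (intro divide_right_mono power_diff_bound assms) auto
    also have "\<dots> = d ^ (n + 1) / fact (n + 1) * norm (x - y)"
    proof -
      have "(fact (n + 2) :: real) = real (Suc (Suc n)) * fact (n + 1)" by (simp add: algebra_simps)
      then show ?thesis by simp
    qed
    finally show ?thesis .
  qed
  have "norm (suminf (\<lambda>n. D (n + 2))) \<le> suminf (\<lambda>n. d ^ (n + 1) / fact (n + 1) * norm (x - y))"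
    by (rule norm_suminf_le[OF le sums_summable[OF E]])
  then show ?thesis using D E by (simp add: sums_iff)
qed

lemma exp_lipschitz:
  fixes x y :: "'a::{real_normed_algebra_1,banach}"
  assumes "norm x \<le> d" "norm y \<le> d"
  shows "norm (exp x - exp y) \<le> exp d * norm (x - y)"
  using exp_remainder_lipschitz[OF assms]
    norm_triangle_ineq[of "(exp x - 1 - x) - (exp y - 1 - y)" "x - y"]
  by (simp add: algebra_simps)

lemma exp_minus_one_le: "0 \<le> x \<Longrightarrow> x \<le> 1 \<Longrightarrow> exp x - 1 \<le> 2 * x" for x :: real
  using exp_bound[of x] power_le_one[of x 1] mult_left_le[of x x] by (simp add: power2_eq_square)

lemma exp_remainder_le:
  fixes x :: "'a::{real_normed_algebra_1,banach}"
  assumes "norm x \<le> 1"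
  shows "norm (exp x - 1 - x) \<le> 2 * norm x ^ 2"
proof -
  have "norm (exp x - 1 - x) \<le> (exp (norm x) - 1) * norm x"
    using exp_remainder_lipschitz[of x "norm x" 0] by simp
  also have "\<dots> \<le> 2 * norm x * norm x"
    using assms by (intro mult_right_mono exp_minus_one_le) auto
  finally show ?thesis by (simp add: power2_eq_square)
qed

text \<open>On the unit circle, where \<open>a\<close> represents \<open>Re G\<close> and \<open>hilb a\<close> represents \<open>i Im G\<close>, the element
  \<open>zet a\<close> represents \<open>zeta\<close> at the angle \<open>\<phi> + Im G\<close>.\<close>

definition zet :: "wl \<Rightarrow> wl" where
  "zet a = (13/2) *\<^sub>R (zmon 2 * exp (2 *\<^sub>R hilb a) + zmon (-2) * exp ((-2) *\<^sub>R hilb a))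
         - (1/2) *\<^sub>R (zmon 4 * exp (4 *\<^sub>R hilb a) + zmon (-4) * exp ((-4) *\<^sub>R hilb a))"

text \<open>192 = 16 * 3 * 4: the norm of the monomial, the bound e \<le> 3 for the exponential on
  the unit ball, and |c| \<le> 4. The radius 1/4 keeps \<open>c *\<^sub>R hilb x\<close> inside that
  ball.\<close>

lemma mono_exp_lipschitz:
  assumes c: "\<bar>c\<bar> \<le> 4" "wt m \<le> 16" and xy: "norm x \<le> 1/4" "norm y \<le> 1/4"
  shows "norm (zmon m * exp (c *\<^sub>R hilb x) - zmon m * exp (c *\<^sub>R hilb y)) \<le> 192 * norm (x - y)"
proof -
  have n: "norm (c *\<^sub>R hilb z) \<le> 1" if "norm z \<le> 1/4" for z
    using mult_mono[of "\<bar>c\<bar>" 4 "norm (hilb z)" "1/4"] c(1) norm_hilb_le[of z] that by simp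
  have "norm (c *\<^sub>R hilb x - c *\<^sub>R hilb y) = \<bar>c\<bar> * norm (hilb (x - y))"
    unfolding linear_diff[OF bounded_linear.linear[OF bounded_linear_hilb]] scaleR_diff_right[symmetric] norm_scaleR ..
  also have "\<dots> \<le> 4 * norm (x - y)"
    using c(1) norm_hilb_le by (intro mult_mono) auto
  finally have d: "norm (c *\<^sub>R hilb x - c *\<^sub>R hilb y) \<le> 4 * norm (x - y)" .
  have "norm (exp (c *\<^sub>R hilb x) - exp (c *\<^sub>R hilb y)) \<le> exp 1 * norm (c *\<^sub>R hilb x - c *\<^sub>R hilb y)"
    by (rule exp_lipschitz) (use n xy in auto)
  also have "\<dots> \<le> 3 * (4 * norm (x - y))"
    using d exp_le by (intro mult_mono) auto
  finally have e: "norm (exp (c *\<^sub>R hilb x) - exp (c *\<^sub>R hilb y)) \<le> 12 * norm (x - y)" by simp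
  have "norm (zmon m * (exp (c *\<^sub>R hilb x) - exp (c *\<^sub>R hilb y))) \<le> 16 * (12 * norm (x - y))"
    by (rule order_trans[OF norm_mult_ineq], rule mult_mono) (use e c(2) in \<open>auto simp: norm_zmon\<close>)
  then show ?thesis by (simp add: right_diff_distrib)
qed

lemma norm_comb_le:
  fixes x y u v :: "'a::real_normed_vector"
  assumes "0 \<le> c" "0 \<le> d"
  shows "norm (c *\<^sub>R (x + y) - d *\<^sub>R (u + v)) \<le> c * (norm x + norm y) + d * (norm u + norm v)"
proof -
  have "norm (c *\<^sub>R (x + y) - d *\<^sub>R (u + v)) \<le> c * norm (x + y) + d * norm (u + v)"
    using norm_triangle_ineq4[of "c *\<^sub>R (x + y)" "d *\<^sub>R (u + v)"] assms by simp
  also have "\<dots> \<le> c * (norm x + norm y) + d * (norm u + norm v)"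
    by (rule add_mono; rule mult_left_mono; (rule norm_triangle_ineq | rule assms))
  finally show ?thesis .
qed

text \<open>2688 = 14 * 192, where 14 = 2 * 13/2 + 2 * 1/2 is the sum of the four coefficients in
  \<open>zet\<close>.\<close>

lemma zet_lipschitz:
  assumes "norm x \<le> 1/4" "norm y \<le> 1/4"
  shows "norm (zet x - zet y) \<le> 2688 * norm (x - y)"
proof -
  define B where "B m c z = zmon m * exp (c *\<^sub>R hilb z)" for m c z
  define e where "e m c = B m c x - B m c y" for m c
  have le: "norm (e m c) \<le> 192 * norm (x - y)" if "\<bar>c\<bar> \<le> 4" "wt m \<le> 16" for m c
    unfolding e_def B_def by (rule mono_exp_lipschitz[OF that assms])
  have eq: "zet x - zet y = (13/2) *\<^sub>R (e 2 2 + e (-2) (-2)) - (1/2) *\<^sub>R (e 4 4 + e (-4) (-4))"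
    unfolding e_def zet_def B_def[symmetric] by (simp add: algebra_simps)
  have "norm (zet x - zet y) \<le> (13/2) * (norm (e 2 2) + norm (e (-2) (-2))) + (1/2) * (norm (e 4 4) + norm (e (-4) (-4)))"
    unfolding eq by (rule norm_comb_le) simp_all
  moreover have "norm (e 2 2) \<le> 192 * norm (x - y)" "norm (e (-2) (-2)) \<le> 192 * norm (x - y)"
    "norm (e 4 4) \<le> 192 * norm (x - y)" "norm (e (-4) (-4)) \<le> 192 * norm (x - y)"
    by (rule le; simp add: wt_def)+
  moreover have "N \<le> 2688 * k" if "N \<le> (13/2) * (a + b) + (1/2) * (c + d)"
      "a \<le> 192 * k" "b \<le> 192 * k" "c \<le> 192 * k" "d \<le> 192 * k" for N a b c d k :: real
    using that by argo
  ultimately show ?thesis by blast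
qed

lemma zet_0: "zet 0 = (13/2) *\<^sub>R (zmon 2 + zmon (-2)) - (1/2) *\<^sub>R (zmon 4 + zmon (-4))"
proof -
  have "hilb 0 = 0" by (intro wl_eqI) simp
  then show ?thesis by (simp add: zet_def)
qed

lemma norm_zet_0: "norm (zet 0) \<le> 68"
proof -
  have "norm (zet 0) \<le> (13/2) * (norm (zmon 2) + norm (zmon (-2))) + (1/2) * (norm (zmon 4) + norm (zmon (-4)))"
    unfolding zet_0 by (rule norm_comb_le) simp_all
  also have "\<dots> = 68" by (simp add: norm_zmon wt_def)
  finally show ?thesis .
qed

lemma hom_zet_term:
  assumes h: "bounded_linear h" and mult: "\<And>a b. h (a * b) = h a * h b" and one: "h 1 = 1"
  shows "h (zmon m * exp (c *\<^sub>R a)) = h (zmon m) * exp (c *\<^sub>R h a)"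
proof -
  interpret bounded_linear h by (rule h)
  show ?thesis by (simp add: mult hom_exp[OF h mult one] scaleR)
qed

lemma refl_zmon [simp]: "refl_wl (zmon m) = zmon (- m)"
  by (intro wl_eqI) auto
lemma alt_zmon_even: "even m \<Longrightarrow> alt (zmon m) = zmon m"
  by (intro wl_eqI) auto
lemma refl_hilb: "refl_wl (hilb a) = - hilb (refl_wl a)"
  by (intro wl_eqI) (simp add: sgn_if)
lemma alt_hilb: "alt (hilb a) = hilb (alt a)"
  by (intro wl_eqI) simp

text \<open>Reflection changes the sign of \<open>hilb a\<close> and exchanges \<open>zmon m\<close>
  with \<open>zmon (- m)\<close>, so it swaps the two summands in each bracket of
  \<open>zet\<close>. This is the evenness of \<open>zeta\<close>.\<close>

lemma refl_zet: "refl_wl a = a \<Longrightarrow> refl_wl (zet a) = zet a"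
proof -
  interpret bounded_linear refl_wl by (rule bounded_linear_refl)
  assume "refl_wl a = a"
  then show ?thesis
    unfolding zet_def add diff scaleR hom_zet_term[OF bounded_linear_refl refl_mult refl_one] refl_hilb
    by (simp add: add.commute)
qed

text \<open>Only even frequencies occur in \<open>zeta\<close>; this is the central symmetry of the
  domain.\<close>

lemma alt_zet: "alt a = a \<Longrightarrow> alt (zet a) = zet a"
proof -
  interpret bounded_linear alt by (rule bounded_linear_alt)
  assume "alt a = a"
  then show ?thesis
    unfolding zet_def add diff scaleR hom_zet_term[OF bounded_linear_alt alt_mult alt_one] alt_hilb
    by (simp add: alt_zmon_even)
qed

text \<open>Since \<open>exp a - 1 - a\<close> is quadratically small, the equation \<open>exp a = 1 + t zet a\<close> is the fixed point
  equation of a contraction, and no logarithm is needed.\<close>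

lemma theodorsen_solution:
  assumes t: "0 < t" "t \<le> 1/11000"
  obtains a where "refl_wl a = a" "alt a = a" "exp a = 1 + t *\<^sub>R zet a"
    "norm a \<le> 272 * t" "norm (a - t *\<^sub>R zet 0) \<le> 10^6 * t^2"
proof -
  define \<Phi> where "\<Phi> a = t *\<^sub>R zet a - (exp a - 1 - a)" for a
  \<comment> \<open>The symmetries are built into the complete set on which the map contracts, so
    the fixed point inherits them.\<close>
  define X where "X = cball 0 (1/4) \<inter> {a. refl_wl a = a \<and> alt a = a}"
  have X: "norm a \<le> 1/4" if "a \<in> X" for a using that by (simp add: X_def)
  have e: "exp (1/4) - 1 \<le> (1/2::real)" using exp_minus_one_le[of "1/4"] by simp
  have lip: "norm (\<Phi> x - \<Phi> y) \<le> 3/4 * norm (x - y)" if "norm x \<le> 1/4" "norm y \<le> 1/4" for x y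
  proof -
    have "\<Phi> x - \<Phi> y = t *\<^sub>R (zet x - zet y) - ((exp x - 1 - x) - (exp y - 1 - y))"
      by (simp add: \<Phi>_def algebra_simps)
    also have "norm \<dots> \<le> t * (2688 * norm (x - y)) + (exp (1/4) - 1) * norm (x - y)"
      using zet_lipschitz[OF that] t
      by (intro order_trans[OF norm_triangle_ineq4] add_mono exp_remainder_lipschitz[OF that]) auto
    also have "\<dots> = (2688 * t + (exp (1/4) - 1)) * norm (x - y)"
      by (simp add: algebra_simps)
    \<comment> \<open>For t \<le> 1/11000 the first constant 2688 t is below 1/4, and the second is
      at most 1/2.\<close>
    also have "\<dots> \<le> 3/4 * norm (x - y)"
      using t e by (intro mult_right_mono) auto
    finally show ?thesis .
  qed
  have \<Phi>0: "\<Phi> 0 = t *\<^sub>R zet 0" by (simp add: \<Phi>_def)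
  have bd: "norm (\<Phi> x) \<le> 3/4 * norm x + 68 * t" if "norm x \<le> 1/4" for x
  proof -
    have "norm (\<Phi> x) \<le> norm (\<Phi> x - \<Phi> 0) + norm (\<Phi> 0)"
      using norm_triangle_ineq[of "\<Phi> x - \<Phi> 0" "\<Phi> 0"] by simp
    also have "norm (\<Phi> 0) \<le> 68 * t" using norm_zet_0 t by (simp add: \<Phi>0)
    finally show ?thesis using lip[OF that, of 0] by simp
  qed
  have "\<exists>!a\<in>X. \<Phi> a = a"
  proof (rule Banach_fix[where c = "3/4"])
    show "complete X"
      unfolding complete_eq_closed X_def
      by (intro closed_Int closed_cball closed_Collect_conj closed_Collect_eq
          bounded_linear.continuous_on[OF bounded_linear_refl] bounded_linear.continuous_on[OF bounded_linear_alt] continuous_intros)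
    show "X \<noteq> {}"
    proof -
      have "0 \<in> X" by (auto simp: X_def intro!: wl_eqI)
      then show ?thesis by blast
    qed
    show "\<Phi> ` X \<subseteq> X"
    proof safe
      fix a assume a: "a \<in> X"
      then have ra: "refl_wl a = a" "alt a = a" by (auto simp: X_def)
      have "refl_wl (\<Phi> a) = \<Phi> a"
        using linear_diff[OF bounded_linear.linear[OF bounded_linear_refl]]
          linear_cmul[OF bounded_linear.linear[OF bounded_linear_refl]]
        by (simp add: \<Phi>_def hom_exp[OF bounded_linear_refl refl_mult refl_one] ra refl_zet refl_one)
      moreover have "alt (\<Phi> a) = \<Phi> a"
        using linear_diff[OF bounded_linear.linear[OF bounded_linear_alt]]
          linear_cmul[OF bounded_linear.linear[OF bounded_linear_alt]]
        by (simp add: \<Phi>_def hom_exp[OF bounded_linear_alt alt_mult alt_one] ra alt_zet alt_one)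
      moreover have "norm (\<Phi> a) \<le> 1/4"
        using bd[OF X[OF a]] X[OF a] t by simp
      ultimately show "\<Phi> a \<in> X" by (simp add: X_def)
    qed
    show "dist (\<Phi> x) (\<Phi> y) \<le> 3/4 * dist x y" if "x \<in> X" "y \<in> X" for x y
      using lip X that by (auto simp: dist_norm)
  qed auto
  then obtain a where a: "a \<in> X" "\<Phi> a = a" by blast
  \<comment> \<open>The fixed point satisfies |a| \<le> 3/4 |a| + 68 t, and 272 = 4 * 68.\<close>
  have na: "norm a \<le> 272 * t"
    using bd[OF X[OF a(1)]] a(2) by simp
  have "a - t *\<^sub>R zet 0 = t *\<^sub>R (zet a - zet 0) - (exp a - 1 - a)"
    using a(2) by (simp add: \<Phi>_def algebra_simps)
  also have "norm \<dots> \<le> t * (2688 * norm (a - 0)) + 2 * norm a ^ 2"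
    using zet_lipschitz[OF X[OF a(1)], of 0] X[OF a(1)] t
    by (intro order_trans[OF norm_triangle_ineq4] add_mono exp_remainder_le) auto
  also have "\<dots> \<le> t * (2688 * (272 * t)) + 2 * (272 * t) ^ 2"
    using na t by (intro add_mono mult_left_mono power_mono) auto
  \<comment> \<open>2688 * 272 + 2 * 272^2 = 879104.\<close>
  also have "\<dots> \<le> 10^6 * t^2" by (simp add: power2_eq_square)
  finally have "norm (a - t *\<^sub>R zet 0) \<le> 10^6 * t^2" .
  moreover have "exp a = 1 + t *\<^sub>R zet a"
    using a(2) by (simp add: \<Phi>_def algebra_simps)
  ultimately show thesis using that[of a] a(1) na by (simp add: X_def)
qed

section \<open>Holomorphic completion\<close>

text \<open>On the circle the completion a + i b is \<open>a + hilb a\<close>. The factor 1 + sgn n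
  deletes the negative indices, keeps index 0 and doubles the positive ones, which leaves a power
  series that converges on |z| \<le> 2.\<close>

definition Pc :: "wl \<Rightarrow> nat \<Rightarrow> real" where
  "Pc a n = (if n = 0 then coef a 0 else 2 * coef a (int n))"

definition Pf :: "wl \<Rightarrow> complex \<Rightarrow> complex" where
  "Pf a z = (\<Sum>n. of_real (Pc a n) * z ^ n)"

lemma Pc_sums:
  shows "(\<lambda>n. \<bar>Pc a n\<bar> * 2 ^ n) summable_on UNIV" "(\<Sum>\<^sub>\<infinity>n. \<bar>Pc a n\<bar> * 2 ^ n) \<le> 2 * norm a"
proof -
  have s: "(\<lambda>n. \<bar>coef a (int n)\<bar> * 2 ^ n) summable_on UNIV"
    and le: "(\<Sum>\<^sub>\<infinity>n. \<bar>coef a (int n)\<bar> * 2 ^ n) \<le> norm a"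
  proof -
    have "(\<lambda>n. \<bar>coef a n\<bar> * wt n) summable_on (range int)"
      by (rule summable_on_subset_banach[OF coef_summable']) auto
    then have *: "(\<lambda>n. \<bar>coef a n\<bar> * wt n) \<circ> int summable_on UNIV"
      by (subst (asm) summable_on_reindex) auto
    then show "(\<lambda>n. \<bar>coef a (int n)\<bar> * 2 ^ n) summable_on UNIV" by (simp add: o_def wt_def)
    have "infsum ((\<lambda>n. \<bar>coef a n\<bar> * wt n) \<circ> int) UNIV = infsum (\<lambda>n. \<bar>coef a n\<bar> * wt n) (range int)"
      by (rule infsum_reindex[symmetric]) auto
    also have "\<dots> \<le> norm a"
      unfolding norm_wl_def
      by (rule infsum_mono2)
         (use wt_pos in \<open>auto intro!: coef_summable' summable_on_subset_banach[OF coef_summable'] simp: less_imp_le\<close>)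
    finally show "(\<Sum>\<^sub>\<infinity>n. \<bar>coef a (int n)\<bar> * 2 ^ n) \<le> norm a" by (simp add: o_def wt_def)
  qed
  have s2: "(\<lambda>n. 2 * (\<bar>coef a (int n)\<bar> * 2 ^ n)) summable_on UNIV" by (rule summable_on_cmult_right[OF s])
  have le2: "\<bar>Pc a n\<bar> * 2 ^ n \<le> 2 * (\<bar>coef a (int n)\<bar> * 2 ^ n)" for n
    by (auto simp: Pc_def abs_mult)
  show s3: "(\<lambda>n. \<bar>Pc a n\<bar> * 2 ^ n) summable_on UNIV"
    by (rule summable_on_comparison_test[OF s2]) (use le2 in auto)
  have "(\<Sum>\<^sub>\<infinity>n. \<bar>Pc a n\<bar> * 2 ^ n) \<le> (\<Sum>\<^sub>\<infinity>n. 2 * (\<bar>coef a (int n)\<bar> * 2 ^ n))"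
    by (rule infsum_mono[OF s3 s2 le2])
  then show "(\<Sum>\<^sub>\<infinity>n. \<bar>Pc a n\<bar> * 2 ^ n) \<le> 2 * norm a"
    using le by (simp add: infsum_cmult_right')
qed

lemma norm_power_term_le:
  fixes z :: complex
  assumes "norm z \<le> 2"
  shows "norm (of_real c * z ^ n) \<le> \<bar>c\<bar> * 2 ^ n"
proof -
  have "norm z ^ n \<le> 2 ^ n" by (rule power_mono[OF assms]) simp
  then show ?thesis unfolding norm_mult norm_power norm_of_real by (rule mult_left_mono) simp
qed

lemma Pf_has_sum:
  assumes z: "norm z \<le> 2"
  shows "((\<lambda>n. of_real (Pc a n) * z ^ n) has_sum Pf a z) UNIV"
proof -
  have "(\<lambda>n. of_real (Pc a n) * z ^ n) abs_summable_on UNIV"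
    by (rule Infinite_Sum.abs_summable_on_comparison_test'[OF Pc_sums(1)[of a]])
       (rule norm_power_term_le[OF z])
  then have *: "((\<lambda>n. of_real (Pc a n) * z ^ n) has_sum infsum (\<lambda>n. of_real (Pc a n) * z ^ n) UNIV) UNIV"
    by (rule has_sum_infsum[OF abs_summable_summable])
  then show ?thesis
    using has_sum_imp_sums[OF *] by (simp add: Pf_def sums_iff)
qed

lemma Pf_sums: "norm z \<le> 2 \<Longrightarrow> (\<lambda>n. of_real (Pc a n) * z ^ n) sums Pf a z"
  by (intro has_sum_imp_sums Pf_has_sum)

lemma norm_Pf_le:
  assumes z: "norm z \<le> 2"
  shows "norm (Pf a z) \<le> 2 * norm a"
proof -
  have "norm (Pf a z) \<le> (\<Sum>\<^sub>\<infinity>n. \<bar>Pc a n\<bar> * 2 ^ n)"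
    by (rule norm_infsum_le[OF Pf_has_sum[OF z] has_sum_infsum[OF Pc_sums(1)]])
       (rule norm_power_term_le[OF z])
  then show ?thesis using Pc_sums(2)[of a] by simp
qed

lemma Pf_holomorphic: "Pf a holomorphic_on ball 0 2"
  by (rule power_series_holomorphic[where a = "\<lambda>n. of_real (Pc a n)"]) (auto intro!: Pf_sums)

lemma Pf_diff_scale: "norm z \<le> 2 \<Longrightarrow> Pf (a - c *\<^sub>R b) z = Pf a z - of_real c * Pf b z"
proof -
  assume z: "norm z \<le> 2"
  have "(\<lambda>n. of_real (Pc a n) * z ^ n - of_real c * (of_real (Pc b n) * z ^ n)) sums (Pf a z - of_real c * Pf b z)"
    by (intro sums_diff sums_mult Pf_sums z)
  also have "(\<lambda>n. of_real (Pc a n) * z ^ n - of_real c * (of_real (Pc b n) * z ^ n)) = (\<lambda>n. of_real (Pc (a - c *\<^sub>R b) n) * z ^ n)"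
    by (rule ext) (simp add: Pc_def left_diff_distrib)
  finally show ?thesis by (rule sums_unique2[OF Pf_sums[OF z]])
qed

lemma Pf_cnj: "norm z \<le> 2 \<Longrightarrow> Pf a (cnj z) = cnj (Pf a z)"
proof -
  assume z: "norm z \<le> 2"
  have "(\<lambda>n. cnj (of_real (Pc a n) * z ^ n)) sums cnj (Pf a z)"
    using Pf_sums[OF z] by (simp only: sums_cnj)
  then have "(\<lambda>n. of_real (Pc a n) * cnj z ^ n) sums cnj (Pf a z)" by simp
  moreover have "norm (cnj z) \<le> 2" using z by simp
  ultimately show ?thesis using sums_unique2[OF Pf_sums] by blast
qed

text \<open>Invariance under \<open>alt\<close> forces the coefficients of odd index to
  vanish.\<close>

lemma Pf_minus:
  assumes "alt a = a"
  shows "Pf a (- z) = Pf a z"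
proof -
  have "Pc a n * (-1) ^ n = Pc a n" for n
  proof (cases "even n")
    case False
    have "coef a (int n) = coef (alt a) (int n)" using assms by simp
    then have "coef a (int n) = 0" using False by simp
    moreover have "n \<noteq> 0" using False by (metis even_zero)
    ultimately show ?thesis by (simp add: Pc_def)
  qed simp
  then have "of_real (Pc a n) * (- z) ^ n = of_real (Pc a n) * z ^ n" for n
  proof -
    have "of_real (Pc a n) * (- z) ^ n = of_real (Pc a n * (-1) ^ n) * z ^ n"
      by (subst power_minus) simp
    then show ?thesis by (simp only: \<open>\<And>n. Pc a n * (-1) ^ n = Pc a n\<close>)
  qed
  then show ?thesis by (simp only: Pf_def)
qed

lemma Pf_ev:
  assumes z: "1/2 \<le> norm z" "norm z \<le> 2"
  shows "Pf a z = ev z a + ev z (hilb a)"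
proof -
  have "ev z a + ev z (hilb a) = infsum (\<lambda>n. of_real (coef (a + hilb a) n) * z powi n) UNIV"
    by (simp only: ev_def[symmetric] linear_add[OF bounded_linear.linear[OF bounded_linear_ev[OF z]]])
  also have "\<dots> = infsum (\<lambda>n. of_real (coef (a + hilb a) n) * z powi n) (range int)"
  proof (rule infsum_cong_neutral)
    fix n assume "n \<in> UNIV - range int"
    then have "n < 0" by (metis DiffE nonneg_int_cases not_less rangeI)
    then show "of_real (coef (a + hilb a) n) * z powi n = 0" by simp
  qed auto
  also have "\<dots> = infsum ((\<lambda>n. of_real (coef (a + hilb a) n) * z powi n) \<circ> int) UNIV"
    by (rule infsum_reindex) auto
  also have "\<dots> = infsum (\<lambda>n. of_real (Pc a n) * z ^ n) UNIV"
    by (rule infsum_cong) (auto simp: Pc_def)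
  also have "\<dots> = Pf a z"
    by (rule infsumI[OF Pf_has_sum[OF z(2)]])
  finally show ?thesis by simp
qed

text \<open>On the circle 1/z is the conjugate of z. Passing to 1/z fixes \<open>ev z a\<close> and
  changes the sign of \<open>ev z (hilb a)\<close>, so conjugating their sum \<open>Pf a z\<close>
  flips only the second summand.\<close>

lemma ev_circle:
  assumes z: "norm z = 1" and a: "refl_wl a = a"
  shows "ev z a = of_real (Re (Pf a z))" "ev z (hilb a) = \<i> * of_real (Im (Pf a z))"
proof -
  have z': "1/2 \<le> norm z" "norm z \<le> 2" "1/2 \<le> norm (inverse z)" "norm (inverse z) \<le> 2"
    using z by (auto simp: norm_inverse)
  have cz: "cnj z = inverse z" using z
    by (metis complex_norm_square inverse_unique of_real_1 power_one)
  have 1: "ev (inverse z) a = ev z a" by (simp add: a flip: ev_refl)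
  have 2: "ev (inverse z) (hilb a) = - ev z (hilb a)"
    by (simp add: a refl_hilb linear_neg[OF bounded_linear.linear[OF bounded_linear_ev[OF z'(1,2)]]] flip: ev_refl)
  have "Pf a z = ev z a + ev z (hilb a)" by (rule Pf_ev[OF z'(1,2)])
  moreover have "cnj (Pf a z) = ev z a - ev z (hilb a)"
    using Pf_ev[OF z'(3,4), of a] Pf_cnj[OF z'(2), of a] by (simp add: cz 1 2)
  ultimately have "2 * ev z a = Pf a z + cnj (Pf a z)" "2 * ev z (hilb a) = Pf a z - cnj (Pf a z)" by simp_all
  then show "ev z a = of_real (Re (Pf a z))" "ev z (hilb a) = \<i> * of_real (Im (Pf a z))"
    by (simp_all add: complex_eq_iff)
qed

text \<open>A polynomial whose real part on the circle is \<open>zeta\<close>; t times it is the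
  first-order part of G.\<close>

lemma Pf_zet_0: "norm z \<le> 2 \<Longrightarrow> Pf (zet 0) z = 13 * z ^ 2 - z ^ 4"
proof -
  assume z: "norm z \<le> 2"
  have "(\<lambda>n. of_real (Pc (zet 0) n) * z ^ n) sums (\<Sum>n\<in>{2,4}. of_real (Pc (zet 0) n) * z ^ n)"
    by (rule sums_finite) (auto simp: Pc_def zet_0)
  then have "Pf (zet 0) z = (\<Sum>n\<in>{2,4}. of_real (Pc (zet 0) n) * z ^ n)"
    using Pf_sums[OF z] sums_unique2 by blast
  then show ?thesis by (simp add: Pc_def zet_0)
qed

lemma Pf_one: "norm z \<le> 2 \<Longrightarrow> Pf 1 z = 1"
proof -
  assume z: "norm z \<le> 2"
  have "(\<lambda>n. of_real (Pc 1 n) * z ^ n) sums (\<Sum>n\<in>{0}. of_real (Pc 1 n) * z ^ n)"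
    by (rule sums_finite) (auto simp: Pc_def coef_one)
  then have "Pf 1 z = (\<Sum>n\<in>{0}. of_real (Pc 1 n) * z ^ n)"
    using Pf_sums[OF z] sums_unique2 by blast
  then show ?thesis by (simp add: Pc_def coef_one)
qed

section \<open>First-order expansions in \<open>t\<close>\<close>

text \<open>Boundedness of \<open>F0\<close> and \<open>F1\<close> is included so that expansions can be multiplied.\<close>

definition jet :: "complex set \<Rightarrow> (real \<Rightarrow> complex \<Rightarrow> complex) \<Rightarrow> (complex \<Rightarrow> complex) \<Rightarrow> (complex \<Rightarrow> complex) \<Rightarrow> bool" where
  "jet S F F0 F1 \<longleftrightarrow>
     (\<exists>B. (\<forall>z\<in>S. norm (F0 z) \<le> B \<and> norm (F1 z) \<le> B) \<and>
       (\<forall>\<^sub>F t in at_right 0. \<forall>z\<in>S. norm (F t z - F0 z - of_real t * F1 z) \<le> B * t\<^sup>2))"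

lemma jetI:
  assumes "\<And>z. z \<in> S \<Longrightarrow> norm (F0 z) \<le> K" "\<And>z. z \<in> S \<Longrightarrow> norm (F1 z) \<le> L"
    and ev: "\<forall>\<^sub>F t in at_right 0. \<forall>z\<in>S. norm (F t z - F0 z - of_real t * F1 z) \<le> B * t\<^sup>2"
  shows "jet S F F0 F1"
  unfolding jet_def
proof (intro exI conjI)
  let ?M = "max B (max K L)"
  show "\<forall>z\<in>S. norm (F0 z) \<le> ?M \<and> norm (F1 z) \<le> ?M"
    using assms(1,2) by (meson max.coboundedI1 max.coboundedI2)
  show "\<forall>\<^sub>F t in at_right 0. \<forall>z\<in>S. norm (F t z - F0 z - of_real t * F1 z) \<le> ?M * t\<^sup>2"
    using ev by eventually_elim (meson order_trans mult_right_mono max.cobounded1 zero_le_power2)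
qed

lemma jetE:
  assumes "jet S F F0 F1"
  obtains B where "B \<ge> 0" "\<And>z. z \<in> S \<Longrightarrow> norm (F0 z) \<le> B" "\<And>z. z \<in> S \<Longrightarrow> norm (F1 z) \<le> B"
    "\<forall>\<^sub>F t in at_right 0. \<forall>z\<in>S. norm (F t z - F0 z - of_real t * F1 z) \<le> B * t\<^sup>2"
proof -
  from assms obtain B where B: "\<forall>z\<in>S. norm (F0 z) \<le> B \<and> norm (F1 z) \<le> B"
    "\<forall>\<^sub>F t in at_right 0. \<forall>z\<in>S. norm (F t z - F0 z - of_real t * F1 z) \<le> B * t\<^sup>2"
    unfolding jet_def by blast
  show thesis
  proof (rule that[of "max B 0"])
    show "\<forall>\<^sub>F t in at_right 0. \<forall>z\<in>S. norm (F t z - F0 z - of_real t * F1 z) \<le> max B 0 * t\<^sup>2"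
      using B(2) by eventually_elim (meson order_trans mult_right_mono max.cobounded1 zero_le_power2)
  qed (use B(1) in \<open>auto simp: le_max_iff_disj\<close>)
qed

lemma jet_const:
  assumes "\<And>z. z \<in> S \<Longrightarrow> norm (F0 z) \<le> A"
  shows "jet S (\<lambda>t. F0) F0 (\<lambda>_. 0)"
  by (rule jetI[of S F0 A "\<lambda>_. 0" 0 _ 0]) (use assms in auto)

lemma jet_add:
  assumes "jet S F F0 F1" "jet S G G0 G1"
  shows "jet S (\<lambda>t z. F t z + G t z) (\<lambda>z. F0 z + G0 z) (\<lambda>z. F1 z + G1 z)"
proof -
  from assms(1) obtain B where B: "\<And>z. z \<in> S \<Longrightarrow> norm (F0 z) \<le> B" "\<And>z. z \<in> S \<Longrightarrow> norm (F1 z) \<le> B"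
    "\<forall>\<^sub>F t in at_right 0. \<forall>z\<in>S. norm (F t z - F0 z - of_real t * F1 z) \<le> B * t\<^sup>2" by (rule jetE) blast
  from assms(2) obtain C where C: "\<And>z. z \<in> S \<Longrightarrow> norm (G0 z) \<le> C" "\<And>z. z \<in> S \<Longrightarrow> norm (G1 z) \<le> C"
    "\<forall>\<^sub>F t in at_right 0. \<forall>z\<in>S. norm (G t z - G0 z - of_real t * G1 z) \<le> C * t\<^sup>2" by (rule jetE) blast
  show ?thesis
  proof (rule jetI)
    show "\<forall>\<^sub>F t in at_right 0. \<forall>z\<in>S. norm (F t z + G t z - (F0 z + G0 z) - of_real t * (F1 z + G1 z)) \<le> (B + C) * t\<^sup>2"
      using B(3) C(3)
    proof eventually_elim
      case (elim t)
      show ?case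
      proof
        fix z assume "z \<in> S"
        have "F t z + G t z - (F0 z + G0 z) - of_real t * (F1 z + G1 z)
            = (F t z - F0 z - of_real t * F1 z) + (G t z - G0 z - of_real t * G1 z)" by (simp add: algebra_simps)
        also have "norm \<dots> \<le> B * t\<^sup>2 + C * t\<^sup>2"
          using elim \<open>z \<in> S\<close> by (intro norm_triangle_le add_mono) auto
        finally show "norm (F t z + G t z - (F0 z + G0 z) - of_real t * (F1 z + G1 z)) \<le> (B + C) * t\<^sup>2"
          by (simp add: distrib_right)
      qed
    qed
  next
    fix z assume "z \<in> S"
    then show "norm (F0 z + G0 z) \<le> B + C" "norm (F1 z + G1 z) \<le> B + C"
      using B C by (auto intro!: norm_triangle_le add_mono)
  qed
qed

lemma jet_mult:
  assumes "jet S F F0 F1" "jet S G G0 G1"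
  shows "jet S (\<lambda>t z. F t z * G t z) (\<lambda>z. F0 z * G0 z) (\<lambda>z. F0 z * G1 z + F1 z * G0 z)"
proof -
  from assms(1) obtain B where B: "B \<ge> 0" "\<And>z. z \<in> S \<Longrightarrow> norm (F0 z) \<le> B" "\<And>z. z \<in> S \<Longrightarrow> norm (F1 z) \<le> B"
    "\<forall>\<^sub>F t in at_right 0. \<forall>z\<in>S. norm (F t z - F0 z - of_real t * F1 z) \<le> B * t\<^sup>2" by (rule jetE) blast
  from assms(2) obtain C where C: "C \<ge> 0" "\<And>z. z \<in> S \<Longrightarrow> norm (G0 z) \<le> C" "\<And>z. z \<in> S \<Longrightarrow> norm (G1 z) \<le> C"
    "\<forall>\<^sub>F t in at_right 0. \<forall>z\<in>S. norm (G t z - G0 z - of_real t * G1 z) \<le> C * t\<^sup>2" by (rule jetE) blast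
  have "\<forall>\<^sub>F t::real in at_right 0. t < 1" "\<forall>\<^sub>F t::real in at_right 0. t > 0"
    by (auto simp: eventually_at_right_field intro: exI[of _ 1])
  then have ev: "\<forall>\<^sub>F t in at_right 0. \<forall>z\<in>S. norm (F t z * G t z - F0 z * G0 z - of_real t * (F0 z * G1 z + F1 z * G0 z)) \<le> 6 * (B * C) * t\<^sup>2"
    using B(4) C(4)
  proof eventually_elim
    case (elim t)
    show ?case
    proof
      fix z assume z: "z \<in> S"
      define e where "e = F t z - F0 z - of_real t * F1 z"
      define d where "d = G t z - G0 z - of_real t * G1 z"
      have e: "norm e \<le> B * t\<^sup>2" and d: "norm d \<le> C * t\<^sup>2" using elim z by (auto simp: e_def d_def)
      have t2: "t\<^sup>2 \<le> 1" using elim by (simp add: power_le_one)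
      have d1: "norm d \<le> C" using d mult_left_mono[OF t2 C(1)] by simp
      have tn: "norm (of_real t * w) = t * norm w" for w :: complex using elim by (simp add: norm_mult)
      have FF: "F t z = F0 z + of_real t * F1 z + e" and GG: "G t z = G0 z + of_real t * G1 z + d"
        by (simp_all add: e_def d_def)
      \<comment> \<open>There are six remainder products, each at most B C t^2; t < 1 and t^2 \<le>
        1 absorb the higher powers of t.\<close>
      have "F t z * G t z - F0 z * G0 z - of_real t * (F0 z * G1 z + F1 z * G0 z)
        = of_real (t\<^sup>2) * (F1 z * G1 z) + (F0 z * d + of_real t * F1 z * d) + (e * G0 z + of_real t * G1 z * e) + e * d"
        unfolding FF GG by (simp add: algebra_simps power2_eq_square)
      also have "norm \<dots> \<le> t\<^sup>2 * (B * C) + (B * (C * t\<^sup>2) + B * (C * t\<^sup>2)) + (B * t\<^sup>2 * C + C * (B * t\<^sup>2)) + B * t\<^sup>2 * C"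
      proof (intro norm_triangle_le add_mono)
        show "norm (of_real (t\<^sup>2) * (F1 z * G1 z)) \<le> t\<^sup>2 * (B * C)"
          using B C z by (simp add: norm_mult norm_power mult_left_mono mult_mono)
        show "norm (F0 z * d) \<le> B * (C * t\<^sup>2)"
          unfolding norm_mult using B C z d by (intro mult_mono) auto
        show "norm (of_real t * F1 z * d) \<le> B * (C * t\<^sup>2)"
          unfolding norm_mult using B C z d elim mult_mono[of t 1 "norm (F1 z)" B] by (intro mult_mono) auto
        show "norm (e * G0 z) \<le> B * t\<^sup>2 * C"
          unfolding norm_mult using B C z e by (intro mult_mono) auto
        show "norm (of_real t * G1 z * e) \<le> C * (B * t\<^sup>2)"
          unfolding norm_mult using B C z e elim mult_mono[of t 1 "norm (G1 z)" C] by (intro mult_mono) auto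
        show "norm (e * d) \<le> B * t\<^sup>2 * C"
          unfolding norm_mult using B C e d1 by (intro mult_mono) auto
      qed
      also have "\<dots> = 6 * (B * C) * t\<^sup>2" by (simp add: algebra_simps)
      finally show "norm (F t z * G t z - F0 z * G0 z - of_real t * (F0 z * G1 z + F1 z * G0 z)) \<le> 6 * (B * C) * t\<^sup>2" .
    qed
  qed
  show ?thesis
  proof (rule jetI[OF _ _ ev])
    fix z assume z: "z \<in> S"
    show "norm (F0 z * G0 z) \<le> B * C"
      unfolding norm_mult using B C z by (intro mult_mono) auto
    show "norm (F0 z * G1 z + F1 z * G0 z) \<le> B * C + B * C"
      using B C z by (intro norm_triangle_le add_mono) (auto simp: norm_mult intro!: mult_mono)
  qed
qed

lemma jet_compose:
  assumes "jet S F F0 F1" "\<And>w. w \<in> S' \<Longrightarrow> g w \<in> S"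
  shows "jet S' (\<lambda>t w. F t (g w)) (\<lambda>w. F0 (g w)) (\<lambda>w. F1 (g w))"
proof -
  from assms(1) obtain B where B: "B \<ge> 0" "\<And>z. z \<in> S \<Longrightarrow> norm (F0 z) \<le> B" "\<And>z. z \<in> S \<Longrightarrow> norm (F1 z) \<le> B"
    "\<forall>\<^sub>F t in at_right 0. \<forall>z\<in>S. norm (F t z - F0 z - of_real t * F1 z) \<le> B * t\<^sup>2" by (rule jetE) blast
  show ?thesis
    by (rule jetI[where K = B and L = B and B = B])
       (use B assms(2) in \<open>auto elim!: eventually_mono\<close>)
qed

lemma jet_cong:
  assumes "jet S F F0 F1"
    and "\<forall>\<^sub>F t in at_right 0. \<forall>z\<in>S. F' t z = F t z"
    and "\<And>z. z \<in> S \<Longrightarrow> F0' z = F0 z" "\<And>z. z \<in> S \<Longrightarrow> F1' z = F1 z"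
  shows "jet S F' F0' F1'"
proof -
  from assms(1) obtain B where B: "B \<ge> 0" "\<And>z. z \<in> S \<Longrightarrow> norm (F0 z) \<le> B" "\<And>z. z \<in> S \<Longrightarrow> norm (F1 z) \<le> B"
    "\<forall>\<^sub>F t in at_right 0. \<forall>z\<in>S. norm (F t z - F0 z - of_real t * F1 z) \<le> B * t\<^sup>2" by (rule jetE) blast
  show ?thesis
  proof (rule jetI[where K = B and L = B and B = B])
    show "\<forall>\<^sub>F t in at_right 0. \<forall>z\<in>S. norm (F' t z - F0' z - of_real t * F1' z) \<le> B * t\<^sup>2"
      using B(4) assms(2) by eventually_elim (simp add: assms(3,4))
  qed (use B assms in auto)
qed

lemma jet_close:
  assumes "jet S F F0 F1" "e > 0"
  shows "\<forall>\<^sub>F t in at_right 0. \<forall>z\<in>S. norm (F t z - F0 z) \<le> e"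
proof -
  from assms(1) obtain B where B: "B \<ge> 0" "\<And>z. z \<in> S \<Longrightarrow> norm (F0 z) \<le> B" "\<And>z. z \<in> S \<Longrightarrow> norm (F1 z) \<le> B"
    "\<forall>\<^sub>F t in at_right 0. \<forall>z\<in>S. norm (F t z - F0 z - of_real t * F1 z) \<le> B * t\<^sup>2" by (rule jetE) blast
  have "((\<lambda>t::real. B * t\<^sup>2 + t * B) \<longlongrightarrow> B * 0\<^sup>2 + 0 * B) (at_right 0)"
    by (intro tendsto_intros)
  then have "\<forall>\<^sub>F t in at_right 0. B * t\<^sup>2 + t * B < e"
    by (rule order_tendstoD(2)) (simp add: assms)
  moreover have "\<forall>\<^sub>F t::real in at_right 0. t > 0"
    by (rule eventually_at_right_less)
  ultimately show ?thesis using B(4)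
  proof eventually_elim
    case (elim t)
    show ?case
    proof
      fix z assume z: "z \<in> S"
      have "norm ((F t z - F0 z - of_real t * F1 z) + of_real t * F1 z) \<le> B * t\<^sup>2 + t * B"
        using elim z B(3)[OF z] by (intro norm_triangle_le add_mono) (auto simp: norm_mult)
      then show "norm (F t z - F0 z) \<le> e" using elim by simp
    qed
  qed
qed

text \<open>The product of F and 1 - t F1 has no first-order term and so equals 1 up to O(t^2).
  Division by F, which has modulus at least 1/2 for small t, preserves this order.\<close>

lemma jet_inverse:
  assumes "jet S F (\<lambda>_. 1) F1"
  shows "jet S (\<lambda>t z. inverse (F t z)) (\<lambda>_. 1) (\<lambda>z. - F1 z)"
proof -
  from assms(1) obtain B where B: "B \<ge> 0" "\<And>z. z \<in> S \<Longrightarrow> norm (F1 z) \<le> B" by (rule jetE) blast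
  have "jet S (\<lambda>t z. 1 - of_real t * F1 z) (\<lambda>_. 1) (\<lambda>z. - F1 z)"
    by (rule jetI[where K = 1 and L = B and B = 0]) (use B in auto)
  from jet_mult[OF assms this] obtain C where C: "C \<ge> 0"
    "\<forall>\<^sub>F t in at_right 0. \<forall>z\<in>S. norm (F t z * (1 - of_real t * F1 z) - 1) \<le> C * t\<^sup>2"
    by (rule jetE) auto
  have "\<forall>\<^sub>F t in at_right 0. \<forall>z\<in>S. norm (F t z - 1) \<le> 1/2"
    using jet_close[OF assms, of "1/2"] by simp
  then have "\<forall>\<^sub>F t in at_right 0. \<forall>z\<in>S. norm (inverse (F t z) - 1 - of_real t * (- F1 z)) \<le> 2 * C * t\<^sup>2"
    using C(2)
  proof eventually_elim
    case (elim t)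
    show ?case
    proof
      fix z assume z: "z \<in> S"
      have n: "norm (F t z) \<ge> 1/2"
        using elim z norm_triangle_ineq2[of 1 "1 - F t z"] by (force simp: norm_minus_commute)
      then have "F t z \<noteq> 0" by auto
      then have "inverse (F t z) - 1 - of_real t * (- F1 z) = - (F t z * (1 - of_real t * F1 z) - 1) / F t z"
        by (simp add: field_simps)
      also have "norm \<dots> = norm (F t z * (1 - of_real t * F1 z) - 1) / norm (F t z)"
        by (simp only: norm_divide norm_minus_cancel)
      also have "\<dots> \<le> (C * t\<^sup>2) / (1/2)"
        using elim z n C(1) by (intro frac_le) auto
      finally show "norm (inverse (F t z) - 1 - of_real t * (- F1 z)) \<le> 2 * C * t\<^sup>2" by simp
    qed
  qed
  then show ?thesis by (rule jetI[rotated 2, where K = 1 and L = B]) (use B in auto)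
qed

lemma jet_exp:
  assumes "jet S F (\<lambda>_. 0) F1"
  shows "jet S (\<lambda>t z. exp (F t z)) (\<lambda>_. 1) F1"
proof -
  from assms(1) obtain B where B: "B \<ge> 0" "\<And>z. z \<in> S \<Longrightarrow> norm (F1 z) \<le> B"
    "\<forall>\<^sub>F t in at_right 0. \<forall>z\<in>S. norm (F t z - 0 - of_real t * F1 z) \<le> B * t\<^sup>2" by (rule jetE) blast
  have c: "\<forall>\<^sub>F t in at_right 0. \<forall>z\<in>S. norm (F t z) \<le> 1"
    using jet_close[OF assms, of 1] by simp
  have "\<forall>\<^sub>F t::real in at_right 0. t < 1" "\<forall>\<^sub>F t::real in at_right 0. t > 0"
    by (auto simp: eventually_at_right_field intro: exI[of _ 1])
  then have "\<forall>\<^sub>F t in at_right 0. \<forall>z\<in>S. norm (exp (F t z) - 1 - of_real t * F1 z) \<le> (2 * (2 * B)\<^sup>2 + B) * t\<^sup>2"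
    using c B(3)
  proof eventually_elim
    case (elim t)
    show ?case
    proof
      fix z assume z: "z \<in> S"
      have "norm ((F t z - of_real t * F1 z) + of_real t * F1 z) \<le> B * t\<^sup>2 + t * B"
        using elim z B(2)[OF z] by (intro norm_triangle_le add_mono) (auto simp: norm_mult)
      also have "\<dots> \<le> B * t + t * B"
        using elim B(1) mult_left_mono[of t 1 t] by (intro add_mono mult_left_mono) (auto simp: power2_eq_square)
      finally have F: "norm (F t z) \<le> 2 * B * t" by simp
      have "exp (F t z) - 1 - of_real t * F1 z = (exp (F t z) - 1 - F t z) + (F t z - 0 - of_real t * F1 z)" by simp
      also have "norm \<dots> \<le> 2 * norm (F t z) ^ 2 + B * t\<^sup>2"
        using elim z by (intro norm_triangle_le add_mono exp_remainder_le) auto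
      also have "\<dots> \<le> 2 * (2 * B * t) ^ 2 + B * t\<^sup>2"
        using F elim B(1) by (intro add_mono mult_left_mono power_mono) auto
      also have "\<dots> = (2 * (2 * B)\<^sup>2 + B) * t\<^sup>2" by (simp add: algebra_simps power2_eq_square)
      finally show "norm (exp (F t z) - 1 - of_real t * F1 z) \<le> (2 * (2 * B)\<^sup>2 + B) * t\<^sup>2" .
    qed
  qed
  then show ?thesis by (rule jetI[rotated 2, where K = 1 and L = B]) (use B in auto)
qed

lemma norm_higher_deriv_le:
  assumes "f holomorphic_on S" "cball z r \<subseteq> S" "0 < r" "\<And>w. w \<in> S \<Longrightarrow> norm (f w) \<le> B"
  shows "norm ((deriv ^^ n) f z) \<le> fact n * B / r ^ n"
proof (rule Cauchy_inequality)
  show "f holomorphic_on ball z r"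
    using assms(1,2) ball_subset_cball holomorphic_on_subset by blast
  show "continuous_on (cball z r) f"
    using assms(1,2) holomorphic_on_imp_continuous_on holomorphic_on_subset by blast
  show "norm (f x) \<le> B" if "norm (z - x) = r" for x
    using that assms(2,4) by (auto simp: dist_norm subset_iff)
qed (use assms in auto)

text \<open>The remainder is itself holomorphic, so Cauchy's estimate bounds its derivative by
  O(t^2) at points that keep distance \<open>r\<close> from the boundary. Expansions can thus be
  differentiated in z at the cost of a smaller domain.\<close>

lemma jet_deriv:
  assumes j: "jet S F F0 F1" and S: "open S" and r: "0 < r" "\<And>z. z \<in> S' \<Longrightarrow> cball z r \<subseteq> S"
    and h: "\<forall>\<^sub>F t in at_right 0. F t holomorphic_on S" "F0 holomorphic_on S" "F1 holomorphic_on S"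
  shows "jet S' (\<lambda>t. deriv (F t)) (deriv F0) (deriv F1)"
proof -
  from j obtain B where B: "B \<ge> 0" "\<And>z. z \<in> S \<Longrightarrow> norm (F0 z) \<le> B" "\<And>z. z \<in> S \<Longrightarrow> norm (F1 z) \<le> B"
    "\<forall>\<^sub>F t in at_right 0. \<forall>z\<in>S. norm (F t z - F0 z - of_real t * F1 z) \<le> B * t\<^sup>2" by (rule jetE) blast
  have zS: "z \<in> S" if "z \<in> S'" for z using r that by (force simp: subset_iff)
  have "\<forall>\<^sub>F t in at_right 0. \<forall>z\<in>S'. norm (deriv (F t) z - deriv F0 z - of_real t * deriv F1 z) \<le> (B / r) * t\<^sup>2"
    using B(4) h(1)
  proof eventually_elim
    case (elim t)
    show ?case
    proof
      fix z assume z: "z \<in> S'"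
      have d: "F t field_differentiable at z" "F0 field_differentiable at z" "F1 field_differentiable at z"
        using elim h S zS[OF z] holomorphic_on_imp_differentiable_at by blast+
      have hol: "(\<lambda>z. F t z - F0 z - of_real t * F1 z) holomorphic_on S"
        using elim h by (intro holomorphic_intros) auto
      have "deriv (\<lambda>z. F t z - F0 z - of_real t * F1 z) z = deriv (F t) z - deriv F0 z - of_real t * deriv F1 z"
        using d by (simp add: field_differentiable_diff field_differentiable_mult)
      then show "norm (deriv (F t) z - deriv F0 z - of_real t * deriv F1 z) \<le> (B / r) * t\<^sup>2"
        using norm_higher_deriv_le[OF hol r(2)[OF z] r(1), of "B * t\<^sup>2" 1] elim by auto
    qed
  qed
  moreover have "norm (deriv F0 z) \<le> B / r" "norm (deriv F1 z) \<le> B / r" if "z \<in> S'" for z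
    using norm_higher_deriv_le[OF h(2) r(2)[OF that] r(1), of B 1] norm_higher_deriv_le[OF h(3) r(2)[OF that] r(1), of B 1] B
    by auto
  ultimately show ?thesis by (intro jetI)
qed

section \<open>The squared gradient on the boundary\<close>

definition theod :: "real \<Rightarrow> wl \<Rightarrow> bool" where
  "theod t a \<longleftrightarrow> refl_wl a = a \<and> alt a = a \<and> exp a = 1 + t *\<^sub>R zet a \<and>
     norm a \<le> 272 * t \<and> norm (a - t *\<^sub>R zet 0) \<le> 10^6 * t\<^sup>2"

text \<open>\<open>cmap a\<close> is the conformal map from the unit disc onto the domain; the torsion function is
  \<open>Re (hfun a z) - |cmap a z|\<^sup>2 / 4\<close> at the point \<open>cmap a z\<close>, and \<open>grad2 a \<phi>\<close> is the squared norm of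
  its gradient at the boundary point \<open>cmap a (exp (i \<phi>))\<close>, continued to complex \<open>\<phi>\<close>.\<close>

definition cmap :: "wl \<Rightarrow> complex \<Rightarrow> complex" where "cmap a z = z * exp (Pf a z)"
definition hfun :: "wl \<Rightarrow> complex \<Rightarrow> complex" where "hfun a = Pf ((1/4) *\<^sub>R exp (2 *\<^sub>R a))"
definition hder :: "wl \<Rightarrow> complex \<Rightarrow> complex" where "hder a z = deriv (hfun a) z / deriv (cmap a) z"
definition grad2 :: "wl \<Rightarrow> complex \<Rightarrow> complex" where
  "grad2 a w = (hder a (exp (- (\<i> * w))) - cmap a (exp (\<i> * w)) / 2)
             * (hder a (exp (\<i> * w)) - cmap a (exp (- (\<i> * w))) / 2)"

lemma cmap_holomorphic: "cmap a holomorphic_on ball 0 2"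
  unfolding cmap_def[abs_def] by (intro holomorphic_intros Pf_holomorphic)
lemma hfun_holomorphic: "hfun a holomorphic_on ball 0 2"
  unfolding hfun_def by (rule Pf_holomorphic)

lemma hfun_minus: "alt a = a \<Longrightarrow> hfun a (- z) = hfun a z"
  unfolding hfun_def
proof (rule Pf_minus)
  interpret bounded_linear alt by (rule bounded_linear_alt)
  assume "alt a = a"
  then show "alt ((1/4) *\<^sub>R exp (2 *\<^sub>R a)) = (1/4) *\<^sub>R exp (2 *\<^sub>R a)"
    by (simp add: scaleR hom_exp[OF bounded_linear_alt alt_mult alt_one])
qed

lemma cmap_minus: "alt a = a \<Longrightarrow> cmap a (- z) = - cmap a z"
  by (simp add: cmap_def Pf_minus)

lemma deriv_comp_uminus:
  assumes "f holomorphic_on ball 0 r" "norm z < r"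
  shows "deriv (\<lambda>z. f (- z)) z = - deriv f (- z)"
proof -
  have "(f has_field_derivative deriv f (- z)) (at (- z))"
    using assms by (intro holomorphic_derivI[of _ "ball 0 r"]) auto
  then have "((\<lambda>z. f (- z)) has_field_derivative deriv f (- z) * (- 1)) (at z)"
    by (intro DERIV_chain2[where f = f]) (auto intro!: derivative_eq_intros)
  then show ?thesis by (auto dest: DERIV_imp_deriv)
qed

lemma hder_minus:
  assumes "alt a = a" "norm z < 2"
  shows "hder a (- z) = - hder a z"
proof -
  have "deriv (hfun a) z = - deriv (hfun a) (- z)"
    using deriv_comp_uminus[OF hfun_holomorphic[of a] assms(2)] hfun_minus[OF assms(1)] by simp
  moreover have "deriv (\<lambda>z. - cmap a z) z = - deriv (cmap a) (- z)"
    using deriv_comp_uminus[OF cmap_holomorphic[of a] assms(2)] cmap_minus[OF assms(1)] by simp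
  then have "deriv (cmap a) z = deriv (cmap a) (- z)"
    using assms(2) holomorphic_on_imp_differentiable_at[OF cmap_holomorphic, of z] by simp
  ultimately show ?thesis by (simp add: hder_def)
qed

abbreviation strip :: "complex set" where "strip \<equiv> {w. \<bar>Im w\<bar> < 1/2}"

text \<open>The half-width 1/2 is matched to the radius 7/4 by e^(1/2) \<le> 1 + 1/2 + 1/4. Both
  exponentials then stay where the derivatives of \<open>cmap\<close> and \<open>hfun\<close> are
  controlled.\<close>

lemma exp_strip:
  assumes "w \<in> strip"
  shows "exp (\<i> * w) \<in> ball 0 (7/4)" "exp (- (\<i> * w)) \<in> ball 0 (7/4)"
proof -
  have e: "exp (1/2 :: real) \<le> 7/4" using exp_bound[of "1/2"] by (simp add: power2_eq_square)
  have "exp (- Im w) < exp (1/2)" "exp (Im w) < exp (1/2)" using assms by auto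
  then show "exp (\<i> * w) \<in> ball 0 (7/4)" "exp (- (\<i> * w)) \<in> ball 0 (7/4)"
    using e by (auto simp: norm_exp_eq_Re simp del: exp_less_cancel_iff)
qed

text \<open>Reflection in the x2-axis: w \<mapsto> \<pi> - w sends exp(iw) to -exp(-iw). Since
  \<open>cmap\<close> and \<open>hder\<close> are odd, the two factors of \<open>grad2\<close>
  change sign and trade places.\<close>

lemma grad2_reflect:
  assumes "alt a = a" "w \<in> strip"
  shows "grad2 a (of_real pi - w) = grad2 a w"
proof -
  have 1: "exp (\<i> * (of_real pi - w)) = - exp (- (\<i> * w))"
    by (simp add: right_diff_distrib exp_diff exp_minus field_simps)
  have 2: "exp (- (\<i> * (of_real pi - w))) = - exp (\<i> * w)"
    by (simp add: right_diff_distrib exp_diff exp_minus field_simps)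
  have n: "norm (exp (\<i> * w)) < 2" "norm (exp (- (\<i> * w))) < 2"
    using exp_strip[OF assms(2)] by (simp_all only: dist_0_norm mem_ball)
  show ?thesis
    unfolding grad2_def 1 2 cmap_minus[OF assms(1)] hder_minus[OF assms(1) n(1)] hder_minus[OF assms(1) n(2)]
    by (simp add: algebra_simps)
qed

lemma grad2_even: "grad2 a (- w) = grad2 a w"
  by (simp add: grad2_def mult.commute)

lemma cball_74: "z \<in> cball 0 (7/4) \<Longrightarrow> cball z (1/8) \<subseteq> ball (0::complex) 2"
proof
  fix w assume "z \<in> cball 0 (7/4)" "w \<in> cball z (1/8)"
  then show "w \<in> ball 0 2"
    using dist_triangle[of 0 w z] by simp
qed

section \<open>Expansions in t along a chosen family of solutions\<close>

context
  fixes A :: "real \<Rightarrow> wl"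
  assumes A: "\<forall>t. 0 < t \<and> t \<le> 1/11000 \<longrightarrow> theod t (A t)"
begin

lemma ev_theod: "\<forall>\<^sub>F t in at_right 0. t > 0 \<and> theod t (A t) \<and> norm (2 *\<^sub>R A t) \<le> 1"
proof -
  have "\<forall>\<^sub>F t::real in at_right 0. t < 1/11000" "\<forall>\<^sub>F t::real in at_right 0. t > 0"
    by (auto simp: eventually_at_right_field intro: exI[of _ "1/11000"])
  then show ?thesis
  proof eventually_elim
    case (elim t)
    then have "theod t (A t)" using A by simp
    moreover have "norm (2 *\<^sub>R A t) \<le> 1" using calculation elim by (simp add: theod_def)
    ultimately show ?case using elim by simp
  qed
qed

lemma jet_G: "jet (ball 0 2) (\<lambda>t. Pf (A t)) (\<lambda>_. 0) (\<lambda>z. 13 * z ^ 2 - z ^ 4)"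
proof (rule jetI)
  fix z :: complex assume z: "z \<in> ball 0 2"
  show "norm (13 * z ^ 2 - z ^ 4) \<le> 68 * 2"
    using norm_Pf_le[of z "zet 0"] norm_zet_0 z by (simp add: Pf_zet_0)
next
  show "\<forall>\<^sub>F t in at_right 0. \<forall>z\<in>ball 0 2. norm (Pf (A t) z - 0 - of_real t * (13 * z ^ 2 - z ^ 4)) \<le> 2 * 10^6 * t\<^sup>2"
    using ev_theod
  proof eventually_elim
    case (elim t)
    show ?case
    proof
      fix z :: complex assume z: "z \<in> ball 0 2"
      have "norm (Pf (A t - t *\<^sub>R zet 0) z) \<le> 2 * norm (A t - t *\<^sub>R zet 0)"
        using z by (intro norm_Pf_le) auto
      also have "\<dots> \<le> 2 * (10^6 * t\<^sup>2)" using elim by (simp add: theod_def)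
      finally show "norm (Pf (A t) z - 0 - of_real t * (13 * z ^ 2 - z ^ 4)) \<le> 2 * 10^6 * t\<^sup>2"
        using z by (simp add: Pf_diff_scale Pf_zet_0)
    qed
  qed
qed auto

lemma jet_H: "jet (ball 0 2) (\<lambda>t. hfun (A t)) (\<lambda>_. 1/4) (\<lambda>z. (13 * z ^ 2 - z ^ 4) / 2)"
proof (rule jetI[where K = 1])
  fix z :: complex assume z: "z \<in> ball 0 2"
  show "norm ((13 * z ^ 2 - z ^ 4) / 2) \<le> 68"
    using norm_Pf_le[of z "zet 0"] norm_zet_0 z by (simp add: Pf_zet_0 norm_divide)
next
  show "\<forall>\<^sub>F t in at_right 0. \<forall>z\<in>ball 0 2. norm (hfun (A t) z - 1/4 - of_real t * ((13 * z ^ 2 - z ^ 4) / 2)) \<le> 2 * 10^6 * t\<^sup>2"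
    using ev_theod
  proof eventually_elim
    case (elim t)
    define a where "a = A t"
    have a: "norm a \<le> 272 * t" "norm (a - t *\<^sub>R zet 0) \<le> 10^6 * t\<^sup>2" using elim by (auto simp: theod_def a_def)
    \<comment> \<open>The remainder is formed in the algebra, where exp (2a) / 4 = 1/4 + a/2 +
      O(|a|^2) is available, and is passed through the bounded linear completion afterwards.\<close>
    define X where "X = (1/4) *\<^sub>R exp (2 *\<^sub>R a) - (1/4) *\<^sub>R 1 - (t/2) *\<^sub>R zet 0"
    have "X = (1/2) *\<^sub>R (a - t *\<^sub>R zet 0) + (1/4) *\<^sub>R (exp (2 *\<^sub>R a) - 1 - 2 *\<^sub>R a)"
      by (simp add: X_def algebra_simps)
    also have "norm \<dots> \<le> 1/2 * norm (a - t *\<^sub>R zet 0) + 1/4 * norm (exp (2 *\<^sub>R a) - 1 - 2 *\<^sub>R a)"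
      by (rule order_trans[OF norm_triangle_ineq]) simp
    also have "\<dots> \<le> 1/2 * (10^6 * t\<^sup>2) + 1/4 * (2 * norm (2 *\<^sub>R a) ^ 2)"
      using elim a by (intro add_mono mult_left_mono exp_remainder_le) (auto simp: a_def)
    also have "\<dots> \<le> 1/2 * (10^6 * t\<^sup>2) + 1/4 * (2 * (544 * t) ^ 2)"
      using a elim by (intro add_mono mult_left_mono power_mono) auto
    also have "\<dots> \<le> 10^6 * t\<^sup>2" by (simp add: power_mult_distrib)
    finally have X: "norm X \<le> 10^6 * t\<^sup>2" .
    show ?case
    proof
      fix z :: complex assume z: "z \<in> ball 0 2"
      have "norm (Pf X z) \<le> 2 * norm X" using z by (intro norm_Pf_le) auto
      also have "Pf X z = hfun a z - of_real (1/4) * 1 - of_real (t/2) * (13 * z ^ 2 - z ^ 4)"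
        using z unfolding X_def hfun_def by (simp only: Pf_diff_scale Pf_zet_0 Pf_one dist_0_norm mem_ball less_imp_le)
      finally show "norm (hfun (A t) z - 1/4 - of_real t * ((13 * z ^ 2 - z ^ 4) / 2)) \<le> 2 * 10^6 * t\<^sup>2"
        using X by (simp add: a_def)
    qed
  qed
qed auto

lemma jet_cmap: "jet (ball 0 2) (\<lambda>t. cmap (A t)) (\<lambda>z. z) (\<lambda>z. z * (13 * z ^ 2 - z ^ 4))"
proof -
  have "jet (ball 0 2) (\<lambda>t z. z) (\<lambda>z. z) (\<lambda>_. 0)"
    by (rule jet_const[where A = 2]) auto
  from jet_mult[OF this jet_exp[OF jet_G]] show ?thesis
    by (rule jet_cong) (auto simp: cmap_def)
qed

text \<open>The first-order coefficient can stay unevaluated: in \<open>hder\<close> it meets the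
  zeroth-order term of the derivative of \<open>hfun\<close>, which is 0.\<close>

lemma jet_cmap': "jet (cball 0 (7/4)) (\<lambda>t. deriv (cmap (A t))) (\<lambda>_. 1) (deriv (\<lambda>z. z * (13 * z ^ 2 - z ^ 4)))"
proof -
  have "jet (cball 0 (7/4)) (\<lambda>t. deriv (cmap (A t))) (deriv (\<lambda>z. z)) (deriv (\<lambda>z. z * (13 * z ^ 2 - z ^ 4)))"
    by (rule jet_deriv[OF jet_cmap _ _ cball_74]) (auto intro!: holomorphic_intros cmap_holomorphic always_eventually)
  then show ?thesis by (rule jet_cong) auto
qed

lemma jet_H': "jet (cball 0 (7/4)) (\<lambda>t. deriv (hfun (A t))) (\<lambda>_. 0) (\<lambda>z. 13 * z - 2 * z ^ 3)"
proof -
  have "jet (cball 0 (7/4)) (\<lambda>t. deriv (hfun (A t))) (deriv (\<lambda>_. 1/4)) (deriv (\<lambda>z. (13 * z ^ 2 - z ^ 4) / 2))"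
    by (rule jet_deriv[OF jet_H _ _ cball_74]) (auto intro!: holomorphic_intros hfun_holomorphic always_eventually)
  then show ?thesis
  proof (rule jet_cong)
    show "13 * z - 2 * z ^ 3 = deriv (\<lambda>z. (13 * z ^ 2 - z ^ 4) / 2) z" for z :: complex
      by (rule DERIV_imp_deriv[symmetric]) (auto intro!: derivative_eq_intros simp: power2_eq_square power3_eq_cube)
  qed auto
qed

lemma jet_hder: "jet (cball 0 (7/4)) (\<lambda>t. hder (A t)) (\<lambda>_. 0) (\<lambda>z. 13 * z - 2 * z ^ 3)"
proof (rule jet_cong[OF jet_mult[OF jet_H' jet_inverse[OF jet_cmap']]])
  show "\<forall>\<^sub>F t in at_right 0. \<forall>z\<in>cball 0 (7/4). hder (A t) z = deriv (hfun (A t)) z * inverse (deriv (cmap (A t)) z)"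
    unfolding hder_def divide_inverse by simp
qed simp_all

text \<open>Put x = exp(iw) and y = exp(-iw). For t = 0 the terms with \<open>hder\<close> vanish
  and the product is xy/4. The first-order coefficient is a polynomial in x and y that collapses
  modulo xy = 1, which is the identity \<open>alg\<close>.\<close>

lemma jet_grad2: "jet strip (\<lambda>t. grad2 (A t)) (\<lambda>_. 1/4) (\<lambda>w. 3/2 * cos (4 * w) - 13/2 * cos (2 * w))"
proof -
  have P: "exp (\<i> * w) \<in> cball 0 (7/4)" "exp (- (\<i> * w)) \<in> cball 0 (7/4)"
    "exp (\<i> * w) \<in> ball 0 2" "exp (- (\<i> * w)) \<in> ball 0 2" if "w \<in> strip" for w
    using exp_strip[OF that] by (simp_all only: dist_0_norm mem_ball mem_cball)
  have half: "jet strip (\<lambda>t z. - 1/2) (\<lambda>_. - 1/2) (\<lambda>_. 0)"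
    by (rule jet_const[where A = 1]) auto
  have x: "exp (\<i> * w) * exp (- (\<i> * w)) = 1" for w by (simp add: exp_minus)
  note k1 = jet_compose[OF jet_hder P(2)] and k2 = jet_compose[OF jet_hder P(1)]
  note f1 = jet_mult[OF half jet_compose[OF jet_cmap P(3)]] and f2 = jet_mult[OF half jet_compose[OF jet_cmap P(4)]]
  have alg: "(0 + - 1/2 * x) * (13 * x - 2 * x ^ 3 + (- 1/2 * (y * (13 * y ^ 2 - y ^ 4)) + 0 * y))
      + (13 * y - 2 * y ^ 3 + (- 1/2 * (x * (13 * x ^ 2 - x ^ 4)) + 0 * x)) * (0 + - 1/2 * y)
      = 3/4 * (x ^ 4 + y ^ 4) - 13/4 * (x ^ 2 + y ^ 2)" if "x * y = 1" for x y :: complex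
  proof -
    have "(0 + - 1/2 * x) * (13 * x - 2 * x ^ 3 + (- 1/2 * (y * (13 * y ^ 2 - y ^ 4)) + 0 * y))
      + (13 * y - 2 * y ^ 3 + (- 1/2 * (x * (13 * x ^ 2 - x ^ 4)) + 0 * x)) * (0 + - 1/2 * y)
      = (x ^ 4 + y ^ 4) - 13/2 * (x ^ 2 + y ^ 2) + (x * y) * ((13 * y ^ 2 - y ^ 4) + (13 * x ^ 2 - x ^ 4)) / 4"
      by (simp add: algebra_simps power2_eq_square power3_eq_cube power4_eq_xxxx add_divide_distrib diff_divide_distrib)
    also have "\<dots> = 3/4 * (x ^ 4 + y ^ 4) - 13/4 * (x ^ 2 + y ^ 2)"
      unfolding that by (simp add: field_simps)
    finally show ?thesis .
  qed
  have c: "cos (of_nat n * w) = (exp (\<i> * w) ^ n + exp (- (\<i> * w)) ^ n) / 2" for n w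
    unfolding exp_of_nat_mult[symmetric] by (simp add: cos_exp_eq mult.left_commute)
  show ?thesis
  proof (rule jet_cong[OF jet_mult[OF jet_add[OF k1 f1] jet_add[OF k2 f2]]])
    show "\<forall>\<^sub>F t in at_right 0. \<forall>z\<in>strip. grad2 (A t) z =
       (hder (A t) (exp (- (\<i> * z))) + - 1 / 2 * cmap (A t) (exp (\<i> * z))) *
       (hder (A t) (exp (\<i> * z)) + - 1 / 2 * cmap (A t) (exp (- (\<i> * z))))"
      by (simp add: grad2_def)
    fix w assume "w \<in> strip"
    show "1/4 = (0 + - 1 / 2 * exp (\<i> * w)) * (0 + - 1 / 2 * exp (- (\<i> * w)))"
      using x[of w] by simp
    have c42: "cos (4 * w) = (exp (\<i> * w) ^ 4 + exp (- (\<i> * w)) ^ 4) / 2" "cos (2 * w) = (exp (\<i> * w) ^ 2 + exp (- (\<i> * w)) ^ 2) / 2"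
      using c[of 4 w] c[of 2 w] by simp_all
    show "3/2 * cos (4 * w) - 13/2 * cos (2 * w) =
      (0 + - 1 / 2 * exp (\<i> * w)) * (13 * exp (\<i> * w) - 2 * exp (\<i> * w) ^ 3 +
          (- 1 / 2 * (exp (- (\<i> * w)) * (13 * exp (- (\<i> * w)) ^ 2 - exp (- (\<i> * w)) ^ 4)) + 0 * exp (- (\<i> * w))))
      + (13 * exp (- (\<i> * w)) - 2 * exp (- (\<i> * w)) ^ 3 +
          (- 1 / 2 * (exp (\<i> * w) * (13 * exp (\<i> * w) ^ 2 - exp (\<i> * w) ^ 4)) + 0 * exp (\<i> * w))) * (0 + - 1 / 2 * exp (- (\<i> * w)))"
      unfolding alg[OF x] c42 by (simp add: field_simps)
  qed
qed

end

section \<open>Strict monotonicity of the squared gradient in the circle angle\<close>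

lemma half_le_sin:
  fixes x :: real
  assumes "0 \<le> x" "x \<le> pi / 2"
  shows "x / 2 \<le> sin x"
proof (cases "x \<le> pi / 3")
  case True
  have "sin 0 - 0 / 2 \<le> sin x - x / 2"
  proof (rule DERIV_nonneg_imp_nondecreasing[OF assms(1)])
    fix y assume y: "0 \<le> y" "y \<le> x"
    have "cos (pi / 3) \<le> cos y" using y True by (intro cos_monotone_0_pi_le) auto
    then have "0 \<le> cos y - 1 / 2" by (simp add: cos_60)
    moreover have "((\<lambda>x. sin x - x / 2) has_field_derivative cos y - 1 / 2) (at y)"
      by (auto intro!: derivative_eq_intros)
    ultimately show "\<exists>D. ((\<lambda>x. sin x - x / 2) has_field_derivative D) (at y) \<and> 0 \<le> D" by blast
  qed
  then show ?thesis by simp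
next
  case False
  \<comment> \<open>Beyond \<pi>/3 the sine is at least 0.85, whereas x/2 is at most \<pi>/4 <
    0.79.\<close>
  have "sqrt 3 / 2 \<le> sin x"
    using sin_monotone_2pi_le[of "pi / 3" x] False assms by (simp add: sin_60)
  moreover have "1.7 \<le> sqrt 3" by (rule real_le_rsqrt) (simp add: power2_eq_square)
  ultimately show ?thesis using assms pi_less_4 pi_approx by simp
qed

text \<open>The left side is the distance to the nearer end of the quarter circle. A Lipschitz
  function that vanishes at both ends is therefore bounded by a multiple of sin 2x.\<close>

lemma min_le_sin_double:
  fixes x :: real
  assumes "0 \<le> x" "x \<le> pi / 2"
  shows "min x (pi / 2 - x) \<le> sin (2 * x)"
proof (cases "x \<le> pi / 4")
  case True
  then show ?thesis using half_le_sin[of "2 * x"] assms by simp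
next
  case False
  have "sin (pi - 2 * x) = sin (2 * x)" by simp
  then show ?thesis using half_le_sin[of "pi - 2 * x"] assms False by simp
qed

lemma has_real_derivative_Re:
  assumes "(f has_field_derivative D) (at (of_real x))"
  shows "((\<lambda>x. Re (f (of_real x))) has_field_derivative Re D) (at x)"
  using bounded_linear.has_vector_derivative[OF bounded_linear_Re has_vector_derivative_real_field[OF assms]]
  by (simp add: has_real_derivative_iff_has_vector_derivative)

lemma open_strip: "open strip"
proof -
  have "strip = {w. Im w < 1/2} \<inter> {w. Im w > -1/2}" by auto
  then show ?thesis by (metis open_Int open_halfspace_Im_gt open_halfspace_Im_lt)
qed

lemma grad2_holomorphic:
  assumes "\<And>z. z \<in> ball 0 (7/4) \<Longrightarrow> deriv (cmap a) z \<noteq> 0"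
  shows "grad2 a holomorphic_on strip"
proof -
  have sub: "ball 0 (7/4) \<subseteq> (ball 0 2 :: complex set)" by auto
  have h: "hder a holomorphic_on ball 0 (7/4)"
    unfolding hder_def[abs_def] using assms
    by (intro holomorphic_on_divide holomorphic_deriv holomorphic_on_subset[OF hfun_holomorphic sub]
        holomorphic_on_subset[OF cmap_holomorphic sub]) auto
  have c: "cmap a holomorphic_on ball 0 (7/4)"
    by (rule holomorphic_on_subset[OF cmap_holomorphic sub])
  have e: "(\<lambda>w. exp (\<i> * w)) holomorphic_on strip" "(\<lambda>w. exp (- (\<i> * w))) holomorphic_on strip"
    by (intro holomorphic_intros)+
  have comp: "(\<lambda>w. g (exp (\<i> * w))) holomorphic_on strip" "(\<lambda>w. g (exp (- (\<i> * w)))) holomorphic_on strip"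
    if g: "g holomorphic_on ball 0 (7/4)" for g
    using holomorphic_on_compose_gen[OF e(1) g] holomorphic_on_compose_gen[OF e(2) g] exp_strip
    by (force simp: o_def)+
  show ?thesis
    unfolding grad2_def[abs_def] by (intro holomorphic_intros comp h c) auto
qed

text \<open>Differentiating f (c - w) = f w at the fixed point of the reflection gives f' = - f'
  there.\<close>

lemma deriv_reflect:
  assumes f: "f holomorphic_on S" and S: "open S" "z \<in> S"
    and refl: "\<And>w. w \<in> S \<Longrightarrow> c - w \<in> S \<and> f (c - w) = f w" and fp: "c - z = z"
  shows "deriv f z = 0"
proof -
  have d: "(f has_field_derivative deriv f z) (at z)"
    using holomorphic_derivI[OF f S] .
  then have "((\<lambda>w. f (c - w)) has_field_derivative deriv f z * (- 1)) (at z)"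
    by (intro DERIV_chain2[where f = f]) (auto intro!: derivative_eq_intros simp: fp)
  then have "(f has_field_derivative deriv f z * (- 1)) (at z)"
    by (rule has_field_derivative_transform_within_open[OF _ S]) (use refl in auto)
  then have "deriv f z = deriv f z * (- 1)" using d DERIV_unique by blast
  then show ?thesis by simp
qed

lemma grad2_strict_mono:
  assumes A: "\<forall>t. 0 < t \<and> t \<le> 1/11000 \<longrightarrow> theod t (A t)"
  shows "\<forall>\<^sub>F t in at_right 0. strict_mono_on {0..pi/2} (\<lambda>\<phi>. Re (grad2 (A t) (of_real \<phi>)))"
proof -
  define q1 where "q1 = (\<lambda>w::complex. 3/2 * cos (4 * w) - 13/2 * cos (2 * w))"
  obtain B where B: "B \<ge> 0"
    "\<forall>\<^sub>F t in at_right 0. \<forall>z\<in>strip. norm (grad2 (A t) z - 1/4 - of_real t * q1 z) \<le> B * t\<^sup>2"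
  proof -
    have "jet strip (\<lambda>t. grad2 (A t)) (\<lambda>_. 1/4) q1"
      unfolding q1_def by (rule jet_grad2[of A, OF A])
    then show thesis by (rule jetE) (rule that)
  qed
  have nz: "\<forall>\<^sub>F t in at_right 0. \<forall>z\<in>cball 0 (7/4). norm (deriv (cmap (A t)) z - 1) \<le> 1/2"
    by (rule jet_close[OF jet_cmap'[of A, OF A]]) auto
  \<comment> \<open>Chosen so that the error bound \<open>M\<close>, equal to 32 B t^2, falls below
    t.\<close>
  have "\<forall>\<^sub>F t::real in at_right 0. t < 1 / (32 * B + 1)"
    by (rule order_tendstoD(2)[OF tendsto_ident_at]) (use B(1) in auto)
  moreover have "\<forall>\<^sub>F t::real in at_right 0. t > 0" by (rule eventually_at_right_less)
  ultimately show ?thesis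
    using B(2) nz ev_theod[of A, OF A]
  proof eventually_elim
    case (elim t)
    define a where "a = A t"
    define E where "E w = grad2 a w - 1/4 - of_real t * q1 w" for w
    have alt: "alt a = a" using elim by (simp add: a_def theod_def)
    have nz: "deriv (cmap a) z \<noteq> 0" if "z \<in> ball 0 (7/4)" for z
    proof
      assume "deriv (cmap a) z = 0"
      then show False using elim(4) that by (auto simp: a_def dest!: bspec[of _ _ z])
    qed
    have ghol: "grad2 a holomorphic_on strip" by (rule grad2_holomorphic[OF nz])
    have q1hol: "q1 holomorphic_on UNIV" unfolding q1_def by (intro holomorphic_intros)
    have Ehol: "E holomorphic_on strip"
      unfolding E_def[abs_def] by (intro holomorphic_intros ghol holomorphic_on_subset[OF q1hol]) auto
    have Ele: "norm (E w) \<le> B * t\<^sup>2" if "w \<in> strip" for w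
      using elim that by (simp add: E_def a_def)
    have real_strip: "of_real x \<in> strip" for x by simp
    \<comment> \<open>Cauchy's estimate for the second derivative on discs of radius 1/4, which fit
      into the strip around real points: 2! B t^2 / (1/4)^2.\<close>
    define M where "M = 32 * B * t\<^sup>2"
    have dd: "norm (deriv (deriv E) (of_real x)) \<le> M" for x :: real
    proof -
      have "cball (of_real x) (1/4) \<subseteq> strip"
      proof
        fix w assume "w \<in> cball (complex_of_real x) (1/4)"
        then show "w \<in> strip" using abs_Im_le_cmod[of "w - of_real x"] by (simp add: dist_norm norm_minus_commute)
      qed
      from norm_higher_deriv_le[OF Ehol this _ Ele, of 2] show ?thesis
        by (simp add: M_def power2_eq_square numeral_2_eq_2)
    qed
    have q1e: "q1 (- w) = q1 w" "q1 (of_real pi - w) = q1 w" for w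
    proof -
      have c2: "cos (2 * v) = 2 * (cos v)\<^sup>2 - 1" for v :: complex by (rule cos_double_cos)
      have c4: "cos (4 * v) = 2 * (cos (2 * v))\<^sup>2 - 1" for v :: complex using c2[of "2 * v"] by simp
      have "cos (of_real pi - w) = - cos w" by (simp add: cos_diff cos_of_real sin_of_real)
      then have "cos (2 * (of_real pi - w)) = cos (2 * w)" by (simp only: c2) simp
      then have "cos (4 * (of_real pi - w)) = cos (4 * w)" "cos (2 * (of_real pi - w)) = cos (2 * w)"
        by (simp_all only: c4)
      then show "q1 (of_real pi - w) = q1 w" by (simp only: q1_def)
    qed (simp add: q1_def)
    have E0: "deriv E 0 = 0"
      by (rule deriv_reflect[OF Ehol open_strip, where c = 0]) (auto simp: E_def grad2_even q1e)
    have E1: "deriv E (of_real (pi/2)) = 0"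
      by (rule deriv_reflect[OF Ehol open_strip, where c = "of_real pi"])
         (auto simp: E_def grad2_reflect[OF alt] q1e)
    have bd: "norm (deriv E (of_real x) - deriv E (of_real y)) \<le> M * \<bar>x - y\<bar>" for x y
    proof -
      have "norm (deriv E (of_real x) - deriv E (of_real y)) \<le> M * norm (complex_of_real x - of_real y)"
      proof (rule field_differentiable_bound[where S = \<real>])
        fix z :: complex assume "z \<in> \<real>"
        then have r: "z = of_real (Re z)" by simp
        show "(deriv E has_field_derivative deriv (deriv E) z) (at z within \<real>)"
          by (subst (1 2) r, rule has_field_derivative_at_within,
              rule holomorphic_derivI[OF holomorphic_deriv[OF Ehol open_strip] open_strip real_strip])
        show "norm (deriv (deriv E) z) \<le> M" by (subst r) (rule dd)
      qed (auto simp: convex_Reals)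
      then show ?thesis by (simp flip: of_real_diff)
    qed
    have pos: "\<exists>D. ((\<lambda>\<phi>. Re (grad2 a (of_real \<phi>))) has_field_derivative D) (at x) \<and> 0 < D"
      if x: "0 < x" "x < pi / 2" for x
    proof (intro exI conjI)
      have "(grad2 a has_field_derivative deriv (grad2 a) (of_real x)) (at (of_real x))"
        by (rule holomorphic_derivI[OF ghol open_strip real_strip])
      then show "((\<lambda>\<phi>. Re (grad2 a (of_real \<phi>))) has_field_derivative Re (deriv (grad2 a) (of_real x))) (at x)"
        by (rule has_real_derivative_Re)
      have "(E has_field_derivative deriv E (of_real x)) (at (of_real x))"
        by (rule holomorphic_derivI[OF Ehol open_strip real_strip])
      then have "((\<lambda>w. E w + 1/4 + of_real t * q1 w) has_field_derivative
          deriv E (of_real x) + of_real t * (13 * sin (2 * of_real x) - 6 * sin (4 * of_real x))) (at (of_real x))"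
        unfolding q1_def by (auto intro!: derivative_eq_intros)
      then have "deriv (grad2 a) (of_real x) = deriv E (of_real x) + of_real t * (13 * sin (2 * of_real x) - 6 * sin (4 * of_real x))"
        by (simp add: E_def DERIV_imp_deriv)
      also have "13 * sin (2 * complex_of_real x) - 6 * sin (4 * complex_of_real x) = of_real (13 * sin (2 * x) - 6 * sin (4 * x))"
        by (simp flip: sin_of_real)
      also have "13 * sin (2 * x) - 6 * sin (4 * x) = sin (2 * x) * (13 - 12 * cos (2 * x))"
        using sin_double[of "2 * x"] by (simp add: algebra_simps)
      finally have D: "Re (deriv (grad2 a) (of_real x)) = Re (deriv E (of_real x)) + t * (sin (2 * x) * (13 - 12 * cos (2 * x)))"
        by simp
      have s: "0 < sin (2 * x)" using x by (intro sin_gt_zero) auto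
      have "norm (deriv E (of_real x)) \<le> M * min x (pi / 2 - x)"
        using bd[of x 0] bd[of x "pi/2"] x E0 E1 by (auto simp: min_def)
      also have "\<dots> \<le> M * sin (2 * x)"
        using min_le_sin_double[of x] x B(1) by (intro mult_left_mono) (auto simp: M_def)
      finally have "- (M * sin (2 * x)) \<le> Re (deriv E (of_real x))"
        using abs_Re_le_cmod[of "deriv E (of_real x)"] by linarith
      moreover have "M * sin (2 * x) < t * sin (2 * x)"
      proof (rule mult_strict_right_mono[OF _ s])
        have "t * (32 * B + 1) < 1" using elim(1) B(1) by (simp add: field_simps)
        then have "t * (32 * B) < 1" using elim(2) by (simp add: algebra_simps)
        then have "t * (t * (32 * B)) < t * 1" using elim(2) by (intro mult_strict_left_mono)
        then show "M < t" by (simp add: M_def power2_eq_square algebra_simps)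
      qed
      moreover have "t * sin (2 * x) \<le> t * (sin (2 * x) * (13 - 12 * cos (2 * x)))"
        using s elim(2) mult_left_mono[of 1 "13 - 12 * cos (2 * x)" "sin (2 * x)"] by (intro mult_left_mono) auto
      ultimately show "0 < Re (deriv (grad2 a) (of_real x))" unfolding D by linarith
    qed
    have cont: "continuous_on {0..pi/2} (\<lambda>\<phi>. Re (grad2 a (of_real \<phi>)))"
      by (intro continuous_intros continuous_on_compose2[OF holomorphic_on_imp_continuous_on[OF ghol]]) auto
    show ?case
    proof (rule strict_mono_onI)
      fix x y :: real assume xy: "x \<in> {0..pi/2}" "y \<in> {0..pi/2}" "x < y"
      have "Re (grad2 a (of_real x)) < Re (grad2 a (of_real y))"
        by (rule DERIV_pos_imp_increasing_open[OF xy(3)])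
           (use xy pos in \<open>auto intro: continuous_on_subset[OF cont]\<close>)
      then show "Re (grad2 (A t) (of_real x)) < Re (grad2 (A t) (of_real y))" by (simp add: a_def)
    qed
  qed
qed

text \<open>Each bound has its purpose: \<open>deriv (cmap a)\<close> near 1 gives injectivity,
  smallness of \<open>Pf a\<close> keeps the boundary correspondence close to the identity, and
  smallness of its derivative makes that correspondence strictly increasing.\<close>

lemma conformal_data:
  "\<forall>\<^sub>F t in at_right 0. \<exists>a. theod t a \<and> strict_mono_on {0..pi/2} (\<lambda>\<phi>. Re (grad2 a (of_real \<phi>))) \<and>
     (\<forall>z\<in>cball 0 (7/4). norm (deriv (cmap a) z - 1) \<le> 1/2 \<and> norm (Pf a z) \<le> 1/4 \<and> norm (deriv (Pf a) z) \<le> 1/4)"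
proof -
  have "\<exists>a. theod t a" if "0 < t" "t \<le> 1/11000" for t
    using theodorsen_solution[OF that] unfolding theod_def by metis
  then obtain A where A: "\<forall>t. 0 < t \<and> t \<le> 1/11000 \<longrightarrow> theod t (A t)" by metis
  have c: "\<forall>\<^sub>F t in at_right 0. \<forall>z\<in>cball 0 (7/4). norm (deriv (cmap (A t)) z - 1) \<le> 1/2"
    by (rule jet_close[OF jet_cmap'[of A, OF A]]) auto
  have P: "\<forall>\<^sub>F t in at_right 0. \<forall>z\<in>ball 0 2. norm (Pf (A t) z - 0) \<le> 1/4"
    by (rule jet_close[OF jet_G[of A, OF A]]) auto
  have "jet (cball 0 (7/4)) (\<lambda>t. deriv (Pf (A t))) (deriv (\<lambda>_. 0)) (deriv (\<lambda>z. 13 * z ^ 2 - z ^ 4))"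
    by (rule jet_deriv[OF jet_G[of A, OF A] _ _ cball_74]) (auto intro!: holomorphic_intros Pf_holomorphic always_eventually)
  then have P': "\<forall>\<^sub>F t in at_right 0. \<forall>z\<in>cball 0 (7/4). norm (deriv (Pf (A t)) z - deriv (\<lambda>_. 0) z) \<le> 1/4"
    by (rule jet_close) auto
  show ?thesis
    using c P P' grad2_strict_mono[of A, OF A] ev_theod[of A, OF A]
  proof eventually_elim
    case (elim t)
    then show ?case by (intro exI[of _ "A t"]) force
  qed
qed

section \<open>The perturbed disc\<close>

text \<open>Directional derivatives of polynomials are again polynomials. Iterating this gives
  smoothness of every order by induction on the multi-index.\<close>

lemma real_polynomial_function_has_derivative:
  assumes "real_polynomial_function f"
  shows "\<exists>D. (\<forall>x. (f has_derivative D x) (at x)) \<and> (\<forall>h. real_polynomial_function (\<lambda>x. D x h))"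
  using assms
proof induction
  case (linear f)
  then show ?case
    by (intro exI[of _ "\<lambda>x. f"]) (auto intro: bounded_linear_imp_has_derivative)
next
  case (const c)
  then show ?case by (intro exI[of _ "\<lambda>x h. 0"]) auto
next
  case (add f g)
  then obtain D E where "\<forall>x. (f has_derivative D x) (at x)" "\<forall>h. real_polynomial_function (\<lambda>x. D x h)"
    "\<forall>x. (g has_derivative E x) (at x)" "\<forall>h. real_polynomial_function (\<lambda>x. E x h)" by blast
  then show ?case
    by (intro exI[of _ "\<lambda>x h. D x h + E x h"]) (auto intro!: has_derivative_add)
next
  case (mult f g)
  then obtain D E where D: "\<forall>x. (f has_derivative D x) (at x)" "\<forall>h. real_polynomial_function (\<lambda>x. D x h)"
    "\<forall>x. (g has_derivative E x) (at x)" "\<forall>h. real_polynomial_function (\<lambda>x. E x h)" by blast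
  show ?case
  proof (intro exI conjI allI)
    show "((\<lambda>x. f x * g x) has_derivative (\<lambda>h. f x * E x h + D x h * g x)) (at x)" for x
      using D by (intro has_derivative_mult) auto
    show "real_polynomial_function (\<lambda>x. f x * E x h + D x h * g x)" for h
      using D mult.hyps by (intro real_polynomial_function.intros(3,4)) auto
  qed
qed

lemma pd_eq: "(f has_derivative D) (at x) \<Longrightarrow> pd i f x = D (axis i 1)"
  unfolding pd_def by (metis frechet_derivative_at)

lemma real_polynomial_function_pd:
  fixes f :: "real ^ 'n::finite \<Rightarrow> real"
  assumes "real_polynomial_function f"
  shows "f differentiable (at x)" "real_polynomial_function (pd i f)"
proof -
  from real_polynomial_function_has_derivative[OF assms] obtain D where
    D: "\<And>x. (f has_derivative D x) (at x)" "\<And>h. real_polynomial_function (\<lambda>x. D x h)" by blast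
  show "f differentiable (at x)" using D(1) by (rule differentiableI)
  have "pd i f = (\<lambda>x. D x (axis i 1))" by (rule ext) (rule pd_eq[OF D(1)])
  then show "real_polynomial_function (pd i f)" using D(2) by simp
qed

lemma Ck_on_real_polynomial_function:
  fixes f :: "real ^ 'n::finite \<Rightarrow> real"
  assumes "real_polynomial_function f"
  shows "Ck_on k S f"
proof -
  have p: "real_polynomial_function (foldr pd is f)" for "is"
    by (induction "is") (auto intro: assms real_polynomial_function_pd(2))
  show ?thesis
    unfolding Ck_on_def differentiable_on_def
    using real_polynomial_function_pd(1)[OF p]
    by (meson continuous_at_imp_continuous_on differentiable_at_withinI differentiable_imp_continuous_within)
qed

definition rsq :: "real ^ 2 \<Rightarrow> real" where "rsq x = x $ 1 * x $ 1 + x $ 2 * x $ 2"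
definition dsq :: "real ^ 2 \<Rightarrow> real" where "dsq x = x $ 1 * x $ 1 - x $ 2 * x $ 2"

text \<open>With \<open>cos (2\<theta>) = dsq / rsq\<close>, the equation \<open>r\<^sup>2 = (1 + t zeta \<theta>)\<^sup>2\<close> multiplied by \<open>r\<^sup>8\<close> is polynomial.\<close>

definition bdry_poly :: "real \<Rightarrow> real ^ 2 \<Rightarrow> real" where
  "bdry_poly t x = rsq x ^ 5 - (rsq x ^ 2 + t * (13 * dsq x * rsq x - 2 * dsq x ^ 2 + rsq x ^ 2)) ^ 2"

lemma real_polynomial_bdry_poly: "real_polynomial_function (bdry_poly t)"
proof -
  have c: "real_polynomial_function (\<lambda>x::real^2. x $ i)" for i
    by (rule real_polynomial_function.intros(1)) (rule bounded_linear_vec_nth)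
  have r: "real_polynomial_function rsq" "real_polynomial_function dsq"
    unfolding rsq_def[abs_def] dsq_def[abs_def] by (intro real_polynomial_function.intros(3,4) real_polynomial_function_diff c)+
  show ?thesis
    unfolding bdry_poly_def[abs_def]
    by (intro real_polynomial_function.intros(2-) real_polynomial_function_diff real_polynomial_function_power r)
qed

lemma polar_nth [simp]: "polar r \<theta> $ 1 = r * cos \<theta>" "polar r \<theta> $ 2 = r * sin \<theta>"
  by (simp_all add: polar_def)

lemma vec2_eqI: "x $ 1 = y $ 1 \<Longrightarrow> x $ 2 = y $ 2 \<Longrightarrow> (x :: real ^ 2) = y"
  by (simp add: vec_eq_iff forall_2)

lemma rsq_eq: "rsq x = (norm x)\<^sup>2"
  by (simp add: rsq_def norm_vec_def L2_set_def sum_2 power2_eq_square)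

lemma norm_polar: "norm (polar r \<theta>) = \<bar>r\<bar>"
proof -
  have "(norm (polar r \<theta>))\<^sup>2 = r\<^sup>2 * ((cos \<theta>)\<^sup>2 + (sin \<theta>)\<^sup>2)"
    unfolding rsq_eq[symmetric] rsq_def by (simp only: polar_nth power2_eq_square distrib_left mult_ac)
  then have "(norm (polar r \<theta>))\<^sup>2 = \<bar>r\<bar>\<^sup>2" by simp
  then show ?thesis by (rule power2_eq_imp_eq) simp_all
qed

lemma polar_diff: "polar r \<theta> - polar s \<theta> = polar (r - s) \<theta>"
  by (rule vec2_eqI) (simp_all add: algebra_simps)

lemma polar_scaleR: "c *\<^sub>R polar r \<theta> = polar (c * r) \<theta>"
  by (rule vec2_eqI) simp_all

lemma polar_0 [simp]: "polar 0 \<theta> = 0"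
  by (rule vec2_eqI) simp_all

lemma polar_eq_0: "polar r \<theta> = 0 \<longleftrightarrow> r = 0"
  by (metis norm_eq_zero norm_polar abs_eq_0)

lemma polarE:
  obtains r \<theta> where "0 \<le> r" "x = polar r \<theta>"
proof -
  define z where "z = Complex (x $ 1) (x $ 2)"
  have "x = polar (norm z) (Arg z)"
    by (rule vec2_eqI) (metis polar_nth z_def complex.sel rcis_cmod_Arg Re_rcis Im_rcis)+
  then show thesis using that[of "norm z"] by simp
qed

lemma zeta_cos: "zeta \<theta> = 13 * ((cos \<theta>)\<^sup>2 - (sin \<theta>)\<^sup>2) - 2 * ((cos \<theta>)\<^sup>2 - (sin \<theta>)\<^sup>2)\<^sup>2 + 1"
  using cos_double_cos[of "2 * \<theta>"] by (simp add: zeta_def cos_double)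

text \<open>The factor r^8 comes from clearing denominators. It makes \<open>bdry_poly\<close>
  vanish at the origin, which is why the origin has to be treated apart wherever the sign of
  \<open>bdry_poly\<close> describes the domain.\<close>

lemma bdry_poly_polar: "bdry_poly t (polar r \<theta>) = r ^ 8 * (r\<^sup>2 - (1 + t * zeta \<theta>)\<^sup>2)"
proof -
  have r: "rsq (polar r \<theta>) = r\<^sup>2" by (simp add: rsq_eq norm_polar)
  have d: "dsq (polar r \<theta>) = r\<^sup>2 * ((cos \<theta>)\<^sup>2 - (sin \<theta>)\<^sup>2)"
    by (simp add: dsq_def algebra_simps power2_eq_square)
  show ?thesis unfolding bdry_poly_def r d zeta_cos by (simp add: algebra_simps eval_nat_numeral)
qed

lemma abs_zeta_le: "\<bar>zeta \<theta>\<bar> \<le> 14"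
  using abs_cos_le_one[of "2 * \<theta>"] abs_cos_le_one[of "4 * \<theta>"] unfolding zeta_def by linarith

locale small_t =
  fixes t :: real
  assumes t: "0 < t" "t < 1/100"
begin

abbreviation R :: "real \<Rightarrow> real" where "R \<theta> \<equiv> 1 + t * zeta \<theta>"

lemma R_bounds: "1/2 < R \<theta>" "R \<theta> < 2"
proof -
  have "\<bar>t * zeta \<theta>\<bar> \<le> 1/100 * 14" unfolding abs_mult using t abs_zeta_le by (intro mult_mono) auto
  then show "1/2 < R \<theta>" "R \<theta> < 2" by linarith+
qed

lemma bdry_poly_sign:
  assumes "0 < r"
  shows "bdry_poly t (polar r \<theta>) < 0 \<longleftrightarrow> r < R \<theta>" "0 < bdry_poly t (polar r \<theta>) \<longleftrightarrow> R \<theta> < r"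
proof -
  have R: "0 < R \<theta>" using R_bounds[of \<theta>] by simp
  have "r\<^sup>2 < (R \<theta>)\<^sup>2 \<longleftrightarrow> r < R \<theta>" "(R \<theta>)\<^sup>2 < r\<^sup>2 \<longleftrightarrow> R \<theta> < r"
    using assms R by (auto simp: power2_less_imp_less intro: power_strict_mono)
  then show "bdry_poly t (polar r \<theta>) < 0 \<longleftrightarrow> r < R \<theta>" "0 < bdry_poly t (polar r \<theta>) \<longleftrightarrow> R \<theta> < r"
    unfolding bdry_poly_polar using assms by (auto simp: mult_less_0_iff zero_less_mult_iff)
qed

lemma Omega_iff: "x \<in> Omega t \<longleftrightarrow> x = 0 \<or> bdry_poly t x < 0"
proof
  assume "x \<in> Omega t"
  then obtain r \<theta> where "x = polar r \<theta>" "0 \<le> r" "r < R \<theta>" by (auto simp: Omega_def)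
  then show "x = 0 \<or> bdry_poly t x < 0" using bdry_poly_sign(1)[of r \<theta>] by (cases "r = 0") auto
next
  assume x: "x = 0 \<or> bdry_poly t x < 0"
  obtain r \<theta> where r: "0 \<le> r" "x = polar r \<theta>" by (rule polarE)
  have "r < R \<theta>"
    using x r bdry_poly_sign(1)[of r \<theta>] R_bounds[of \<theta>] by (cases "r = 0") (auto simp: polar_eq_0)
  then show "x \<in> Omega t" using r by (auto simp: Omega_def)
qed

lemma polar_in_Omega: "0 \<le> r \<Longrightarrow> polar r \<theta> \<in> Omega t \<longleftrightarrow> r < R \<theta>"
  using bdry_poly_sign(1)[of r \<theta>] R_bounds[of \<theta>] by (cases "r = 0") (auto simp: Omega_iff polar_eq_0)

lemma continuous_bdry_poly: "continuous_on S (bdry_poly t)"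
  by (meson continuous_at_imp_continuous_on differentiable_imp_continuous_within
      real_polynomial_bdry_poly real_polynomial_function_pd(1))

lemma open_Omega: "open (Omega t)"
proof -
  \<comment> \<open>The ball supplies a neighbourhood of the origin, where the sign condition fails;
    it lies in the domain because every radius exceeds 1/2.\<close>
  have "Omega t = ball 0 (1/2) \<union> {x. bdry_poly t x < 0}"
  proof (intro subset_antisym subsetI)
    fix x assume "x \<in> ball 0 (1/2) \<union> {x. bdry_poly t x < 0}"
    moreover obtain r \<theta> where "0 \<le> r" "x = polar r \<theta>" by (rule polarE)
    ultimately show "x \<in> Omega t"
      using R_bounds[of \<theta>] polar_in_Omega[of r \<theta>] Omega_iff[of x] by (auto simp: norm_polar)
  qed (auto simp: Omega_iff)
  then show ?thesis
    by (simp add: open_Un open_Collect_less continuous_bdry_poly continuous_on_const)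
qed

lemma bdry_notin_Omega: "bdry_point t \<theta> \<notin> Omega t"
  unfolding bdry_point_def using polar_in_Omega[of "R \<theta>" \<theta>] R_bounds[of \<theta>] by simp

lemma frontier_Omega: "frontier (Omega t) = range (bdry_point t)"
proof (intro subset_antisym subsetI)
  fix x assume "x \<in> frontier (Omega t)"
  then have x: "x \<in> closure (Omega t)" "x \<notin> Omega t"
    using open_Omega by (auto simp: frontier_def interior_open)
  obtain r \<theta> where r: "0 \<le> r" "x = polar r \<theta>" by (rule polarE)
  have "R \<theta> \<le> r" using x(2) r polar_in_Omega by (meson not_less)
  moreover have "\<not> R \<theta> < r"
  proof
    assume "R \<theta> < r"
    then have "x \<in> {x. 0 < bdry_poly t x}" using r R_bounds[of \<theta>] bdry_poly_sign(2)[of r \<theta>] by simp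
    \<comment> \<open>An open set that misses the domain, the origin included, since
      \<open>bdry_poly\<close> is 0 there.\<close>
    moreover have "open {x. 0 < bdry_poly t x}"
      by (simp add: open_Collect_less continuous_bdry_poly continuous_on_const)
    ultimately obtain y where "y \<in> Omega t" "0 < bdry_poly t y"
      using x(1) open_Int_closure_eq_empty[of "{x. 0 < bdry_poly t x}" "Omega t"] by blast
    moreover have "bdry_poly t 0 = 0" by (simp add: bdry_poly_def rsq_def dsq_def)
    ultimately show False by (auto simp: Omega_iff)
  qed
  ultimately show "x \<in> range (bdry_point t)" using r by (auto simp: bdry_point_def)
next
  fix x assume "x \<in> range (bdry_point t)"
  then obtain \<theta> where x: "x = bdry_point t \<theta>" by blast
  have "x \<in> closure (Omega t)"
    unfolding closure_approachable
  proof (intro allI impI)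
    fix e :: real assume e: "e > 0"
    define s where "s = max 0 (R \<theta> - e / 2)"
    have s: "0 \<le> s" "s < R \<theta>" using e R_bounds[of \<theta>] by (auto simp: s_def)
    have "dist (polar s \<theta>) x = \<bar>s - R \<theta>\<bar>" by (simp add: x bdry_point_def dist_norm polar_diff norm_polar)
    also have "\<dots> < e" using e R_bounds[of \<theta>] by (auto simp: s_def)
    finally show "\<exists>y\<in>Omega t. dist y x < e" using polar_in_Omega s by blast
  qed
  then show "x \<in> frontier (Omega t)"
    using bdry_notin_Omega[of \<theta>] open_Omega by (simp add: frontier_def interior_open x)
qed

lemma connected_Omega: "connected (Omega t)"
proof (rule starlike_imp_connected)
  show "starlike (Omega t)"
    unfolding starlike_def
  proof (intro bexI ballI subsetI)
    fix x y assume "x \<in> Omega t" "y \<in> closed_segment 0 x"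
    then obtain r \<theta> u where x: "x = polar r \<theta>" "0 \<le> r" "r < R \<theta>" and u: "y = u *\<^sub>R x" "0 \<le> u" "u \<le> 1"
      by (auto simp: Omega_def closed_segment_def)
    have "u * r \<le> 1 * r" using x u by (intro mult_right_mono) auto
    then show "y \<in> Omega t" using x u polar_in_Omega[of "u * r" \<theta>] by (simp add: polar_scaleR)
  qed (simp add: Omega_iff)
qed

lemma bounded_Omega: "bounded (Omega t)"
  unfolding bounded_iff
proof (intro exI ballI)
  fix x assume "x \<in> Omega t"
  then obtain r \<theta> where "x = polar r \<theta>" "0 \<le> r" "r < R \<theta>" by (auto simp: Omega_def)
  then show "norm x \<le> 2" using R_bounds[of \<theta>] by (simp add: norm_polar)
qed

lemma symmetric_Omega: "symmetric_both_axes (Omega t)"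
  unfolding symmetric_both_axes_def
proof (intro allI impI)
  fix x y assume "vector [x, y] \<in> Omega t"
  then obtain r \<theta> where r: "vector [x, y] = polar r \<theta>" "0 \<le> r" "r < R \<theta>" by (auto simp: Omega_def)
  have "x = (vector [x, y] :: real ^ 2) $ 1" "y = (vector [x, y] :: real ^ 2) $ 2" by simp_all
  then have xy: "x = r * cos \<theta>" "y = r * sin \<theta>" unfolding r(1) by simp_all
  have "vector [x, - y] = polar r (- \<theta>)" "vector [- x, y] = polar r (pi - \<theta>)"
    by (rule vec2_eqI; simp add: xy)+
  moreover have "zeta (- \<theta>) = zeta \<theta>" "zeta (pi - \<theta>) = zeta \<theta>" by (simp_all add: zeta_cos)
  ultimately show "vector [x, - y] \<in> Omega t \<and> vector [- x, y] \<in> Omega t"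
    using r polar_in_Omega by simp
qed

lemma Gamma_pp_eq: "Gamma_pp t = bdry_point t ` {0..pi/2}"
proof (intro subset_antisym subsetI)
  fix x assume "x \<in> Gamma_pp t"
  then obtain \<theta> where \<theta>: "x = bdry_point t \<theta>" "0 \<le> x $ 1" "0 \<le> x $ 2"
    by (auto simp: Gamma_pp_def frontier_Omega)
  have "0 < R \<theta>" using R_bounds[of \<theta>] by simp
  then have cs: "0 \<le> cos \<theta>" "0 \<le> sin \<theta>" using \<theta> by (simp_all add: bdry_point_def zero_le_mult_iff)
  \<comment> \<open>The representative of the angle in [0, \<pi>/2]. It has the same sine and
    cosine, and \<open>zeta\<close> depends on these alone.\<close>
  define \<eta> where "\<eta> = arccos (cos \<theta>)"
  have c: "cos \<eta> = cos \<theta>" by (simp add: \<eta>_def)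
  have s: "sin \<eta> = sin \<theta>"
    using cs by (simp add: \<eta>_def sin_arccos sin_squared_eq[symmetric])
  have "\<eta> \<in> {0..pi/2}"
    using cs arccos_le_pi2[of "cos \<theta>"] arccos_lbound[of "cos \<theta>"] by (simp add: \<eta>_def)
  moreover have "x = bdry_point t \<eta>" unfolding \<theta>(1) bdry_point_def polar_def zeta_cos c s ..
  ultimately show "x \<in> bdry_point t ` {0..pi/2}" by blast
next
  fix x assume "x \<in> bdry_point t ` {0..pi/2}"
  then obtain \<theta> where \<theta>: "x = bdry_point t \<theta>" "\<theta> \<in> {0..pi/2}" by blast
  have "0 < R \<theta>" using R_bounds[of \<theta>] by simp
  then show "x \<in> Gamma_pp t"
    using \<theta> by (auto simp: Gamma_pp_def frontier_Omega bdry_point_def intro!: mult_nonneg_nonneg cos_ge_zero sin_ge_zero)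
qed

text \<open>The derivative along the ray through the boundary point is 2 R^10, which is nonzero; if
  both partial derivatives vanished, it would be 0.\<close>

lemma bdry_poly_regular: "\<exists>i. pd i (bdry_poly t) (bdry_point t \<theta>) \<noteq> 0"
proof (rule ccontr)
  assume "\<not> ?thesis"
  then have z: "pd i (bdry_poly t) (bdry_point t \<theta>) = 0" for i by blast
  define p where "p = bdry_point t \<theta>"
  obtain D where D: "\<And>x. (bdry_poly t has_derivative D x) (at x)"
    using real_polynomial_function_has_derivative[OF real_polynomial_bdry_poly] by blast
  have lin: "linear (D p)" using D[of p] by (rule has_derivative_linear)
  have "p = p $ 1 *\<^sub>R axis 1 1 + p $ 2 *\<^sub>R axis 2 1"
    by (rule vec2_eqI) (simp_all add: axis_def)
  then have "D p p = D p (p $ 1 *\<^sub>R axis 1 1 + p $ 2 *\<^sub>R axis 2 1)" by simp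
  also have "\<dots> = p $ 1 * D p (axis 1 1) + p $ 2 * D p (axis 2 1)"
    using lin by (simp add: linear_add linear_cmul)
  also have "\<dots> = 0" using z pd_eq[OF D] by (simp add: p_def)
  finally have Dp: "D p p = 0" .
  have "((\<lambda>s. bdry_poly t (s *\<^sub>R p)) has_derivative (\<lambda>h. D p (h *\<^sub>R p))) (at 1)"
    by (rule has_derivative_compose[of "\<lambda>s. s *\<^sub>R p" "\<lambda>h. h *\<^sub>R p" 1 UNIV "bdry_poly t" "D p"])
       (use D[of p] in \<open>auto intro!: derivative_eq_intros\<close>)
  moreover have "(\<lambda>h. D p (h *\<^sub>R p)) = (\<lambda>h. 0)" using lin Dp by (simp add: linear_cmul)
  ultimately have 1: "((\<lambda>s. bdry_poly t (s *\<^sub>R p)) has_field_derivative 0) (at 1)"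
    by (simp add: has_field_derivative_def lambda_zero)
  have "(\<lambda>s. bdry_poly t (s *\<^sub>R p)) = (\<lambda>s. (s * R \<theta>) ^ 8 * ((s * R \<theta>)\<^sup>2 - (R \<theta>)\<^sup>2))"
    by (simp add: p_def bdry_point_def polar_scaleR bdry_poly_polar)
  moreover have "((\<lambda>s. (s * R \<theta>) ^ 8 * ((s * R \<theta>)\<^sup>2 - (R \<theta>)\<^sup>2)) has_field_derivative 2 * R \<theta> ^ 10) (at 1)"
    by (auto intro!: derivative_eq_intros simp: eval_nat_numeral)
  ultimately have "2 * R \<theta> ^ 10 = 0" using 1 DERIV_unique by metis
  then show False using R_bounds[of \<theta>] by simp
qed

lemma bounded_smooth_Omega: "bounded_smooth_domain (Omega t)"
  unfolding bounded_smooth_domain_def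
proof (intro conjI ballI)
  show "Omega t \<noteq> {}" by (auto simp: Omega_iff)
  fix p assume "p \<in> frontier (Omega t)"
  then obtain \<theta> where p: "p = bdry_point t \<theta>" by (auto simp: frontier_Omega)
  show "\<exists>U \<phi>. open U \<and> p \<in> U \<and> (\<forall>k. Ck_on k U \<phi>) \<and> (\<exists>i. pd i \<phi> p \<noteq> 0) \<and> Omega t \<inter> U = {x \<in> U. \<phi> x < 0}"
  \<comment> \<open>One defining function serves all boundary points; only the origin, an interior
    point of the domain, is removed.\<close>
  proof (rule exI[of _ "- {0}"], rule exI[of _ "bdry_poly t"], intro conjI allI)
    show "open (- {0 :: real ^ 2})" by (rule open_Compl) simp
    show "p \<in> - {0}" using R_bounds[of \<theta>] by (simp add: p bdry_point_def polar_eq_0)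
    show "Ck_on k (- {0}) (bdry_poly t)" for k
      by (rule Ck_on_real_polynomial_function[OF real_polynomial_bdry_poly])
    show "\<exists>i. pd i (bdry_poly t) p \<noteq> 0" unfolding p by (rule bdry_poly_regular)
    show "Omega t \<inter> - {0} = {x \<in> - {0}. bdry_poly t x < 0}" by (auto simp: Omega_iff)
  qed
qed (rule open_Omega connected_Omega bounded_Omega)+

end

section \<open>Harmonic functions of two real variables\<close>

definition cplx :: "real ^ 2 \<Rightarrow> complex" where "cplx x = Complex (x $ 1) (x $ 2)"
definition rvec :: "complex \<Rightarrow> real ^ 2" where "rvec z = vector [Re z, Im z]"

lemma rvec_cplx [simp]: "rvec (cplx x) = x" by (rule vec2_eqI) (simp_all add: rvec_def cplx_def)
lemma cplx_rvec [simp]: "cplx (rvec z) = z" by (simp add: rvec_def cplx_def)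
lemma rvec_nth [simp]: "rvec z $ 1 = Re z" "rvec z $ 2 = Im z" by (simp_all add: rvec_def)
lemma Re_cplx [simp]: "Re (cplx x) = x $ 1" and Im_cplx [simp]: "Im (cplx x) = x $ 2"
  by (simp_all add: cplx_def)

lemma norm_cplx: "norm (cplx x) = norm x"
  by (simp add: cmod_def norm_vec_def L2_set_def sum_2)

lemma bounded_linear_cplx: "bounded_linear cplx"
  by (rule bounded_linear_intro[where K = 1]) (simp_all add: norm_cplx complex_eq_iff)

lemma bounded_linear_rvec: "bounded_linear rvec"
proof (rule bounded_linear_intro[where K = 1])
  show "norm (rvec z) \<le> norm z * 1" for z using norm_cplx[of "rvec z"] by simp
qed (rule vec2_eqI; simp)+

lemma inj_rvec: "inj rvec" by (metis cplx_rvec injI)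
lemma surj_rvec: "surj rvec" by (metis rvec_cplx surjI)

lemma cplx_polar: "cplx (polar r \<theta>) = rcis r \<theta>"
  by (simp add: complex_eq_iff)

lemma has_derivative_Re_cplx:
  assumes "F holomorphic_on S" "open S" "cplx x \<in> S"
  shows "((\<lambda>x. Re (F (cplx x))) has_derivative (\<lambda>h. Re (deriv F (cplx x) * cplx h))) (at x)"
proof -
  have "(F has_derivative (*) (deriv F (cplx x))) (at (cplx x))"
    using holomorphic_derivI[OF assms] by (simp add: has_field_derivative_def)
  from has_derivative_compose[OF bounded_linear_imp_has_derivative[OF bounded_linear_cplx] this]
  show ?thesis by (rule bounded_linear.has_derivative[OF bounded_linear_Re])
qed

lemma pd_cong_open:
  assumes "open T" "x \<in> T" "\<And>y. y \<in> T \<Longrightarrow> f y = g y"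
  shows "pd i f x = pd i g x"
proof -
  have "(f has_derivative D) (at x) \<longleftrightarrow> (g has_derivative D) (at x)" for D
    by (rule iffI; erule has_derivative_transform_within_open[OF _ assms(1,2)]) (simp_all add: assms(3))
  then show ?thesis by (simp add: pd_def frechet_derivative_def)
qed

lemma pd_add:
  assumes "f differentiable (at x)" "g differentiable (at x)"
  shows "pd i (\<lambda>x. f x + g x) x = pd i f x + pd i g x"
proof -
  obtain D E where D: "(f has_derivative D) (at x)" and E: "(g has_derivative E) (at x)"
    using assms unfolding differentiable_def by blast
  show ?thesis by (simp only: pd_eq[OF has_derivative_add[OF D E]] pd_eq[OF D] pd_eq[OF E])
qed

text \<open>A coordinate direction as a complex number: the partial derivatives of Re F are the real
  parts of F' times \<open>dir i\<close>, and harmonicity of Re F is the identity 1^2 + i^2 =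
  0.\<close>

definition dir :: "2 \<Rightarrow> complex" where "dir i = cplx (axis i 1)"

lemma dir_simps [simp]: "dir 1 = 1" "dir 2 = \<i>"
  by (simp_all add: dir_def complex_eq_iff axis_def)

lemma pd_Re_cplx:
  assumes "F holomorphic_on S" "open S" "cplx x \<in> S"
  shows "pd i (\<lambda>x. Re (F (cplx x))) x = Re (deriv F (cplx x) * dir i)"
  unfolding dir_def by (rule pd_eq[OF has_derivative_Re_cplx[OF assms]])

lemma open_cplx_vimage: "open S \<Longrightarrow> open (cplx -` S)"
  by (rule open_vimage[OF _ linear_continuous_on[OF bounded_linear_cplx]])

lemma differentiable_Re_cplx:
  assumes "F holomorphic_on S" "open S" "cplx x \<in> S"
  shows "(\<lambda>x. Re (F (cplx x))) differentiable (at x)"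
  using has_derivative_Re_cplx[OF assms] by (rule differentiableI)

text \<open>Real parts of holomorphic functions plus polynomials form a class closed under partial
  derivatives, so every iterated derivative stays in it.\<close>

lemma pds_harmonic_plus_polynomial:
  assumes S: "open S" and F: "F holomorphic_on S" and p: "real_polynomial_function p"
    and u: "\<And>x. x \<in> cplx -` S \<Longrightarrow> u x = Re (F (cplx x)) + p x"
  shows "\<exists>F' p'. F' holomorphic_on S \<and> real_polynomial_function p' \<and>
     (\<forall>x\<in>cplx -` S. foldr pd is u x = Re (F' (cplx x)) + p' x)"
proof (induction "is")
  case Nil
  show ?case using F p u by auto
next
  case (Cons i "is")
  then obtain F' p' where *: "F' holomorphic_on S" "real_polynomial_function p'"
    "\<And>x. x \<in> cplx -` S \<Longrightarrow> foldr pd is u x = Re (F' (cplx x)) + p' x" by blast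
  have "foldr pd (i # is) u x = Re (deriv F' (cplx x) * dir i) + pd i p' x" if x: "x \<in> cplx -` S" for x
  proof -
    have "foldr pd (i # is) u x = pd i (\<lambda>x. Re (F' (cplx x)) + p' x) x"
      using pd_cong_open[OF open_cplx_vimage[OF S] x *(3)] by simp
    also have "\<dots> = pd i (\<lambda>x. Re (F' (cplx x))) x + pd i p' x"
      using x by (intro pd_add differentiable_Re_cplx[OF *(1) S] real_polynomial_function_pd(1)[OF *(2)]) auto
    also have "pd i (\<lambda>x. Re (F' (cplx x))) x = Re (deriv F' (cplx x) * dir i)"
      using x by (intro pd_Re_cplx[OF *(1) S]) auto
    finally show ?thesis .
  qed
  moreover have "(\<lambda>z. deriv F' z * dir i) holomorphic_on S"
    by (intro holomorphic_intros holomorphic_deriv *(1) S)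
  ultimately show ?case
    by (intro exI[of _ "\<lambda>z. deriv F' z * dir i"] exI[of _ "pd i p'"]) (auto intro: real_polynomial_function_pd(2)[OF *(2)])
qed

lemma Ck_on_harmonic_plus_polynomial:
  assumes S: "open S" and F: "F holomorphic_on S" and p: "real_polynomial_function p"
    and u: "\<And>x. x \<in> cplx -` S \<Longrightarrow> u x = Re (F (cplx x)) + p x" and T: "T \<subseteq> cplx -` S"
  shows "Ck_on k T u"
proof -
  have d: "foldr pd is u differentiable (at x)" if "x \<in> T" for "is" x
  proof -
    from pds_harmonic_plus_polynomial[OF S F p u] obtain F' p' where *: "F' holomorphic_on S" "real_polynomial_function p'"
      "\<And>x. x \<in> cplx -` S \<Longrightarrow> foldr pd is u x = Re (F' (cplx x)) + p' x" by blast
    have x: "x \<in> cplx -` S" using that T by blast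
    have "(\<lambda>x. Re (F' (cplx x)) + p' x) differentiable (at x)"
      using x by (intro differentiable_add differentiable_Re_cplx[OF *(1) S] real_polynomial_function_pd(1)[OF *(2)]) auto
    then obtain D where "((\<lambda>x. Re (F' (cplx x)) + p' x) has_derivative D) (at x)" by (auto simp: differentiable_def)
    then have "(foldr pd is u has_derivative D) (at x)"
      by (rule has_derivative_transform_within_open[OF _ open_cplx_vimage[OF S] x]) (use *(3) in auto)
    then show ?thesis by (rule differentiableI)
  qed
  show ?thesis
    unfolding Ck_on_def differentiable_on_def
    using d by (meson continuous_at_imp_continuous_on differentiable_at_withinI differentiable_imp_continuous_within)
qed

lemma rsq_derivs:
  "((\<lambda>x. - rsq x / 4) has_derivative (\<lambda>h. - (x \<bullet> h) / 2)) (at x)"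
  "pd i (\<lambda>x. - rsq x / 4) = (\<lambda>x. - (x $ i) / 2)" "pd i (\<lambda>x. - (x $ i) / 2) = (\<lambda>x. - (1 / 2))"
proof -
  have 1: "((\<lambda>x. - rsq x / 4) has_derivative (\<lambda>h. - (x \<bullet> h) / 2)) (at x)" for x
    unfolding rsq_def inner_vec_def sum_2
    by (auto intro!: derivative_eq_intros bounded_linear_imp_has_derivative bounded_linear_vec_nth simp: field_simps)
  show "((\<lambda>x. - rsq x / 4) has_derivative (\<lambda>h. - (x \<bullet> h) / 2)) (at x)" by (rule 1)
  show "pd i (\<lambda>x. - rsq x / 4) = (\<lambda>x. - (x $ i) / 2)"
    by (rule ext, subst pd_eq[OF 1]) (simp add: inner_axis)
  have "((\<lambda>x. - (x $ i) / 2) has_derivative (\<lambda>h. - (h $ i) / 2)) (at x)" for x :: "real ^ 2"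
    using bounded_linear_compose[OF bounded_linear_mult_right[of "- (1/2) :: real"] bounded_linear_vec_nth[of i]]
    by (intro bounded_linear_imp_has_derivative) simp
  from pd_eq[OF this] show "pd i (\<lambda>x. - (x $ i) / 2) = (\<lambda>x. - (1 / 2))"
    by (auto simp: fun_eq_iff)
qed

lemma laplacian_harmonic_minus_rsq:
  assumes S: "open S" and F: "F holomorphic_on S" and x: "cplx x \<in> S"
  shows "laplacian (\<lambda>x. Re (F (cplx x)) - rsq x / 4) x = - 1"
proof -
  have rp: "real_polynomial_function (\<lambda>x::real^2. - rsq x / 4)" "real_polynomial_function (\<lambda>x::real^2. - (x $ i) / 2)" for i
    unfolding rsq_def by (intro real_polynomial_function_divide real_polynomial_function_minus
        real_polynomial_function.intros(3,4) real_polynomial_function.intros(1)[OF bounded_linear_vec_nth])+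
  have p1: "pd i (\<lambda>x. Re (F (cplx x)) - rsq x / 4) y = Re (deriv F (cplx y) * dir i) + - (y $ i) / 2"
    if "y \<in> cplx -` S" for i y
  proof -
    have "pd i (\<lambda>x. Re (F (cplx x)) + - rsq x / 4) y = pd i (\<lambda>x. Re (F (cplx x))) y + pd i (\<lambda>x. - rsq x / 4) y"
      using that by (intro pd_add differentiable_Re_cplx[OF F S] real_polynomial_function_pd(1)[OF rp(1)]) auto
    also have "pd i (\<lambda>x. Re (F (cplx x))) y = Re (deriv F (cplx y) * dir i)"
      using that by (intro pd_Re_cplx[OF F S]) auto
    finally show ?thesis unfolding rsq_derivs(2) by simp
  qed
  have F': "(\<lambda>z. deriv F z * dir i) holomorphic_on S" for i
    by (intro holomorphic_intros holomorphic_deriv F S)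
  have p2: "pd i (pd i (\<lambda>x. Re (F (cplx x)) - rsq x / 4)) x = Re (deriv (deriv F) (cplx x) * dir i * dir i) - 1/2" for i
  proof -
    have "pd i (pd i (\<lambda>x. Re (F (cplx x)) - rsq x / 4)) x = pd i (\<lambda>y. Re (deriv F (cplx y) * dir i) + - (y $ i) / 2) x"
      using p1 x by (intro pd_cong_open[OF open_cplx_vimage[OF S]]) auto
    also have "\<dots> = pd i (\<lambda>y. Re (deriv F (cplx y) * dir i)) x + pd i (\<lambda>y. - (y $ i) / 2) x"
      using x by (intro pd_add differentiable_Re_cplx[OF F' S] real_polynomial_function_pd(1)[OF rp(2)]) auto
    also have "pd i (\<lambda>y. Re (deriv F (cplx y) * dir i)) x = Re (deriv (\<lambda>z. deriv F z * dir i) (cplx x) * dir i)"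
      by (rule pd_Re_cplx[OF F' S x])
    also have "deriv (\<lambda>z. deriv F z * dir i) (cplx x) = deriv (deriv F) (cplx x) * dir i"
      using holomorphic_on_imp_differentiable_at[OF holomorphic_deriv[OF F S] S x] by simp
    finally show ?thesis unfolding rsq_derivs(3) by simp
  qed
  \<comment> \<open>The two terms with the second derivative of \<open>F\<close> cancel, and each
    coordinate leaves -1/2.\<close>
  show ?thesis unfolding laplacian_def sum_2 p2 by simp
qed

section \<open>Uniqueness of the torsion function\<close>

text \<open>If \<open>l\<close> were positive, \<open>h'\<close> would exceed
  \<open>h' 0 = 0\<close> just to the right of 0, and \<open>h\<close> would increase there.\<close>

lemma second_derivative_nonpos_at_local_max:
  fixes h :: "real \<Rightarrow> real"
  assumes d: "0 < d" and h': "\<And>s. \<bar>s\<bar> < d \<Longrightarrow> (h has_field_derivative h' s) (at s)"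
    and h'': "(h' has_field_derivative l) (at 0)" and max: "\<And>s. \<bar>s\<bar> < d \<Longrightarrow> h s \<le> h 0"
  shows "l \<le> 0"
proof (rule ccontr)
  assume "\<not> l \<le> 0"
  then obtain e where e: "0 < e" "\<And>s. 0 < s \<Longrightarrow> s < e \<Longrightarrow> h' 0 < h' s"
    using DERIV_pos_inc_right[OF h''] by auto
  have "h' 0 = 0"
    by (rule DERIV_local_max[OF h' d]) (use d max in auto)
  define s where "s = min d e / 2"
  have s: "0 < s" "s < d" "s < e" using d e by (auto simp: s_def)
  have "h 0 < h s"
  proof (rule DERIV_pos_imp_increasing_open[OF s(1)])
    show "\<exists>y. (h has_field_derivative y) (at x) \<and> 0 < y" if "0 < x" "x < s" for x
      using h'[of x] e(2)[of x] that s \<open>h' 0 = 0\<close> by auto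
    show "continuous_on {0..s} h"
    proof (intro continuous_at_imp_continuous_on ballI)
      show "isCont h x" if "x \<in> {0..s}" for x
        by (rule DERIV_isCont[OF h']) (use that s in auto)
    qed
  qed
  then show False using max[of s] s by auto
qed

lemma has_derivative_pd:
  fixes f :: "real ^ 'n::finite \<Rightarrow> real"
  assumes "f differentiable (at (x + s *\<^sub>R axis i 1))"
  shows "((\<lambda>s. f (x + s *\<^sub>R axis i 1)) has_field_derivative pd i f (x + s *\<^sub>R axis i 1)) (at s)"
proof -
  obtain D where D: "(f has_derivative D) (at (x + s *\<^sub>R axis i 1))" using assms by (auto simp: differentiable_def)
  have "((\<lambda>s. f (x + s *\<^sub>R axis i 1)) has_derivative (\<lambda>h. D (h *\<^sub>R axis i 1))) (at s)"
    by (rule has_derivative_compose[of "\<lambda>s. x + s *\<^sub>R axis i 1" "\<lambda>h. h *\<^sub>R axis i 1" s UNIV f D]) (auto intro!: derivative_eq_intros D)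
  moreover have "(\<lambda>h. D (h *\<^sub>R axis i 1)) = (*) (pd i f (x + s *\<^sub>R axis i 1))"
    using linear_cmul[OF has_derivative_linear[OF D]] by (simp add: pd_eq[OF D] fun_eq_iff mult.commute)
  ultimately show ?thesis by (simp add: has_field_derivative_def)
qed

lemma differentiable_at_open: "f differentiable_on S \<Longrightarrow> open S \<Longrightarrow> x \<in> S \<Longrightarrow> f differentiable (at x)"
  unfolding differentiable_on_def by (metis at_within_open)

text \<open>Weak maximum principle by perturbation: adding e |x|^2 to a harmonic function makes all
  pure second derivatives at an interior maximum at most -2e in the unperturbed function, which
  contradicts a vanishing Laplacian.\<close>

lemma harmonic_le_zero:
  fixes w :: "real ^ 'n::finite \<Rightarrow> real"
  assumes \<Omega>: "open \<Omega>" "bounded \<Omega>"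
    and diff: "w differentiable_on \<Omega>" "\<And>i. pd i w differentiable_on \<Omega>"
    and harm: "\<And>x. x \<in> \<Omega> \<Longrightarrow> laplacian w x = 0"
    and cont: "continuous_on (closure \<Omega>) w" and bd: "\<And>x. x \<in> frontier \<Omega> \<Longrightarrow> w x \<le> 0"
    and x0: "x0 \<in> closure \<Omega>"
  shows "w x0 \<le> 0"
proof (rule ccontr)
  assume m: "\<not> w x0 \<le> 0"
  obtain B where B: "\<And>x. x \<in> closure \<Omega> \<Longrightarrow> norm x \<le> B" "B > 0"
    using bounded_closure[OF \<Omega>(2)] by (auto simp: bounded_pos)
  \<comment> \<open>With this size the perturbation adds at most half of \<open>w x0\<close> on the
    boundary, so the maximum of the perturbed function is forced into the interior.\<close>
  define e where "e = w x0 / (2 * B\<^sup>2)"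
  have e: "0 < e" using m B(2) by (simp add: e_def)
  define M where "M x = w x + e * (x \<bullet> x)" for x
  have c: "continuous_on (closure \<Omega>) M" unfolding M_def by (intro continuous_intros cont)
  have k: "compact (closure \<Omega>)" using \<Omega>(2) unfolding compact_closure .
  have "closure \<Omega> \<noteq> {}" using x0 by (metis empty_iff)
  from continuous_attains_sup[OF k this c] obtain y where
    y: "y \<in> closure \<Omega>" "\<And>x. x \<in> closure \<Omega> \<Longrightarrow> M x \<le> M y" by metis
  have "y \<in> \<Omega>"
  proof (rule ccontr)
    assume "y \<notin> \<Omega>"
    then have "y \<in> frontier \<Omega>" using y(1) \<Omega>(1) by (simp add: frontier_def interior_open)
    then have "w y \<le> 0" by (rule bd)
    moreover have "e * (y \<bullet> y) \<le> e * B\<^sup>2"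
      using B(1)[OF y(1)] e by (intro mult_left_mono) (auto simp: dot_square_norm intro: power_mono)
    moreover have "e * B\<^sup>2 = w x0 / 2" using B(2) by (simp add: e_def)
    moreover have "w x0 \<le> M x0" using e by (simp add: M_def)
    ultimately have "M y < M x0" using m by (simp add: M_def)
    then show False using y(2)[OF x0] by simp
  qed
  then obtain d where d: "0 < d" "ball y d \<subseteq> \<Omega>" using \<Omega>(1) open_contains_ball by blast
  have "pd i (pd i w) y + 2 * e \<le> 0" for i
  proof -
    have inO: "y + s *\<^sub>R axis i 1 \<in> \<Omega>" if "\<bar>s\<bar> < d" for s
      using that d(2) by (auto simp: dist_norm subset_iff norm_axis_1)
    have dw: "w differentiable (at (y + s *\<^sub>R axis i 1))" "pd i w differentiable (at (y + s *\<^sub>R axis i 1))" if "\<bar>s\<bar> < d" for s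
      by (rule differentiable_at_open[OF _ \<Omega>(1) inO[OF that]], rule diff)+
    define a where "a = axis i (1::real)"
    have sq: "(y + s *\<^sub>R a) \<bullet> (y + s *\<^sub>R a) = y \<bullet> y + 2 * s * (y $ i) + s\<^sup>2" for s
      by (simp add: a_def inner_add_left inner_add_right inner_axis inner_axis' power2_eq_square algebra_simps)
    show ?thesis
    proof (rule second_derivative_nonpos_at_local_max[OF d(1), where h = "\<lambda>s. M (y + s *\<^sub>R a)"
          and h' = "\<lambda>s. pd i w (y + s *\<^sub>R a) + e * (2 * (y $ i) + 2 * s)"])
      fix s assume s: "\<bar>s\<bar> < d"
      show "((\<lambda>s. M (y + s *\<^sub>R a)) has_field_derivative pd i w (y + s *\<^sub>R a) + e * (2 * (y $ i) + 2 * s)) (at s)"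
        unfolding M_def sq
        by (intro DERIV_add has_derivative_pd[OF dw(1)[OF s], folded a_def]) (auto intro!: derivative_eq_intros)
      show "M (y + s *\<^sub>R a) \<le> M (y + 0 *\<^sub>R a)"
        using y(2)[of "y + s *\<^sub>R a"] inO[OF s] closure_subset[of \<Omega>] by (auto simp: a_def)
    next
      have "((\<lambda>s. pd i w (y + s *\<^sub>R a)) has_field_derivative pd i (pd i w) (y + 0 *\<^sub>R a)) (at 0)"
        unfolding a_def by (rule has_derivative_pd[OF dw(2)]) (use d in simp)
      then show "((\<lambda>s. pd i w (y + s *\<^sub>R a) + e * (2 * (y $ i) + 2 * s)) has_field_derivative pd i (pd i w) y + 2 * e) (at 0)"
        by (auto intro!: derivative_eq_intros)
    qed
  qed
  then have "pd i (pd i w) y < 0" for i using e by (smt (verit))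
  then have "laplacian w y < (\<Sum>i::'n\<in>UNIV. 0)" unfolding laplacian_def by (intro sum_strict_mono) auto
  then show False using harm[OF \<open>y \<in> \<Omega>\<close>] by simp
qed

text \<open>The difference of two torsion functions is harmonic with zero boundary values; the
  maximum principle is applied to both orders of subtraction. The boundary gradient of an arbitrary
  torsion function is accessible only through this identification.\<close>

lemma torsion_function_unique:
  fixes u v :: "real ^ 'n::finite \<Rightarrow> real"
  assumes \<Omega>: "open \<Omega>" "bounded \<Omega>" and u: "torsion_function \<Omega> u" and v: "torsion_function \<Omega> v"
    and x: "x \<in> closure \<Omega>"
  shows "u x = v x"
proof -
  have le: "u x - v x \<le> 0" if u: "torsion_function \<Omega> u" and v: "torsion_function \<Omega> v" for u v :: "real ^ 'n \<Rightarrow> real"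
  proof -
    have d: "f differentiable (at y)" "pd i f differentiable (at y)" if "torsion_function \<Omega> f" "y \<in> \<Omega>" for f i y
    proof -
      have "foldr pd is f differentiable_on \<Omega>" if "length is < 2" for "is"
        using that \<open>torsion_function \<Omega> f\<close> by (simp add: torsion_function_def Ck_on_def)
      from this[of "[]"] this[of "[i]"] show "f differentiable (at y)" "pd i f differentiable (at y)"
        using differentiable_at_open[OF _ \<Omega>(1) \<open>y \<in> \<Omega>\<close>] by simp_all
    qed
    have pdd: "pd i (\<lambda>x. f x - g x) y = pd i f y - pd i g y"
      if fg: "f differentiable (at y)" "g differentiable (at y)" for f g :: "real ^ 'n \<Rightarrow> real" and i y
    proof -
      obtain D E where D: "(f has_derivative D) (at y)" and E: "(g has_derivative E) (at y)"
        using fg unfolding differentiable_def by blast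
      show ?thesis by (simp only: pd_eq[OF has_derivative_diff[OF D E]] pd_eq[OF D] pd_eq[OF E])
    qed
    have p1: "pd i (\<lambda>x. u x - v x) y = pd i u y - pd i v y" if "y \<in> \<Omega>" for i y
      by (rule pdd[OF d(1)[OF u that] d(1)[OF v that]])
    have cong: "(pd i (\<lambda>x. u x - v x) has_derivative D) (at y)"
      if D: "((\<lambda>y. pd i u y - pd i v y) has_derivative D) (at y)" and y: "y \<in> \<Omega>" for i y D
      by (rule has_derivative_transform_within_open[OF D \<Omega>(1) y]) (simp add: p1)
    have dd: "((\<lambda>y. pd i u y - pd i v y) has_derivative frechet_derivative (\<lambda>y. pd i u y - pd i v y) (at y)) (at y)"
      if "y \<in> \<Omega>" for i y
      by (rule frechet_derivative_works[THEN iffD1, OF differentiable_diff[OF d(2)[OF u that] d(2)[OF v that]]])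
    have p2: "pd i (pd i (\<lambda>x. u x - v x)) y = pd i (pd i u) y - pd i (pd i v) y" if "y \<in> \<Omega>" for i y
    proof -
      have 1: "pd i (pd i (\<lambda>x. u x - v x)) y = pd i (\<lambda>y. pd i u y - pd i v y) y"
        using p1 by (intro pd_cong_open[OF \<Omega>(1) that]) auto
      have 2: "pd i (\<lambda>y. pd i u y - pd i v y) y = pd i (pd i u) y - pd i (pd i v) y"
        by (rule pdd[OF d(2)[OF u that, of i] d(2)[OF v that, of i]])
      show ?thesis by (rule trans[OF 1 2])
    qed
    define w where "w = (\<lambda>x. u x - v x)"
    have "w x \<le> 0"
    proof (rule harmonic_le_zero[of \<Omega> w x, OF \<Omega>])
      show "w differentiable_on \<Omega>"
        unfolding differentiable_on_def w_def
        by (rule ballI, rule differentiable_at_withinI, rule differentiable_diff[OF d(1)[OF u] d(1)[OF v]])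
      show "pd i w differentiable_on \<Omega>" for i
        unfolding differentiable_on_def w_def
        by (rule ballI, rule differentiable_at_withinI, rule differentiableI[OF cong[OF dd]])
      show "laplacian w y = 0" if "y \<in> \<Omega>" for y
      proof -
        have "laplacian w y = laplacian u y - laplacian v y"
          unfolding laplacian_def w_def p2[OF that] by (rule sum_subtractf)
        then show ?thesis using u v that unfolding torsion_function_def by force
      qed
      show "continuous_on (closure \<Omega>) w"
        using u v unfolding torsion_function_def w_def by (intro continuous_on_diff) auto
      show "w y \<le> 0" if "y \<in> frontier \<Omega>" for y
        using u v that unfolding torsion_function_def w_def by auto
    qed (rule x)
    then show ?thesis by (simp add: w_def)
  qed
  from le[OF u v] le[OF v u] show ?thesis by simp
qed

section \<open>The torsion function of the perturbed disc\<close>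

lemma hfun_cnj: "norm z \<le> 2 \<Longrightarrow> hfun a (cnj z) = cnj (hfun a z)"
  unfolding hfun_def by (rule Pf_cnj)
lemma cmap_cnj: "norm z \<le> 2 \<Longrightarrow> cmap a (cnj z) = cnj (cmap a z)"
  by (simp add: cmap_def Pf_cnj exp_cnj)

lemma deriv_cnj_symmetric:
  assumes f: "f holomorphic_on ball 0 r" and z: "norm z < r"
    and sym: "\<And>w. norm w < r \<Longrightarrow> f (cnj w) = cnj (f w)"
  shows "deriv f (cnj z) = cnj (deriv f z)"
proof -
  have "(f has_field_derivative deriv f z) (at z)"
    using f z by (intro holomorphic_derivI[of _ "ball 0 r"]) auto
  then have "(cnj \<circ> f \<circ> cnj has_field_derivative cnj (deriv f z)) (at (cnj z))"
    using has_field_derivative_cnj_cnj[of f "deriv f z" "cnj z"] by simp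
  then have "(f has_field_derivative cnj (deriv f z)) (at (cnj z))"
    by (rule has_field_derivative_transform_within_open[where S = "ball 0 r"]) (use z sym in auto)
  then show ?thesis by (rule DERIV_imp_deriv)
qed

lemma hder_cnj: "norm z < 2 \<Longrightarrow> hder a (cnj z) = cnj (hder a z)"
  unfolding hder_def
  by (subst (1 2) deriv_cnj_symmetric[where r = 2])
     (auto intro: hfun_holomorphic cmap_holomorphic hfun_cnj cmap_cnj)

locale conf = small_t +
  fixes a :: wl
  assumes theod: "theod t a"
    and mono_grad2: "strict_mono_on {0..pi/2} (\<lambda>\<phi>. Re (grad2 a (of_real \<phi>)))"
    and cmap'_near: "\<And>z. z \<in> cball 0 (7/4) \<Longrightarrow> norm (deriv (cmap a) z - 1) \<le> 1/2"
    and Pf_small: "\<And>z. z \<in> cball 0 (7/4) \<Longrightarrow> norm (Pf a z) \<le> 1/4"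
    and Pf'_small: "\<And>z. z \<in> cball 0 (7/4) \<Longrightarrow> norm (deriv (Pf a) z) \<le> 1/4"
begin

lemma sym: "refl_wl a = a" "alt a = a" and eq: "exp a = 1 + t *\<^sub>R zet a"
  using theod by (auto simp: theod_def)

abbreviation S :: "complex set" where "S \<equiv> ball 0 (7/4)"

lemma cmap_hol: "cmap a holomorphic_on S"
  by (rule holomorphic_on_subset[OF cmap_holomorphic]) auto
lemma hfun_hol: "hfun a holomorphic_on S"
  by (rule holomorphic_on_subset[OF hfun_holomorphic]) auto

text \<open>\<open>cmap a\<close> differs from the identity by a map with Lipschitz constant 1/2 on
  the convex disc.\<close>

lemma inj_cmap: "inj_on (cmap a) S"
proof (rule inj_onI)
  fix z w assume zw: "z \<in> S" "w \<in> S" "cmap a z = cmap a w"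
  have "norm ((cmap a z - z) - (cmap a w - w)) \<le> 1/2 * norm (z - w)"
  proof (rule field_differentiable_bound[where S = S and f' = "\<lambda>z. deriv (cmap a) z - 1"])
    show "((\<lambda>z. cmap a z - z) has_field_derivative deriv (cmap a) z - 1) (at z within S)" if "z \<in> S" for z
      by (intro DERIV_diff has_field_derivative_at_within[OF holomorphic_derivI[OF cmap_hol _ that]]) auto
    show "norm (deriv (cmap a) z - 1) \<le> 1/2" if "z \<in> S" for z
      using that by (intro cmap'_near) auto
  qed (use zw in auto)
  then have "norm (w - z) \<le> 1/2 * norm (z - w)" using zw(3) by simp
  then show "z = w" by (simp add: norm_minus_commute)
qed

text \<open>The boundary correspondence of the conformal map: the polar angle of the image of the
  point at angle \<phi> on the circle.\<close>

definition ang :: "real \<Rightarrow> real" where "ang \<phi> = \<phi> + Im (Pf a (cis \<phi>))"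

text \<open>Evaluating the equation in the algebra at a point of the circle turns each term
  \<open>zmon m * exp (m *\<^sub>R hilb a)\<close> into exp (i m (\<phi> + Im G)); opposite
  frequencies combine to cosines of the shifted angle.\<close>

lemma boundary_eq: "exp (Re (Pf a (cis \<phi>))) = R (ang \<phi>)"
proof -
  define z where "z = cis \<phi>"
  have n: "norm z = 1" and z: "1/2 \<le> norm z" "norm z \<le> 2" by (simp_all add: z_def)
  define g where "g = Im (Pf a z)"
  have e: "ev z (zmon m * exp (c *\<^sub>R hilb a)) = cis (of_int m * \<phi> + c * g)" for m c
  proof -
    interpret bounded_linear "ev z" by (rule bounded_linear_ev[OF z])
    have "ev z (zmon m * exp (c *\<^sub>R hilb a)) = z powi m * exp (c *\<^sub>R (\<i> * of_real g))"
      unfolding ev_mult[OF z] ev_zmon hom_exp[OF bounded_linear_ev[OF z] ev_mult[OF z] ev_one] scaleR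
        ev_circle(2)[OF n sym(1)] g_def ..
    also have "exp (c *\<^sub>R (\<i> * of_real g)) = cis (c * g)"
      by (simp add: cis_conv_exp scaleR_conv_of_real mult_ac)
    also have "z powi m = cis (of_int m * \<phi>)" by (simp add: z_def cis_power_int)
    finally show ?thesis by (simp add: cis_mult)
  qed
  have "ev z (exp a) = ev z (1 + t *\<^sub>R zet a)" by (simp only: eq)
  also have "ev z (exp a) = of_real (exp (Re (Pf a z)))"
    unfolding hom_exp[OF bounded_linear_ev[OF z] ev_mult[OF z] ev_one] ev_circle(1)[OF n sym(1)]
    by (rule exp_of_real)
  also have "ev z (1 + t *\<^sub>R zet a) = of_real (1 + t * zeta (\<phi> + g))"
  proof -
    interpret bounded_linear "ev z" by (rule bounded_linear_ev[OF z])
    have c: "cis (of_int m * \<phi> + of_int m * g) + cis (of_int (- m) * \<phi> + (- of_int m) * g) = of_real (2 * cos (of_int m * (\<phi> + g)))" for m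
      by (simp add: complex_eq_iff algebra_simps cos_diff cos_add sin_add sin_diff)
    have "ev z (zet a) = (13/2) *\<^sub>R of_real (2 * cos (2 * (\<phi> + g))) - (1/2) *\<^sub>R of_real (2 * cos (4 * (\<phi> + g)))"
      unfolding zet_def diff scaleR add e using c[of 2] c[of 4] by simp
    then have Z: "ev z (zet a) = of_real (zeta (\<phi> + g))"
      by (simp add: zeta_def scaleR_conv_of_real)
    show ?thesis unfolding add scaleR ev_one Z by (simp add: scaleR_conv_of_real)
  qed
  finally have "exp (Re (Pf a z)) = 1 + t * zeta (\<phi> + g)" by (simp only: of_real_eq_iff)
  then show ?thesis by (simp add: z_def g_def ang_def)
qed

lemma cmap_cis: "cmap a (cis \<phi>) = rcis (R (ang \<phi>)) (ang \<phi>)"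
proof -
  have "cmap a (cis \<phi>) = cis \<phi> * (exp (Re (Pf a (cis \<phi>))) * cis (Im (Pf a (cis \<phi>))))"
    by (simp add: cmap_def exp_eq_polar)
  also have "\<dots> = exp (Re (Pf a (cis \<phi>))) * cis (ang \<phi>)"
    by (simp add: ang_def cis_mult[symmetric])
  finally show ?thesis unfolding boundary_eq rcis_def .
qed

lemma rvec_cmap_cis: "rvec (cmap a (cis \<phi>)) = bdry_point t (ang \<phi>)"
  unfolding cmap_cis bdry_point_def by (metis cplx_polar rvec_cplx)

text \<open>The deviation of \<open>ang\<close> from the identity is Im G along the circle, whose
  derivative in the angle is bounded by that of G, hence by 1/4.\<close>

lemma ang_lipschitz: "4 * \<bar>(ang x - x) - (ang y - y)\<bar> \<le> \<bar>x - y\<bar>"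
proof -
  have hol: "Pf a holomorphic_on S" by (rule holomorphic_on_subset[OF Pf_holomorphic]) auto
  have "norm (Pf a (exp (\<i> * of_real x)) - Pf a (exp (\<i> * of_real y))) \<le> 1/4 * norm (complex_of_real x - of_real y)"
  proof (rule field_differentiable_bound[where S = \<real> and f = "\<lambda>w. Pf a (exp (\<i> * w))"
        and f' = "\<lambda>w. deriv (Pf a) (exp (\<i> * w)) * (exp (\<i> * w) * \<i>)"])
    fix w :: complex assume "w \<in> \<real>"
    then have n: "norm (exp (\<i> * w)) = 1" by (auto elim!: Reals_cases simp: norm_exp_eq_Re)
    show "((\<lambda>w. Pf a (exp (\<i> * w))) has_field_derivative deriv (Pf a) (exp (\<i> * w)) * (exp (\<i> * w) * \<i>)) (at w within \<real>)"
      by (rule DERIV_chain2[OF holomorphic_derivI[OF hol]]) (use n in \<open>auto intro!: derivative_eq_intros\<close>)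
    show "norm (deriv (Pf a) (exp (\<i> * w)) * (exp (\<i> * w) * \<i>)) \<le> 1/4"
      using Pf'_small[of "exp (\<i> * w)"] n by (simp add: norm_mult)
  qed (auto simp: convex_Reals)
  then have "norm (Pf a (cis x) - Pf a (cis y)) \<le> 1/4 * \<bar>x - y\<bar>"
    by (simp add: cis_conv_exp flip: of_real_diff)
  then show ?thesis using abs_Im_le_cmod[of "Pf a (cis x) - Pf a (cis y)"] by (simp add: ang_def)
qed

lemma ang_strict_mono: "x < y \<Longrightarrow> ang x < ang y"
proof -
  assume "x < y"
  then have "\<bar>x - y\<bar> = y - x" by simp
  then show ?thesis
    using ang_lipschitz[of x y] abs_ge_self[of "(ang x - x) - (ang y - y)"] \<open>x < y\<close> by argo
qed

lemma continuous_ang: "continuous_on X ang"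
proof (rule lipschitz_on_continuous_on)
  show "2-lipschitz_on X ang"
  proof (rule lipschitz_onI)
    show "dist (ang x) (ang y) \<le> 2 * dist x y" for x y
    proof -
      have "ang x - ang y = ((ang x - x) - (ang y - y)) + (x - y)" by simp
      then have "\<bar>ang x - ang y\<bar> \<le> \<bar>(ang x - x) - (ang y - y)\<bar> + \<bar>x - y\<bar>"
        by (metis abs_triangle_ineq)
      then show ?thesis
        using ang_lipschitz[of x y] abs_ge_zero[of "x - y"] unfolding dist_real_def by argo
    qed
  qed simp
qed

lemma ang_0: "ang 0 = 0"
proof -
  have "cnj (Pf a 1) = Pf a 1" using Pf_cnj[of 1 a] by simp
  then show ?thesis by (simp add: ang_def complex_eq_iff)
qed

text \<open>Both symmetries enter: conjugation takes i to -i and evenness of G takes it back, so G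
  is real at i.\<close>

lemma ang_pi_half: "ang (pi/2) = pi/2"
proof -
  have "cnj (Pf a \<i>) = Pf a \<i>" using Pf_cnj[of \<i> a] Pf_minus[OF sym(2), of \<i>] by simp
  then show ?thesis by (simp add: ang_def complex_eq_iff)
qed

lemma ang_near: "\<bar>ang x - x\<bar> \<le> 1"
  using abs_Im_le_cmod[of "Pf a (cis x)"] Pf_small[of "cis x"] by (simp add: ang_def)

lemma surj_ang: "surj ang"
  unfolding surj_def
proof
  fix y
  obtain x where "y - 2 \<le> x" "x \<le> y + 2" "ang x = y"
    using IVT'[OF _ _ _ continuous_ang, of "y - 2" y "y + 2"] ang_near[of "y - 2"] ang_near[of "y + 2"]
    by (smt (verit))
  then show "\<exists>x. y = ang x" by blast
qed

lemma range_bdry: "range (bdry_point t) = rvec ` cmap a ` sphere 0 1"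
proof -
  have "sphere 0 1 = range cis"
  proof (intro subset_antisym subsetI)
    fix z :: complex assume "z \<in> sphere 0 1"
    then have "z = cis (Arg z)" using rcis_cmod_Arg[of z] by (simp add: rcis_def)
    then show "z \<in> range cis" by blast
  qed auto
  then have "rvec ` cmap a ` sphere 0 1 = range (\<lambda>\<phi>. bdry_point t (ang \<phi>))"
    by (simp add: image_image rvec_cmap_cis)
  also have "\<dots> = range (bdry_point t)"
    using surj_ang by (metis image_image)
  finally show ?thesis ..
qed

lemma cmap_0: "cmap a 0 = 0" by (simp add: cmap_def)

text \<open>Two connected sets that both contain the origin, neither of which meets the frontier of
  the other, coincide. The frontier of the image lies on the boundary curve because the curve is the
  image of the unit circle.\<close>

lemma Omega_eq: "Omega t = rvec ` cmap a ` ball 0 1"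
proof -
  define W where "W = rvec ` cmap a ` ball 0 1"
  have sub: "ball 0 1 \<subseteq> S" "cball 0 1 \<subseteq> S" "sphere 0 1 \<subseteq> S" by auto
  have "open (cmap a ` ball 0 1)"
    by (rule open_mapping_thm3) (use holomorphic_on_subset[OF cmap_hol sub(1)] inj_on_subset[OF inj_cmap sub(1)] in auto)
  then have oW: "open W"
    unfolding W_def by (rule open_surjective_linear_image[OF _ bounded_linear.linear[OF bounded_linear_rvec] surj_rvec])
  have cv: "continuous_on X rvec" for X by (rule linear_continuous_on[OF bounded_linear_rvec])
  have cc: "continuous_on X (cmap a)" if "X \<subseteq> S" for X
    using holomorphic_on_imp_continuous_on[OF holomorphic_on_subset[OF cmap_hol that]] .
  have kW: "compact (rvec ` cmap a ` cball 0 1)"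
    by (intro compact_continuous_image cv cc sub compact_cball)
  have conW: "connected W"
    unfolding W_def by (intro connected_continuous_image cv cc sub connected_ball)
  have "W \<subseteq> rvec ` cmap a ` cball 0 1" unfolding W_def by (intro image_mono) auto
  then have "closure W \<subseteq> rvec ` cmap a ` cball 0 1"
    using kW by (intro closure_minimal compact_imp_closed)
  then have fW: "frontier W \<subseteq> frontier (Omega t)"
  proof -
    assume cl: "closure W \<subseteq> rvec ` cmap a ` cball 0 1"
    show ?thesis
      unfolding frontier_Omega range_bdry
    proof
      fix x assume "x \<in> frontier W"
      then have x: "x \<in> closure W" "x \<notin> W" by (auto simp: frontier_def interior_open[OF oW])
      then obtain z where z: "x = rvec (cmap a z)" "z \<in> cball 0 1" using cl by blast
      then have "z \<notin> ball 0 1" using x(2) by (auto simp: W_def)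
      then have "z \<in> sphere 0 1" using z(2) by simp
      then show "x \<in> rvec ` cmap a ` sphere 0 1" using z(1) by blast
    qed
  qed
  \<comment> \<open>Injectivity on the larger disc keeps the image of the open unit disc off the
    image of the circle.\<close>
  have disj: "W \<inter> frontier (Omega t) = {}"
  proof -
    have "z = w" if "rvec (cmap a z) = rvec (cmap a w)" "z \<in> ball 0 1" "w \<in> sphere 0 1" for z w
      using that sub inj_onD[OF inj_cmap, of z w] injD[OF inj_rvec, of "cmap a z" "cmap a w"] by blast
    then show ?thesis unfolding frontier_Omega range_bdry W_def by fastforce
  qed
  have "rvec 0 = 0" by (rule vec2_eqI) simp_all
  then have z: "0 \<in> W" "0 \<in> Omega t"
  proof -
    have "rvec (cmap a 0) \<in> W" unfolding W_def by (intro imageI) simp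
    then show "0 \<in> W" by (simp only: cmap_0 \<open>rvec 0 = 0\<close>)
    show "0 \<in> Omega t" by (simp add: Omega_iff)
  qed
  have fO: "Omega t \<inter> frontier (Omega t) = {}"
    using bdry_notin_Omega unfolding frontier_Omega by auto
  have "Omega t - W = {}"
    using connected_Int_frontier[OF connected_Omega, of W] z fW fO by blast
  moreover have "W - Omega t = {}"
    using connected_Int_frontier[OF conW, of "Omega t"] z disj by blast
  ultimately show ?thesis unfolding W_def by blast
qed

lemma closure_Omega_eq: "closure (Omega t) = rvec ` cmap a ` cball 0 1"
proof -
  have "closure (Omega t) = Omega t \<union> frontier (Omega t)" by (rule closure_Un_frontier)
  also have "\<dots> = rvec ` cmap a ` (ball 0 1 \<union> sphere 0 1)"
    unfolding image_Un using Omega_eq range_bdry frontier_Omega by (intro arg_cong2[where f = "(\<union>)"]) simp_all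
  also have "ball 0 1 \<union> sphere 0 1 = cball (0::complex) 1" by auto
  finally show ?thesis .
qed

section \<open>The torsion function through the inverse conformal map\<close>

definition inv_map :: "complex \<Rightarrow> complex" where
  "inv_map = (SOME g. g holomorphic_on cmap a ` S \<and> (\<forall>z\<in>S. deriv (cmap a) z * deriv g (cmap a z) = 1 \<and> g (cmap a z) = z))"

lemma inv_map:
  shows inv_map_hol: "inv_map holomorphic_on cmap a ` S"
    and inv_map_deriv: "z \<in> S \<Longrightarrow> deriv (cmap a) z * deriv inv_map (cmap a z) = 1"
    and inv_map_inv: "z \<in> S \<Longrightarrow> inv_map (cmap a z) = z"
proof -
  obtain g where "g holomorphic_on cmap a ` S" "\<And>z. z \<in> S \<Longrightarrow> deriv (cmap a) z * deriv g (cmap a z) = 1"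
    "\<And>z. z \<in> S \<Longrightarrow> g (cmap a z) = z"
    using holomorphic_has_inverse[OF cmap_hol open_ball inj_cmap] by blast
  then have "\<exists>g. g holomorphic_on cmap a ` S \<and> (\<forall>z\<in>S. deriv (cmap a) z * deriv g (cmap a z) = 1 \<and> g (cmap a z) = z)"
    by blast
  from someI_ex[OF this, folded inv_map_def] show "inv_map holomorphic_on cmap a ` S"
    "z \<in> S \<Longrightarrow> deriv (cmap a) z * deriv inv_map (cmap a z) = 1" "z \<in> S \<Longrightarrow> inv_map (cmap a z) = z" by blast+
qed

text \<open>The harmonic part transplanted to the domain. Since \<open>inv_map\<close> lives on the
  image of the disc of radius 7/4, this function is holomorphic across the boundary, and the
  boundary gradient is an ordinary derivative.\<close>

definition harm :: "complex \<Rightarrow> complex" where "harm w = hfun a (inv_map w)"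

lemma open_cmap_image: "open (cmap a ` S)"
  by (rule open_mapping_thm3[OF cmap_hol open_ball inj_cmap])

lemma inv_map_range: "w \<in> cmap a ` S \<Longrightarrow> inv_map w \<in> S"
  using inv_map_inv by auto

lemma harm_hol: "harm holomorphic_on cmap a ` S"
  using holomorphic_on_compose_gen[OF inv_map_hol hfun_hol] inv_map_range
  by (simp add: harm_def[abs_def] o_def image_subset_iff)

lemma harm_cmap: "z \<in> S \<Longrightarrow> harm (cmap a z) = hfun a z"
  by (simp add: harm_def inv_map_inv)

text \<open>Chain rule for H after the inverse of f: this is the reason for the quotient in
  \<open>hder\<close>.\<close>

lemma deriv_harm:
  assumes z: "z \<in> S"
  shows "deriv harm (cmap a z) = hder a z"
proof -
  have w: "cmap a z \<in> cmap a ` S" using z by blast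
  have "(inv_map has_field_derivative deriv inv_map (cmap a z)) (at (cmap a z))"
    by (rule holomorphic_derivI[OF inv_map_hol open_cmap_image w])
  moreover have "(hfun a has_field_derivative deriv (hfun a) z) (at (inv_map (cmap a z)))"
    using holomorphic_derivI[OF hfun_hol open_ball z] by (simp add: inv_map_inv[OF z])
  ultimately have "((\<lambda>w. hfun a (inv_map w)) has_field_derivative deriv (hfun a) z * deriv inv_map (cmap a z)) (at (cmap a z))"
    by (rule DERIV_chain2[rotated])
  then have "deriv harm (cmap a z) = deriv (hfun a) z * deriv inv_map (cmap a z)"
    unfolding harm_def[abs_def] by (rule DERIV_imp_deriv)
  also have "deriv inv_map (cmap a z) = 1 / deriv (cmap a) z"
    using inv_map_deriv[OF z] by (metis mult_zero_left nonzero_mult_div_cancel_left zero_neq_one)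
  finally show ?thesis by (simp add: hder_def)
qed

definition tors :: "real ^ 2 \<Rightarrow> real" where "tors x = Re (harm (cplx x)) - rsq x / 4"
text \<open>As a complex number, the gradient of Re F is the conjugate of F'.\<close>

definition tgrad :: "real ^ 2 \<Rightarrow> real ^ 2" where "tgrad x = rvec (cnj (deriv harm (cplx x))) - (1/2) *\<^sub>R x"

lemma closure_subset_dom: "closure (Omega t) \<subseteq> cplx -` cmap a ` S"
proof -
  have "(cball 0 1 :: complex set) \<subseteq> S" by auto
  then show ?thesis unfolding closure_Omega_eq by auto
qed

lemma tors_has_derivative:
  assumes "cplx x \<in> cmap a ` S"
  shows "(tors has_derivative (\<lambda>h. tgrad x \<bullet> h)) (at x)"
proof -
  have "((\<lambda>x. Re (harm (cplx x)) + - rsq x / 4) has_derivative (\<lambda>h. Re (deriv harm (cplx x) * cplx h) + - (x \<bullet> h) / 2)) (at x)"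
    by (rule has_derivative_add[OF has_derivative_Re_cplx[OF harm_hol open_cmap_image assms] rsq_derivs(1)])
  moreover have "(\<lambda>h. Re (deriv harm (cplx x) * cplx h) + - (x \<bullet> h) / 2) = (\<lambda>h. tgrad x \<bullet> h)"
    by (rule ext) (simp add: tgrad_def inner_vec_def sum_2 field_simps)
  ultimately show ?thesis by (simp add: tors_def[abs_def])
qed

lemma tors_zero: "x \<in> frontier (Omega t) \<Longrightarrow> tors x = 0"
proof -
  assume "x \<in> frontier (Omega t)"
  then obtain z where x: "x = rvec (cmap a z)" and n: "norm z = 1"
    unfolding frontier_Omega range_bdry by auto
  have z: "1/2 \<le> norm z" "norm z \<le> 2" "z \<in> S" using n by auto
  define b where "b = (1/4) *\<^sub>R exp (2 *\<^sub>R a)"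
  have "refl_wl b = b"
  proof -
    interpret bounded_linear refl_wl by (rule bounded_linear_refl)
    show ?thesis unfolding b_def scaleR hom_exp[OF bounded_linear_refl refl_mult refl_one] sym(1) ..
  qed
  then have "of_real (Re (hfun a z)) = ev z b"
    unfolding hfun_def b_def[symmetric] by (rule ev_circle(1)[OF n, symmetric])
  also have "\<dots> = of_real (exp (2 * Re (Pf a z)) / 4)"
  proof -
    interpret bounded_linear "ev z" by (rule bounded_linear_ev[OF z(1,2)])
    have "ev z b = (1/4) *\<^sub>R exp (2 *\<^sub>R complex_of_real (Re (Pf a z)))"
      unfolding b_def scaleR hom_exp[OF bounded_linear_ev[OF z(1,2)] ev_mult[OF z(1,2)] ev_one] ev_circle(1)[OF n sym(1)] ..
    then show ?thesis by (simp add: scaleR_conv_of_real flip: exp_of_real)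
  qed
  finally have "Re (hfun a z) = exp (2 * Re (Pf a z)) / 4" by (simp only: of_real_eq_iff)
  moreover have "rsq x = (norm (cmap a z))\<^sup>2"
    using norm_cplx[of x] by (simp add: rsq_eq x)
  moreover have "norm (cmap a z) = exp (Re (Pf a z))"
    by (simp add: cmap_def norm_mult n)
  moreover have "(exp (Re (Pf a z)))\<^sup>2 = exp (2 * Re (Pf a z))"
    by (simp add: power2_eq_square flip: exp_add)
  ultimately show ?thesis by (simp add: tors_def x harm_cmap[OF z(3)])
qed

lemma torsion_tors: "torsion_function (Omega t) tors"
  unfolding torsion_function_def
proof (intro conjI ballI)
  have rp: "real_polynomial_function (\<lambda>x::real^2. - rsq x / 4)"
    unfolding rsq_def by (intro real_polynomial_function_divide real_polynomial_function_minus
        real_polynomial_function.intros(3,4) real_polynomial_function.intros(1)[OF bounded_linear_vec_nth])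
  have sub: "Omega t \<subseteq> cplx -` cmap a ` S" using closure_subset_dom closure_subset by blast
  show "Ck_on 2 (Omega t) tors"
    by (rule Ck_on_harmonic_plus_polynomial[OF open_cmap_image harm_hol rp _ sub]) (simp add: tors_def)
  show "continuous_on (closure (Omega t)) tors"
  proof (rule continuous_at_imp_continuous_on, rule ballI)
    fix x assume "x \<in> closure (Omega t)"
    then have "cplx x \<in> cmap a ` S" using closure_subset_dom by blast
    then show "isCont tors x" by (rule has_derivative_continuous[OF tors_has_derivative])
  qed
  show "- laplacian tors x = 1" if "x \<in> Omega t" for x
  proof -
    have "cplx x \<in> cmap a ` S" using sub that by blast
    from laplacian_harmonic_minus_rsq[OF open_cmap_image harm_hol this] show ?thesis
      by (simp add: tors_def[abs_def])
  qed
qed (rule tors_zero)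

text \<open>For real \<phi> the points exp(i\<phi>) and exp(-i\<phi>) are conjugate, and
  \<open>cmap\<close> and \<open>hder\<close> commute with conjugation. The two factors of
  \<open>grad2\<close> are then a complex number and its conjugate.\<close>

lemma norm_tgrad_sq: "(norm (tgrad (bdry_point t (ang \<phi>))))\<^sup>2 = Re (grad2 a (of_real \<phi>))"
proof -
  define z where "z = cis \<phi>"
  have n: "norm z = 1" and z: "z \<in> S" "norm z \<le> 2" "norm z < 2" by (simp_all add: z_def)
  define k where "k = hder a z"
  define w where "w = cnj k - cmap a z / 2"
  have cz: "cplx (bdry_point t (ang \<phi>)) = cmap a z" unfolding rvec_cmap_cis[symmetric] z_def by simp
  have "cplx (tgrad (bdry_point t (ang \<phi>))) = w"
    unfolding tgrad_def cz deriv_harm[OF z(1)] w_def k_def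
    by (simp add: complex_eq_iff flip: cz)
  then have "norm (tgrad (bdry_point t (ang \<phi>))) = norm w" by (metis norm_cplx)
  then have "complex_of_real ((norm (tgrad (bdry_point t (ang \<phi>))))\<^sup>2) = w * cnj w"
    by (simp only: complex_norm_square)
  also have "\<dots> = grad2 a (of_real \<phi>)"
  proof -
    have "exp (\<i> * of_real \<phi>) = z" "exp (- (\<i> * of_real \<phi>)) = cnj z"
      by (simp_all add: z_def cis_conv_exp exp_cnj)
    then show ?thesis
      unfolding grad2_def by (simp add: w_def k_def hder_cnj[OF z(3)] cmap_cnj[OF z(2)])
  qed
  finally show ?thesis by (metis Re_complex_of_real)
qed

text \<open>By its end values and the intermediate value theorem, \<open>ang\<close> maps
  [0, \<pi>/2] onto itself increasingly, so strict growth in the circle angle is strict growth in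
  the polar angle.\<close>

lemma norm_tgrad_strict_mono: "strict_mono_on {0..pi/2} (\<lambda>\<theta>. norm (tgrad (bdry_point t \<theta>)))"
proof (rule strict_mono_onI)
  fix x y :: real assume xy: "x \<in> {0..pi/2}" "y \<in> {0..pi/2}" "x < y"
  have ex: "\<exists>\<phi>\<in>{0..pi/2}. ang \<phi> = \<theta>" if "\<theta> \<in> {0..pi/2}" for \<theta>
    using IVT'[OF _ _ _ continuous_ang, of 0 \<theta> "pi/2"] that by (auto simp: ang_0 ang_pi_half)
  obtain \<phi> where \<phi>: "\<phi> \<in> {0..pi/2}" "ang \<phi> = x" using ex[OF xy(1)] by blast
  obtain \<psi> where \<psi>: "\<psi> \<in> {0..pi/2}" "ang \<psi> = y" using ex[OF xy(2)] by blast
  have "\<phi> < \<psi>"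
    using xy(3) \<phi>(2) \<psi>(2) ang_strict_mono[of \<psi> \<phi>] by (metis less_asym less_irrefl linorder_neqE)
  then have "Re (grad2 a (of_real \<phi>)) < Re (grad2 a (of_real \<psi>))"
    using strict_mono_onD[OF mono_grad2 \<phi>(1) \<psi>(1)] by simp
  then have "(norm (tgrad (bdry_point t x)))\<^sup>2 < (norm (tgrad (bdry_point t y)))\<^sup>2"
    unfolding norm_tgrad_sq[symmetric] \<phi>(2) \<psi>(2) .
  then show "norm (tgrad (bdry_point t x)) < norm (tgrad (bdry_point t y))"
    by (rule power2_less_imp_less) simp
qed

lemma gradient_torsion:
  assumes u: "torsion_function (Omega t) u"
  shows "gradient_on (closure (Omega t)) u tgrad"
  unfolding gradient_on_def
proof (intro conjI ballI)
  have "continuous_on (cplx -` cmap a ` S) tgrad"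
    unfolding tgrad_def
    by (intro continuous_intros linear_continuous_on_compose[OF _ bounded_linear.linear[OF bounded_linear_rvec]]
        continuous_on_compose2[OF holomorphic_on_imp_continuous_on[OF holomorphic_deriv[OF harm_hol open_cmap_image]]]
        linear_continuous_on[OF bounded_linear_cplx]) auto
  then show "continuous_on (closure (Omega t)) tgrad"
    using closure_subset_dom continuous_on_subset by blast
  fix x assume x: "x \<in> closure (Omega t)"
  have "(tors has_derivative (\<lambda>h. tgrad x \<bullet> h)) (at x within closure (Omega t))"
    by (rule has_derivative_at_withinI, rule tors_has_derivative) (use x closure_subset_dom in blast)
  \<comment> \<open>Equality with \<open>tors\<close> is known on the closure only, which is exactly
    what a derivative within the closure requires.\<close>
  then show "(u has_derivative (\<lambda>h. tgrad x \<bullet> h)) (at x within closure (Omega t))"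
    by (rule has_derivative_transform[OF x, rotated])
       (rule torsion_function_unique[OF open_Omega bounded_Omega u torsion_tors])
qed

end

section \<open>Curvature\<close>

lemma has_vector_derivative_vec2:
  assumes "(f has_field_derivative f') (at s)" "(g has_field_derivative g') (at s)"
  shows "((\<lambda>s. vector [f s, g s] :: real ^ 2) has_vector_derivative vector [f', g']) (at s)"
proof -
  have e: "vector [x, y] = x *\<^sub>R axis 1 1 + y *\<^sub>R (axis 2 1 :: real ^ 2)" for x y :: real
    by (rule vec2_eqI) (simp_all add: axis_def)
  have "((\<lambda>s. f s *\<^sub>R axis 1 1 + g s *\<^sub>R (axis 2 1 :: real ^ 2)) has_vector_derivative (f' *\<^sub>R axis 1 1 + g' *\<^sub>R axis 2 1)) (at s)"
    using assms by (intro has_vector_derivative_add) (auto intro!: derivative_eq_intros)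
  then show ?thesis unfolding e .
qed

text \<open>The classical formula for a polar graph: the determinant of velocity and acceleration
  and the squared speed are both free of the angle once cos^2 + sin^2 = 1 is factored out.\<close>

lemma curvature_polar:
  assumes r: "\<And>s. (r has_field_derivative r' s) (at s)" and r': "\<And>s. (r' has_field_derivative r'' s) (at s)"
  shows "curvature (\<lambda>s. polar (r s) s) s =
    ((r s)\<^sup>2 + 2 * (r' s)\<^sup>2 - r s * r'' s) / sqrt ((r s)\<^sup>2 + (r' s)\<^sup>2) ^ 3"
proof -
  define v :: "real \<Rightarrow> real ^ 2" where "v = (\<lambda>s. vector [r' s * cos s - r s * sin s, r' s * sin s + r s * cos s])"
  define a :: "real ^ 2" where "a = vector [r'' s * cos s - 2 * r' s * sin s - r s * cos s, r'' s * sin s + 2 * r' s * cos s - r s * sin s]"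
  have v: "((\<lambda>s. polar (r s) s) has_vector_derivative v s) (at s)" for s
    unfolding polar_def v_def
    by (rule has_vector_derivative_vec2) (auto intro!: derivative_eq_intros r)
  have a: "(v has_vector_derivative a) (at s)"
    unfolding v_def a_def
    by (rule has_vector_derivative_vec2) (auto intro!: derivative_eq_intros r r')
  have "vector_derivative (\<lambda>s. polar (r s) s) (at s) = v s" for s
    by (rule vector_derivative_at[OF v])
  then have c: "curvature (\<lambda>s. polar (r s) s) s = (v s $ 1 * a $ 2 - v s $ 2 * a $ 1) / norm (v s) ^ 3"
    by (simp add: curvature_def Let_def vector_derivative_at[OF a])
  have cs: "cos s * cos s + sin s * sin s = 1"
    using sin_cos_squared_add3[of s] .
  have "v s $ 1 * a $ 2 - v s $ 2 * a $ 1 = ((r s)\<^sup>2 + 2 * (r' s)\<^sup>2 - r s * r'' s) * (cos s * cos s + sin s * sin s)"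
    unfolding v_def a_def vector_2 power2_eq_square by algebra
  moreover have "rsq (v s) = ((r s)\<^sup>2 + (r' s)\<^sup>2) * (cos s * cos s + sin s * sin s)"
    unfolding rsq_def v_def vector_2 power2_eq_square by algebra
  then have "norm (v s) = sqrt ((r s)\<^sup>2 + (r' s)\<^sup>2)"
    unfolding cs rsq_eq by (metis mult.right_neutral norm_ge_zero real_sqrt_unique)
  ultimately show ?thesis unfolding c cs by simp
qed

text \<open>In c = cos 2\<theta> the first-order curvature coefficient 39 c - 15 (2 c^2 - 1) peaks
  at c = 13/20, inside the quarter. The angle \<pi>/6, with c = 1/2, is close enough to the peak and
  has sines and cosines in closed form.\<close>

lemma curvature_bdry:
  "curvature (bdry_point t) 0 = ((1 + 12 * t)\<^sup>2 + (1 + 12 * t) * (36 * t)) / sqrt ((1 + 12 * t)\<^sup>2) ^ 3"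
  "curvature (bdry_point t) (pi / 6) = ((1 + 7 * t)\<^sup>2 + 726 * t\<^sup>2 + (1 + 7 * t) * (34 * t)) / sqrt ((1 + 7 * t)\<^sup>2 + 363 * t\<^sup>2) ^ 3"
  "curvature (bdry_point t) (pi / 2) = ((1 - 14 * t)\<^sup>2 - (1 - 14 * t) * (68 * t)) / sqrt ((1 - 14 * t)\<^sup>2) ^ 3"
proof -
  define r where "r s = 1 + t * zeta s" for s
  define r' where "r' s = t * (4 * sin (4 * s) - 26 * sin (2 * s))" for s
  define r'' where "r'' s = t * (16 * cos (4 * s) - 52 * cos (2 * s))" for s
  have c: "curvature (bdry_point t) s = ((r s)\<^sup>2 + 2 * (r' s)\<^sup>2 - r s * r'' s) / sqrt ((r s)\<^sup>2 + (r' s)\<^sup>2) ^ 3" for s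
    unfolding bdry_point_def[abs_def] r_def[symmetric]
    by (rule curvature_polar)
       (auto simp: r_def[abs_def] r'_def[abs_def] r''_def zeta_def intro!: derivative_eq_intros)
  have "r 0 = 1 + 12 * t" "r' 0 = 0" "r'' 0 = - 36 * t" by (simp_all add: r_def r'_def r''_def zeta_def)
  then show "curvature (bdry_point t) 0 = ((1 + 12 * t)\<^sup>2 + (1 + 12 * t) * (36 * t)) / sqrt ((1 + 12 * t)\<^sup>2) ^ 3"
    unfolding c by simp
  have "cos (2 * (pi / 2)) = -1" "cos (4 * (pi / 2)) = 1" "sin (2 * (pi / 2)) = 0" "sin (4 * (pi / 2)) = 0"
    by (simp_all flip: mult.commute[of pi])
  then have "r (pi/2) = 1 - 14 * t" "r' (pi/2) = 0" "r'' (pi/2) = 68 * t" unfolding r_def r'_def r''_def zeta_def by simp_all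
  then show "curvature (bdry_point t) (pi / 2) = ((1 - 14 * t)\<^sup>2 - (1 - 14 * t) * (68 * t)) / sqrt ((1 - 14 * t)\<^sup>2) ^ 3"
    unfolding c by simp
  have 2: "2 * (pi / 6) = pi / 3" and 4: "4 * (pi / 6) = pi - pi / 3" by simp_all
  have cs4: "cos (pi - pi / 3) = - (1/2)" "sin (pi - pi / 3) = sqrt 3 / 2"
    by (simp_all only: cos_pi_minus sin_pi_minus cos_60 sin_60)
  have "r (pi/6) = 1 + 7 * t" "r' (pi/6) = - 11 * sqrt 3 * t" "r'' (pi/6) = - 34 * t"
    unfolding r_def r'_def r''_def zeta_def 2 4 cs4 cos_60 sin_60 by (simp_all add: algebra_simps)
  then show "curvature (bdry_point t) (pi / 6) = ((1 + 7 * t)\<^sup>2 + 726 * t\<^sup>2 + (1 + 7 * t) * (34 * t)) / sqrt ((1 + 7 * t)\<^sup>2 + 363 * t\<^sup>2) ^ 3"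
    unfolding c by (simp add: power_mult_distrib)
qed

lemma curvature_not_monotone:
  "\<forall>\<^sub>F t in at_right 0. \<not> mono_on {0..pi/2} (curvature (bdry_point t)) \<and>
     \<not> antimono_on {0..pi/2} (curvature (bdry_point t))"
proof -
  \<comment> \<open>The two sides are 1 + 24 t and 1 + 27 t up to O(t^2); in the second comparison
    the left side is 1 - 54 t.\<close>
  have "\<forall>\<^sub>F t::real in at_right 0. ((1 + 12 * t)\<^sup>2 + (1 + 12 * t) * (36 * t)) / sqrt ((1 + 12 * t)\<^sup>2) ^ 3
      < ((1 + 7 * t)\<^sup>2 + 726 * t\<^sup>2 + (1 + 7 * t) * (34 * t)) / sqrt ((1 + 7 * t)\<^sup>2 + 363 * t\<^sup>2) ^ 3"
    by real_asymp
  moreover have "\<forall>\<^sub>F t::real in at_right 0. ((1 - 14 * t)\<^sup>2 - (1 - 14 * t) * (68 * t)) / sqrt ((1 - 14 * t)\<^sup>2) ^ 3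
      < ((1 + 7 * t)\<^sup>2 + 726 * t\<^sup>2 + (1 + 7 * t) * (34 * t)) / sqrt ((1 + 7 * t)\<^sup>2 + 363 * t\<^sup>2) ^ 3"
    by real_asymp
  ultimately show ?thesis
  proof eventually_elim
    case (elim t)
    then have k: "curvature (bdry_point t) 0 < curvature (bdry_point t) (pi / 6)"
      "curvature (bdry_point t) (pi / 2) < curvature (bdry_point t) (pi / 6)"
      by (simp_all only: curvature_bdry)
    have "\<not> mono_on {0..pi/2} (curvature (bdry_point t))"
    proof
      assume "mono_on {0..pi/2} (curvature (bdry_point t))"
      from mono_onD[OF this, of "pi/6" "pi/2"] show False using k by simp
    qed
    moreover have "\<not> antimono_on {0..pi/2} (curvature (bdry_point t))"
    proof
      assume "antimono_on {0..pi/2} (curvature (bdry_point t))"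
      from monotone_onD[OF this, of 0 "pi/6"] show False using k by simp
    qed
    ultimately show ?case ..
  qed
qed

lemma eventually_at_right_0D:
  "\<forall>\<^sub>F t::real in at_right 0. 0 < t \<longrightarrow> Q t \<Longrightarrow> \<exists>t0>0. \<forall>t. 0 < t \<and> t < t0 \<longrightarrow> Q t"
  unfolding eventually_at_right_field by blast

theorem proposition4p4:
  shows "\<exists>t0>0. \<forall>t. 0 < t \<and> t < t0 \<longrightarrow>
    bounded_smooth_domain (Omega t) \<and> symmetric_both_axes (Omega t) \<and>
    frontier (Omega t) = range (bdry_point t) \<and>
    Gamma_pp t = bdry_point t ` {0..pi/2} \<and>
    (\<exists>u. torsion_function (Omega t) u) \<and>
    (\<forall>u. torsion_function (Omega t) u \<longrightarrow>
      (\<exists>g. gradient_on (closure (Omega t)) u g \<and>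
        (strict_mono_on {0..pi/2} (\<lambda>\<theta>. norm (g (bdry_point t \<theta>))) \<or>
         strict_antimono_on {0..pi/2} (\<lambda>\<theta>. norm (g (bdry_point t \<theta>)))))) \<and>
    \<not> mono_on {0..pi/2} (curvature (bdry_point t)) \<and>
    \<not> antimono_on {0..pi/2} (curvature (bdry_point t))"
proof -
  have "\<forall>\<^sub>F t::real in at_right 0. t < 1/100"
    by (rule order_tendstoD(2)[OF tendsto_ident_at]) simp
  then have "\<forall>\<^sub>F t in at_right 0. 0 < t \<longrightarrow>
    bounded_smooth_domain (Omega t) \<and> symmetric_both_axes (Omega t) \<and>
    frontier (Omega t) = range (bdry_point t) \<and>
    Gamma_pp t = bdry_point t ` {0..pi/2} \<and>
    (\<exists>u. torsion_function (Omega t) u) \<and>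
    (\<forall>u. torsion_function (Omega t) u \<longrightarrow>
      (\<exists>g. gradient_on (closure (Omega t)) u g \<and>
        (strict_mono_on {0..pi/2} (\<lambda>\<theta>. norm (g (bdry_point t \<theta>))) \<or>
         strict_antimono_on {0..pi/2} (\<lambda>\<theta>. norm (g (bdry_point t \<theta>)))))) \<and>
    \<not> mono_on {0..pi/2} (curvature (bdry_point t)) \<and>
    \<not> antimono_on {0..pi/2} (curvature (bdry_point t))"
    using conformal_data curvature_not_monotone
  proof eventually_elim
    case (elim t)
    show ?case
    proof
      assume "0 < t"
      from elim(2) obtain a where a: "theod t a"
        "strict_mono_on {0..pi/2} (\<lambda>\<phi>. Re (grad2 a (of_real \<phi>)))"
        "\<And>z. z \<in> cball 0 (7/4) \<Longrightarrow> norm (deriv (cmap a) z - 1) \<le> 1/2"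
        "\<And>z. z \<in> cball 0 (7/4) \<Longrightarrow> norm (Pf a z) \<le> 1/4"
        "\<And>z. z \<in> cball 0 (7/4) \<Longrightarrow> norm (deriv (Pf a) z) \<le> 1/4" by blast
      interpret conf t a
        by unfold_locales (fact \<open>0 < t\<close> elim(1) a)+
      show "bounded_smooth_domain (Omega t) \<and> symmetric_both_axes (Omega t) \<and>
        frontier (Omega t) = range (bdry_point t) \<and>
        Gamma_pp t = bdry_point t ` {0..pi/2} \<and>
        (\<exists>u. torsion_function (Omega t) u) \<and>
        (\<forall>u. torsion_function (Omega t) u \<longrightarrow>
          (\<exists>g. gradient_on (closure (Omega t)) u g \<and>
            (strict_mono_on {0..pi/2} (\<lambda>\<theta>. norm (g (bdry_point t \<theta>))) \<or>
             strict_antimono_on {0..pi/2} (\<lambda>\<theta>. norm (g (bdry_point t \<theta>)))))) \<and>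
        \<not> mono_on {0..pi/2} (curvature (bdry_point t)) \<and>
        \<not> antimono_on {0..pi/2} (curvature (bdry_point t))"
      proof (intro conjI)
        show "\<exists>u. torsion_function (Omega t) u" by (rule exI[of _ tors]) (rule torsion_tors)
        \<comment> \<open>The increasing alternative holds. One field \<open>tgrad\<close> serves
          every \<open>u\<close>, because all torsion functions agree on the closure.\<close>
        show "\<forall>u. torsion_function (Omega t) u \<longrightarrow>
          (\<exists>g. gradient_on (closure (Omega t)) u g \<and>
            (strict_mono_on {0..pi/2} (\<lambda>\<theta>. norm (g (bdry_point t \<theta>))) \<or>
             strict_antimono_on {0..pi/2} (\<lambda>\<theta>. norm (g (bdry_point t \<theta>)))))"
          by (intro allI impI exI[of _ tgrad] conjI gradient_torsion disjI1 norm_tgrad_strict_mono)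
      qed (rule bounded_smooth_Omega symmetric_Omega frontier_Omega Gamma_pp_eq elim(3)[THEN conjunct1] elim(3)[THEN conjunct2])+
    qed
  qed
  then show ?thesis by (rule eventually_at_right_0D)
qed

end
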